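(* Let $S$ be the $2$-sphere or the real projective plane, and let $(G^+,G^-)$ be a normal pair of graphs in $S$ such that $G^+$ and $G^-$ intersect at least once. Then the width of $(G^+,G^-)$ is equal to two.
   Context: Graphs are finite and need not be simple (loops and multiple edges are allowed). Let $S$ be a closed surface and let $G^+$ and $G^-$ be two graphs embedded in it. The pair $(G^+,G^-)$ is a normal pair of graphs if $G^+$ and $G^-$ intersect only in the interior of edges, each edge of one intersects each edge of the other at most once, and all the intersections are transversal (the four branches coming out of an intersection point alternate between $G^+$ and $G^-$ when looked at cyclically). The common refinement $H$ of $G^+$ and $G^-$ is the embedded graph whose vertices are the vertices of $G^+$, the vertices of $G^-$, and the intersection points of $G^+$ and $G^-$, and whose edges are the pieces into which these points divide the edges of $G^+$ and of $G^-$. The width of the normal pair is the minimum distance, in the graph $H$ (number of edges of a path), from a vertex of $G^+$ to a vertex of $G^-$. *)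

theory Defs
  imports "HOL-Analysis.Analysis" "HOL-Library.Extended_Nat"
begin

definition is_two_sphere :: "'a topology \<Rightarrow> bool" where
  "is_two_sphere S \<longleftrightarrow> S homeomorphic_space top_of_set (sphere (0 :: real^3) 1)"

text \<open>The projective plane is the quotient of the sphere by the antipodal map; the space is
  described up to homeomorphism by its quotient projection.\<close>

definition is_projective_plane :: "'a topology \<Rightarrow> bool" where
  "is_projective_plane S \<longleftrightarrow>
     (\<exists>q. quotient_map (top_of_set (sphere (0 :: real^3) 1)) S q \<and>
          (\<forall>x \<in> sphere 0 1. \<forall>y \<in> sphere 0 1. q x = q y \<longleftrightarrow> x = y \<or> x = - y))"

text \<open>An edge is a path parametrised by the unit interval; only its values there matter.\<close>

record 'a embedded_graph =
  verts :: "'a set"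
  edges :: "(real \<Rightarrow> 'a) set"

definition support :: "'a embedded_graph \<Rightarrow> 'a set" where
  "support G = verts G \<union> (\<Union>e \<in> edges G. e ` {0..1})"

text \<open>Loops (\<open>e 0 = e 1\<close>) and multiple edges are allowed. Distinct edges have disjoint
  nonempty interiors, so no edge is listed twice with different parametrisations.\<close>

definition graph_embedded_in :: "'a embedded_graph \<Rightarrow> 'a topology \<Rightarrow> bool" where
  "graph_embedded_in G S \<longleftrightarrow>
     finite (verts G) \<and> verts G \<subseteq> topspace S \<and> finite (edges G) \<and>
     (\<forall>e \<in> edges G. pathin S e \<and> e 0 \<in> verts G \<and> e 1 \<in> verts G \<and>
        inj_on e {0<..<1} \<and> e ` {0<..<1} \<inter> verts G = {}) \<and>
     (\<forall>e \<in> edges G. \<forall>f \<in> edges G. e \<noteq> f \<longrightarrow> e ` {0<..<1} \<inter> f ` {0<..<1} = {})"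

text \<open>A chart around \<open>x\<close> straightens the four branches at \<open>x\<close> into the four half-axes of the disc,
  the two half-axes of the real line belonging to \<open>G\<close> and the two of the imaginary line to \<open>G'\<close>.
  Thus the branches alternate in the cyclic order around \<open>x\<close>.\<close>

definition transversal_at ::
  "'a topology \<Rightarrow> 'a embedded_graph \<Rightarrow> 'a embedded_graph \<Rightarrow> 'a \<Rightarrow> bool" where
  "transversal_at S G G' x \<longleftrightarrow>
     (\<exists>U \<phi>. openin S U \<and> x \<in> U \<and>
        homeomorphic_map (subtopology S U) (top_of_set (ball (0 :: complex) 1)) \<phi> \<and> \<phi> x = 0 \<and>
        \<phi> ` (U \<inter> support G) = {z \<in> ball 0 1. Im z = 0} \<and>
        \<phi> ` (U \<inter> support G') = {z \<in> ball 0 1. Re z = 0})"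

definition normal_pair :: "'a topology \<Rightarrow> 'a embedded_graph \<Rightarrow> 'a embedded_graph \<Rightarrow> bool" where
  "normal_pair S G G' \<longleftrightarrow>
     graph_embedded_in G S \<and> graph_embedded_in G' S \<and>
     support G \<inter> support G' \<inter> (verts G \<union> verts G') = {} \<and>
     (\<forall>e \<in> edges G. \<forall>f \<in> edges G'. \<forall>x \<in> e ` {0..1} \<inter> f ` {0..1}.
        \<forall>y \<in> e ` {0..1} \<inter> f ` {0..1}. x = y) \<and>
     (\<forall>x \<in> support G \<inter> support G'. transversal_at S G G' x)"

text \<open>The piece of \<open>e\<close> between the parameters \<open>s\<close> and \<open>t\<close>. The library's \<open>subpath\<close> is restricted to
  normed spaces.\<close>

definition edge_piece :: "real \<Rightarrow> real \<Rightarrow> (real \<Rightarrow> 'a) \<Rightarrow> real \<Rightarrow> 'a" where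
  "edge_piece s t e = (\<lambda>r. e ((1 - r) * s + r * t))"

definition refinement_verts :: "'a embedded_graph \<Rightarrow> 'a embedded_graph \<Rightarrow> 'a set" where
  "refinement_verts G G' = verts G \<union> verts G' \<union> (support G \<inter> support G')"

text \<open>The pieces run between consecutive dividing points of an edge.\<close>

definition common_refinement ::
  "'a embedded_graph \<Rightarrow> 'a embedded_graph \<Rightarrow> 'a embedded_graph" where
  "common_refinement G G' =
     \<lparr>verts = refinement_verts G G',
      edges = {edge_piece s t e | e s t.
        e \<in> edges G \<union> edges G' \<and> 0 \<le> s \<and> s < t \<and> t \<le> 1 \<and>
        e s \<in> refinement_verts G G' \<and> e t \<in> refinement_verts G G' \<and>
        e ` {s<..<t} \<inter> refinement_verts G G' = {}}\<rparr>"

definition adjacency :: "'a embedded_graph \<Rightarrow> ('a \<times> 'a) set" where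
  "adjacency G = {(u, v). \<exists>e \<in> edges G. (e 0 = u \<and> e 1 = v) \<or> (e 0 = v \<and> e 1 = u)}"

text \<open>\<open>\<infinity>\<close> if no path connects the two vertices.\<close>

definition graph_distance :: "'a embedded_graph \<Rightarrow> 'a \<Rightarrow> 'a \<Rightarrow> enat" where
  "graph_distance G u v = (INF n \<in> {n. (u, v) \<in> adjacency G ^^ n}. enat n)"

definition width :: "'a embedded_graph \<Rightarrow> 'a embedded_graph \<Rightarrow> enat" where
  "width G G' =
     (INF u \<in> verts G. INF v \<in> verts G'. graph_distance (common_refinement G G') u v)"

end

theory Submission
  imports Defs "HOL-Complex_Analysis.Winding_Numbers"
begin

text \<open>Call a crossing of an edge \<open>e\<close> of \<open>G\<^sup>+\<close> with an edge \<open>f\<close> of \<open>G\<^sup>-\<close> extremal on \<open>e\<close> if it is the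
first or the last crossing on \<open>e\<close>. A crossing that is extremal on both of its edges is joined by one
piece of \<open>e\<close> to a vertex of \<open>G\<^sup>+\<close> and by one piece of \<open>f\<close> to a vertex of \<open>G\<^sup>-\<close>, so the width is at
most two. It is at least two because an edge of the refinement lies in a single edge of one graph and
therefore cannot join vertices of both. Everything rests on the existence of a crossing that is
extremal on both of its edges.

Suppose that there is none. Discard the end pieces of the edges; the remaining pieces, the links, form
a graph in which, at every vertex, at least one of the two curves passes straight through. Imagine
that all crossings are at right angles. Then the angles around a vertex sum to \<open>2\<pi>\<close>, and a face with
\<open>k\<close> corners carries at most the curvature \<open>2\<pi> - k\<pi>/2\<close>, with equality for discs. Two edges meet at
most once, so no face has fewer than four corners and the curvature is nowhere positive. This
contradicts the Gauss-Bonnet formula on a surface of positive Euler characteristic.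

The proof below replaces the formula by the Jordan curve theorem in the plane. The sphere without a
point is a plane, and the projective plane is first lifted to the sphere; lifting preserves the
hypotheses and extremality. The turning of a cycle of links is the number of its convex corners minus
the number of its reflex corners, which for a disc without positive curvature should be at least 4.
A cycle of turning less than 4 has a reflex corner (it has at least four corners), and from there a
curve enters the inside of the cycle. Follow it, changing to the transversal curve when a curve ends,
alternately to the left and to the right. If this zigzag reaches the cycle again, it cuts the inside
into two parts whose boundaries have turnings of sum at most 4 more than before, so one of them is
less than 4 (\<open>theta_total_turning\<close>). If the zigzag meets itself, it closes up to a cycle whose
turns alternate, hence of turning at most 2 (\<open>zigzag_loop\<close>). In both cases the new cycle has a smaller
inside (\<open>smaller_cycle\<close>), which cannot go on forever. A zigzag from any link yields a first cycle of
turning at most 2, so there are no links at all (\<open>no_links\<close>), while the absence of an extremal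
crossing provides some.

There is no notion of left and right for topological curves here. What is used instead is that of the
two ways to turn at the end of a run along a curve, one never produces two convex corners in a row
(\<open>one_branch_safe\<close>); this is a statement about winding numbers (\<open>not_both_turns_convex\<close>).\<close>

section \<open>Arcs and Jordan curves in the plane\<close>

text \<open>Curves enter as point sets: the cycles and chains below are unions of links, and the parametrisation
of the union is irrelevant.\<close>

definition jordan :: "complex set \<Rightarrow> bool" where
  "jordan J \<longleftrightarrow> (\<exists>g. simple_path g \<and> pathfinish g = pathstart g \<and> path_image g = J)"

definition arc_between :: "complex set \<Rightarrow> complex \<Rightarrow> complex \<Rightarrow> bool" where
  "arc_between A p q \<longleftrightarrow> (\<exists>g. arc g \<and> pathstart g = p \<and> pathfinish g = q \<and> path_image g = A)"

lemma arc_betweenE: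
  assumes "arc_between A p q"
  obtains g where "arc g" "pathstart g = p" "pathfinish g = q" "path_image g = A"
  using assms unfolding arc_between_def by blast

lemma arc_betweenI:
  "arc g \<Longrightarrow> arc_between (path_image g) (pathstart g) (pathfinish g)"
  unfolding arc_between_def by blast

lemma jordan_facts:
  assumes "jordan J"
  shows "open (inside J)" "connected (inside J)" "open (outside J)" "connected (outside J)"
    "\<not> bounded (outside J)" "inside J \<inter> outside J = {}" "inside J \<union> outside J = - J"
    "frontier (inside J) = J" "frontier (outside J) = J" "inside J \<noteq> {}" "compact J" "J \<noteq> {}"
  using assms Jordan_inside_outside unfolding jordan_def
  by (auto intro: compact_simple_path_image)

lemma arc_between_facts:
  assumes "arc_between A p q"
  shows "compact A" "connected A" "p \<in> A" "q \<in> A" "p \<noteq> q" "connected (A - {p,q})" "A - {p,q} \<noteq> {}"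
proof -
  obtain g where g: "arc g" "pathstart g = p" "pathfinish g = q" "path_image g = A"
    using assms by (rule arc_betweenE)
  have s: "simple_path g" using g(1) by (rule arc_imp_simple_path)
  show "compact A" "connected A" "p \<in> A" "q \<in> A" "p \<noteq> q"
    using g compact_arc_image connected_arc_image pathstart_in_path_image pathfinish_in_path_image arc_distinct_ends
    by metis+
  show "connected (A - {p,q})" using connected_simple_path_endless[OF s] g by simp
  show "A - {p,q} \<noteq> {}" using nonempty_simple_path_endless[OF s] g by simp
qed

lemma arc_between_connected_minus_end:
  assumes "arc_between A p q"
  shows "connected (A - {q})"
proof -
  obtain g where g: "arc g" "pathstart g = p" "pathfinish g = q" "path_image g = A"
    using assms by (rule arc_betweenE)
  have inj: "inj_on g {0..1}" and c: "continuous_on {0..1} g"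
    using g(1) unfolding arc_def path_def by auto
  have "A - {q} = g ` {0..<1}"
  proof
    show "A - {q} \<subseteq> g ` {0..<1}"
      using g(3,4) unfolding path_image_def pathfinish_def by (auto simp: order.order_iff_strict)
    show "g ` {0..<1} \<subseteq> A - {q}"
    proof
      fix x assume "x \<in> g ` {0..<1}"
      then obtain a where a: "a \<in> {0..<1}" "x = g a" by blast
      then have "x \<noteq> q" using inj_onD[OF inj, of a 1] g(3) unfolding pathfinish_def by auto
      moreover have "x \<in> A" using a g(4) unfolding path_image_def by auto
      ultimately show "x \<in> A - {q}" by blast
    qed
  qed
  moreover have "continuous_on {0..<1} g" using c by (rule continuous_on_subset) auto
  ultimately show ?thesis by (metis connected_continuous_image connected_Ico)
qed

lemma arc_between_initial:
  assumes "arc_between A p q" "r \<in> A" "r \<noteq> p" "r \<noteq> q"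
  obtains B where "arc_between B p r" "B \<subseteq> A" "q \<notin> B"
proof -
  obtain g where g: "arc g" "pathstart g = p" "pathfinish g = q" "path_image g = A"
    using assms(1) by (rule arc_betweenE)
  have inj: "inj_on g {0..1}" using g(1) unfolding arc_def by auto
  obtain u where u: "u \<in> {0..1}" "g u = r" using assms(2) g(4) unfolding path_image_def by blast
  have u': "0 < u" "u < 1" using u assms(3,4) g(2,3) unfolding pathstart_def pathfinish_def
    by (metis atLeastAtMost_iff less_eq_real_def)+
  have im: "path_image (subpath 0 u g) = g ` {0..u}" using u' by (simp add: path_image_subpath)
  have a: "arc (subpath 0 u g)" using arc_subpath_arc[OF g(1), of 0 u] u' by simp
  have s: "pathstart (subpath 0 u g) = p" "pathfinish (subpath 0 u g) = r"
    using g(2) u(2) unfolding pathstart_def by (simp_all add: pathfinish_def subpath_def)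
  have "arc_between (g ` {0..u}) p r" using arc_betweenI[OF a] s im by simp
  moreover have "g ` {0..u} \<subseteq> A" using u' g(4) unfolding path_image_def by auto
  moreover have "q \<notin> g ` {0..u}"
  proof
    assume "q \<in> g ` {0..u}"
    then obtain v where "v \<in> {0..u}" "g v = g 1" using g(3) unfolding pathfinish_def by auto
    then show False using inj_onD[OF inj, of v 1] u' by auto
  qed
  ultimately show thesis using that by blast
qed

lemma connected_insert_closure:
  fixes x :: complex
  assumes "connected (insert x T)" "T \<noteq> {}"
  shows "x \<in> closure T"
proof (cases "x \<in> T")
  case False
  then obtain t where "t \<in> T" "t \<noteq> x" using assms(2) by blast
  then have "x islimpt insert x T"
    using connected_imp_perfect[OF assms(1) insertI1] by blast
  then show ?thesis unfolding closure_def by (simp add: islimpt_insert)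
qed (use closure_subset in blast)

lemma arc_between_sym: "arc_between A p q \<Longrightarrow> arc_between A q p"
  unfolding arc_between_def
  by (metis arc_reversepath path_image_reversepath pathfinish_reversepath pathstart_reversepath)

lemma arc_between_join:
  assumes "arc_between A p q" "arc_between B q r" "A \<inter> B = {q}"
  shows "arc_between (A \<union> B) p r"
proof -
  obtain g where g: "arc g" "pathstart g = p" "pathfinish g = q" "path_image g = A"
    using assms(1) by (rule arc_betweenE)
  obtain h where h: "arc h" "pathstart h = q" "pathfinish h = r" "path_image h = B"
    using assms(2) by (rule arc_betweenE)
  have "arc (g +++ h)"
    using arc_join[OF g(1) h(1)] g h assms(3) by auto
  moreover have "path_image (g +++ h) = A \<union> B" using g h by (simp add: path_image_join)
  ultimately show ?thesis unfolding arc_between_def using g h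
    by (metis pathfinish_join pathstart_join)
qed

lemma jordan_join:
  assumes "arc_between A p q" "arc_between B q p" "A \<inter> B = {p,q}"
  shows "jordan (A \<union> B)"
proof -
  obtain g where g: "arc g" "pathstart g = p" "pathfinish g = q" "path_image g = A"
    using assms(1) by (rule arc_betweenE)
  obtain h where h: "arc h" "pathstart h = q" "pathfinish h = p" "path_image h = B"
    using assms(2) by (rule arc_betweenE)
  have "simple_path (g +++ h)"
    using simple_path_join_loop[OF g(1) h(1)] g h assms(3) by auto
  moreover have "path_image (g +++ h) = A \<union> B" using g h by (simp add: path_image_join)
  ultimately show ?thesis unfolding jordan_def using g h
    by (metis pathfinish_join pathstart_join)
qed

text \<open>An arc is irreducible between its end points: pulled back to the unit interval, a connected set
containing both ends is everything.\<close>

lemma arc_between_subset_eq: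
  assumes "arc_between U p q" "connected A" "p \<in> A" "q \<in> A" "A \<subseteq> U"
  shows "A = U"
proof -
  obtain g where g: "arc g" "pathstart g = p" "pathfinish g = q" "path_image g = U"
    using assms(1) by (rule arc_betweenE)
  obtain h where h: "homeomorphism {0..1} (path_image g) g h"
    using homeomorphism_arc[OF g(1)] by blast
  have "continuous_on A h" using h assms(5) g(4) unfolding homeomorphism_def
    by (auto intro: continuous_on_subset)
  then have c: "connected (h ` A)" using assms(2) by (rule connected_continuous_image)
  have h0: "h p = 0" "h q = 1"
    using homeomorphism_apply1[OF h, of 0] homeomorphism_apply1[OF h, of 1] g(2,3)
    unfolding pathstart_def pathfinish_def by auto
  have "0 \<in> h ` A" "1 \<in> h ` A" using h0 assms(3,4) by (simp_all add: rev_image_eqI)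
  then have *: "{0..1} \<subseteq> h ` A"
    using connected_contains_Icc[OF c] by blast
  have "g ` {0..1} \<subseteq> A"
  proof
    fix x assume "x \<in> g ` {0..1}"
    then obtain a where "a \<in> A" "x = g (h a)" using * by blast
    then show "x \<in> A" using homeomorphism_apply2[OF h, of a] assms(5) g(4) by auto
  qed
  then show ?thesis using g(4) assms(5) unfolding path_image_def by blast
qed

lemma jordan_double_arc:
  assumes "jordan J" "p \<in> J" "q \<in> J" "p \<noteq> q"
  obtains U D where "arc_between U p q" "arc_between D q p" "U \<inter> D = {p,q}" "U \<union> D = J"
proof -
  obtain g where g: "simple_path g" "pathfinish g = pathstart g" "path_image g = J"
    using assms(1) unfolding jordan_def by blast
  obtain u d where "arc u" "arc d" "pathstart u = p" "pathfinish u = q" "pathstart d = q" "pathfinish d = p"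
    "path_image u \<inter> path_image d = {p,q}" "path_image u \<union> path_image d = path_image g"
    by (rule exists_double_arc[OF g(1,2), of p q]) (use assms g in auto)
  then show thesis
    using that[of "path_image u" "path_image d"] g(3) arc_betweenI[of u] arc_betweenI[of d] by simp
qed

lemma connected_in_double_arc:
  assumes "arc_between U p q" "arc_between D q p" "U \<inter> D = {p,q}"
    "connected T" "T \<subseteq> U \<union> D" "p \<notin> T" "q \<notin> T" "T \<inter> U \<noteq> {}"
  shows "T \<subseteq> U"
proof -
  have cl: "closed U" "closed D"
    using arc_between_facts(1)[OF assms(1)] arc_between_facts(1)[OF assms(2)] compact_imp_closed
      by auto
  have "U \<inter> D \<inter> T = {}" using assms(3,6,7) by auto
  then have "U \<inter> T = {} \<or> D \<inter> T = {}"
    using connected_closedD[OF assms(4) _ assms(5) cl] by blast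
  then show ?thesis using assms(5,8) by blast
qed

text \<open>The two arcs into which the ends of \<open>A\<close> cut \<open>L\<close> are only known to exist; irreducibility of arcs
identifies one of them with \<open>A\<close>.\<close>

lemma jordan_complementary_arc:
  assumes "jordan L" "arc_between A p q" "A \<subseteq> L"
  obtains B where "arc_between B q p" "A \<inter> B = {p,q}" "A \<union> B = L"
proof -
  note f = arc_between_facts[OF assms(2)]
  obtain U D where UD: "arc_between U p q" "arc_between D q p" "U \<inter> D = {p,q}" "U \<union> D = L"
    using jordan_double_arc[of L p q] assms f by blast
  have A: "A = insert p (insert q (A - {p,q}))" using f by blast
  show thesis
  proof (cases "(A - {p,q}) \<inter> U = {}")
    case False
    have "A - {p,q} \<subseteq> U"
      using connected_in_double_arc[OF UD(1-3), of "A - {p,q}"] f assms UD False by blast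
    then have "A \<subseteq> U" using A arc_between_facts(3,4)[OF UD(1)] by blast
    then have "A = U" using arc_between_subset_eq[OF UD(1)] f by blast
    then show thesis using that UD by blast
  next
    case True
    then have "A - {p,q} \<subseteq> D" using assms UD by blast
    then have "A \<subseteq> D" using A arc_between_facts(3,4)[OF UD(2)] by blast
    then have "A = D" using arc_between_subset_eq[OF UD(2)] f by blast
    then show thesis using that[of U] UD arc_between_sym by (metis Un_commute Int_commute)
  qed
qed

lemma connected_subset_inside:
  assumes "jordan J" "connected T" "T \<inter> J = {}" "T \<inter> inside J \<noteq> {}"
  shows "T \<subseteq> inside J"
  using inside_outside_intersect_connected[of T J] assms jordan_facts(7)[OF assms(1)] by blast

lemma connected_subset_outside:
  assumes "jordan J" "connected T" "T \<inter> J = {}" "T \<inter> inside J = {}"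
  shows "T \<subseteq> outside J"
  using assms jordan_facts(7)[OF assms(1)] by blast

text \<open>The unbounded connected set \<open>outside J\<close> does not meet \<open>L\<close>, so it cannot lie in the bounded set
\<open>inside L\<close>.\<close>

lemma inside_jordan_subset:
  assumes "jordan J" "jordan L" "L \<subseteq> J \<union> inside J"
  shows "inside L \<subseteq> inside J"
proof -
  have "outside J \<subseteq> outside L"
  proof -
    have "outside J \<inter> inside L = {}"
    proof (rule ccontr)
      assume "outside J \<inter> inside L \<noteq> {}"
      moreover have "outside J \<inter> L = {}" using assms jordan_facts(6,7)[OF assms(1)] by blast
      ultimately have "outside J \<subseteq> inside L"
        using connected_subset_inside[OF assms(2) jordan_facts(4)[OF assms(1)]] by blast
      moreover have "bounded (inside L)"
        using jordan_facts(11)[OF assms(2)] bounded_inside compact_imp_bounded by blast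
      ultimately show False using jordan_facts(5)[OF assms(1)] bounded_subset by blast
    qed
    moreover have "outside J \<inter> L = {}" using assms jordan_facts(6,7)[OF assms(1)] by blast
    ultimately show ?thesis using jordan_facts(7)[OF assms(2)] by blast
  qed
  then have *: "inside L \<subseteq> J \<union> inside J"
    using jordan_facts(6,7)[OF assms(2)] jordan_facts(7)[OF assms(1)] by blast
  have "inside L \<inter> J = {}"
  proof (rule ccontr)
    assume "inside L \<inter> J \<noteq> {}"
    then have "inside L \<inter> closure (outside J) \<noteq> {}"
      using jordan_facts(9)[OF assms(1)] unfolding frontier_def by blast
    then have "inside L \<inter> outside J \<noteq> {}"
      using open_Int_closure_eq_empty[OF jordan_facts(1)[OF assms(2)]] by blast
    then show False using \<open>outside J \<subseteq> outside L\<close> jordan_facts(6)[OF assms(2)] by blast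
  qed
  then show ?thesis using * by blast
qed

lemma inside_jordan_psubset:
  assumes "jordan J" "jordan L" "L \<subseteq> J \<union> inside J" "L \<noteq> J"
  shows "inside L \<subset> inside J"
  using inside_jordan_subset[OF assms(1-3)] assms(4) jordan_facts(8)[OF assms(1)] jordan_facts(8)[OF assms(2)]
  by (metis psubsetI)

text \<open>The theorem on theta curves for curves given as point sets.\<close>

lemma theta_split:
  assumes A: "arc_between A p q" and B: "arc_between B p q" and P: "arc_between P p q"
    and i: "A \<inter> B = {p,q}" "A \<inter> P = {p,q}" "B \<inter> P = {p,q}"
    and ne: "P \<inter> inside (A \<union> B) \<noteq> {}"
  shows "inside (A \<union> P) \<inter> inside (B \<union> P) = {}"
    "inside (A \<union> P) \<union> inside (B \<union> P) \<union> (P - {p,q}) = inside (A \<union> B)"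
proof -
  obtain a where a: "arc a" "pathstart a = p" "pathfinish a = q" "path_image a = A"
    using A by (rule arc_betweenE)
  obtain b where b: "arc b" "pathstart b = p" "pathfinish b = q" "path_image b = B"
    using B by (rule arc_betweenE)
  obtain c where c: "arc c" "pathstart c = p" "pathfinish c = q" "path_image c = P"
    using P by (rule arc_betweenE)
  have "p \<noteq> q" using arc_between_facts(5)[OF A] .
  note split_inside_simple_closed_curve[OF arc_imp_simple_path[OF a(1)] a(2,3) arc_imp_simple_path[OF b(1)] b(2,3)
    arc_imp_simple_path[OF c(1)] c(2,3) this, unfolded a(4) b(4) c(4), OF i ne]
  then show "inside (A \<union> P) \<inter> inside (B \<union> P) = {}"
    "inside (A \<union> P) \<union> inside (B \<union> P) \<union> (P - {p,q}) = inside (A \<union> B)" by metis+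
qed

text \<open>Splitting the winding number over two arcs makes Jordan curves with a common arc comparable: the
contribution of the common arc cancels in the difference.\<close>

lemma jordan_orientation:
  assumes "arc a" "arc b" "pathfinish a = pathstart b" "pathfinish b = pathstart a"
    "path_image a \<inter> path_image b = {pathstart a, pathfinish a}"
    "path_image a \<union> path_image b = L"
  obtains \<epsilon> :: complex where "\<epsilon> = 1 \<or> \<epsilon> = -1"
    "\<And>z. z \<in> inside L \<Longrightarrow> winding_number a z + winding_number b z = \<epsilon>"
    "\<And>z. z \<in> outside L \<Longrightarrow> winding_number a z + winding_number b z = 0"
proof -
  have s: "simple_path (a +++ b)"
    using simple_path_join_loop[OF assms(1,2)] assms by auto
  have im: "path_image (a +++ b) = L" using assms by (simp add: path_image_join)
  have l: "pathfinish (a +++ b) = pathstart (a +++ b)" using assms by simp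
  have add: "winding_number (a +++ b) z = winding_number a z + winding_number b z" if "z \<notin> L" for z
    using winding_number_join[of a z b] assms that arc_imp_path by auto
  have n: "z \<notin> L" if "z \<in> inside L \<or> z \<in> outside L" for z
    using that inside_no_overlap[of L] outside_no_overlap[of L] by blast
  have out: "\<And>z. z \<in> outside L \<Longrightarrow> winding_number a z + winding_number b z = 0"
    using winding_number_zero_in_outside[OF simple_path_imp_path[OF s] l] im add n by metis
  obtain \<epsilon> :: complex where e: "\<epsilon> = 1 \<or> \<epsilon> = -1"
    "\<And>z. z \<in> inside L \<Longrightarrow> winding_number (a +++ b) z = \<epsilon>"
    using simple_closed_path_winding_number_inside[OF s] im by metis
  then show thesis using that[of \<epsilon>] out add n by metis
qed

lemma frontier_point_near:
  assumes "x \<in> frontier S" "open U" "x \<in> U"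
  obtains z where "z \<in> S" "z \<in> U"
proof -
  have "U \<inter> closure S \<noteq> {}" using assms unfolding frontier_def by blast
  then have "U \<inter> S \<noteq> {}" using open_Int_closure_eq_empty[OF assms(2)] by blast
  then show thesis using that by blast
qed

section \<open>The orientation argument\<close>

text \<open>The substitute for left and right. Two Jordan curves share the arc \<open>A\<close> up to \<open>t\<close>; there \<open>L\<close> continues
along \<open>\<beta>\<close> and \<open>L'\<close> along \<open>\<beta>'\<close>. A branch \<open>E\<close> leaves \<open>A\<close> at \<open>m\<close> and is outside both curves, as is at \<open>t\<close>
the branch taken by the other curve: this would be a convex corner at \<open>m\<close> followed
  by a convex corner
at \<open>t\<close> for both choices of the branch.

The difference \<open>c\<close> of the two winding numbers depends only on the parts \<open>B\<close>, \<open>B'\<close> of the curves away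
from \<open>A\<close>. It vanishes along \<open>E\<close>, hence around \<open>m\<close>, so both curves have the same orientation \<open>\<epsilon>\<close>. Around \<open>t\<close>
it then takes the values \<open>\<epsilon>\<close> (inside \<open>L\<close>, near \<open>\<beta>\<close>), \<open>-\<epsilon>\<close> (inside \<open>L'\<close>, near \<open>\<beta>'\<close>) and \<open>0\<close> (outside both).
But \<open>\<beta>\<close> and \<open>\<beta>'\<close> together divide a neighbourhood \<open>N\<close> of \<open>t\<close> into only two connected parts, and \<open>c\<close> is
constant on each of them.\<close>

lemma not_both_turns_convex:
  assumes L: "jordan L" and L': "jordan L'"
    and A: "arc_between A o' t" "A \<subseteq> L" "A \<subseteq> L'"
    and m: "m \<in> A - {o',t}" and E: "connected (insert m E)" "E \<noteq> {}" "E \<subseteq> outside L" "E \<subseteq> outside L'"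
    and N: "open N" "t \<in> N" "o' \<notin> N" "N \<inter> L \<subseteq> A \<union> \<beta>" "N \<inter> L' \<subseteq> A \<union> \<beta>'"
    and \<beta>: "\<beta> \<subseteq> L" "\<beta>' \<subseteq> L'" "t \<in> \<beta>"
    and b: "b \<in> N" "b \<in> \<beta>" "b \<in> outside L'" and b': "b' \<in> N" "b' \<in> \<beta>'" "b' \<in> outside L"
    and H: "N - (\<beta> \<union> \<beta>') = H1 \<union> H2" "connected H1" "connected H2"
  shows False
proof -
  obtain a where a: "arc a" "pathstart a = o'" "pathfinish a = t" "path_image a = A"
    using A(1) by (rule arc_betweenE)
  obtain B where B: "arc_between B t o'" "A \<inter> B = {o',t}" "A \<union> B = L"
    using jordan_complementary_arc[OF L A(1,2)] by blast
  obtain B' where B': "arc_between B' t o'" "A \<inter> B' = {o',t}" "A \<union> B' = L'"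
    using jordan_complementary_arc[OF L' A(1,3)] by blast
  obtain g where g: "arc g" "pathstart g = t" "pathfinish g = o'" "path_image g = B"
    using B(1) by (rule arc_betweenE)
  obtain g' where g': "arc g'" "pathstart g' = t" "pathfinish g' = o'" "path_image g' = B'"
    using B'(1) by (rule arc_betweenE)
  obtain \<epsilon> :: complex where e: "\<epsilon> = 1 \<or> \<epsilon> = -1"
    "\<And>z. z \<in> inside L \<Longrightarrow> winding_number a z + winding_number g z = \<epsilon>"
    "\<And>z. z \<in> outside L \<Longrightarrow> winding_number a z + winding_number g z = 0"
    using jordan_orientation[of a g L] a g B by auto
  obtain \<epsilon>' :: complex where e': "\<epsilon>' = 1 \<or> \<epsilon>' = -1"
    "\<And>z. z \<in> inside L' \<Longrightarrow> winding_number a z + winding_number g' z = \<epsilon>'"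
    "\<And>z. z \<in> outside L' \<Longrightarrow> winding_number a z + winding_number g' z = 0"
    using jordan_orientation[of a g' L'] a g' B' by auto
  define c where "c z = winding_number g z - winding_number g' z" for z
  have const: "c y = c z" if "connected T" "y \<in> T" "z \<in> T" "T \<inter> (B \<union> B') = {}" for T y z
  proof -
    have p: "path g" "path (reversepath g')" using g g' arc_imp_path by auto
    have *: "winding_number (g +++ reversepath g') w = c w" if "w \<in> T" for w
    proof -
      have n: "w \<notin> path_image g" "w \<notin> path_image g'" using \<open>T \<inter> _ = {}\<close> that g g' by auto
      have "winding_number (g +++ reversepath g') w = winding_number g w + winding_number (reversepath g') w"
        using winding_number_join[OF p(1) n(1) p(2)] n(2) g g' by simp
      then show ?thesis using winding_number_reversepath[OF arc_imp_path[OF g'(1)] n(2)]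
        unfolding c_def by simp
    qed
    have "winding_number (g +++ reversepath g') y = winding_number (g +++ reversepath g') z"
      using winding_number_eq[of "g +++ reversepath g'" y T z] p g g' that
      by (auto simp: path_image_join)
    then show ?thesis using * that by simp
  qed
  have cd: "c z = (winding_number a z + winding_number g z) - (winding_number a z + winding_number g' z)" for z
    unfolding c_def by simp
  have BL: "B \<subseteq> L" "B' \<subseteq> L'" using B B' by auto
  have out: "outside L \<inter> L = {}" "outside L' \<inter> L' = {}" "inside L \<inter> L = {}" "inside L' \<inter> L' = {}"
    using outside_no_overlap inside_no_overlap by blast+
  \<comment> \<open>Near \<open>m\<close> both curves coincide with \<open>A\<close>, so a point inside \<open>L\<close> close to \<open>m\<close> is off \<open>L'\<close>, and \<open>c = 0\<close> there.\<close>
  have "\<epsilon> = \<epsilon>'"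
  proof -
    obtain x where x: "x \<in> E" using E by blast
    have "c x = 0" using x E e(3) e'(3) unfolding cd by (metis subsetD diff_self)
    have dj: "m \<notin> B" "m \<notin> B'" using m B B' by auto
    have "E \<inter> B = {}" "E \<inter> B' = {}" using E(3,4) out(1,2) BL by blast+
    then have "insert m E \<inter> (B \<union> B') = {}" using dj by auto
    then have "c m = 0" using const[OF E(1), of m x] x \<open>c x = 0\<close> by auto
    have "open (- (B \<union> B'))"
      using arc_between_facts(1)[OF B(1)] arc_between_facts(1)[OF B'(1)] compact_imp_closed
      by (intro open_Compl closed_Un) auto
    then obtain r where r: "r > 0" "ball m r \<subseteq> - (B \<union> B')"
      using dj openE by (metis ComplI Un_iff)
    have "m \<in> L" using m A by blast
    then have "m \<in> frontier (inside L)" using jordan_facts(8)[OF L] by simp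
    then obtain z where z: "z \<in> inside L" "z \<in> ball m r"
      using frontier_point_near[of m "inside L" "ball m r"] r by auto
    have cz: "c z = 0" using const[of "ball m r" z m] z r \<open>c m = 0\<close> by auto
    have "z \<notin> A" using z A out by blast
    then have "z \<notin> L'" using z r B'(3) by blast
    moreover have "z \<notin> outside L'"
      using cz e(1) e(2)[OF z(1)] e'(3)[of z] unfolding cd by auto
    ultimately have "z \<in> inside L'" using jordan_facts(7)[OF L'] by blast
    then show ?thesis using cz e(2)[OF z(1)] e'(2)[of z] unfolding cd by simp
  qed
  have avoid: "H1 \<inter> (B \<union> B') = {}" "H2 \<inter> (B \<union> B') = {}"
  proof -
    have "z \<in> \<beta> \<union> \<beta>'" if z: "z \<in> N" "z \<in> B \<union> B'" for z
    proof (cases "z \<in> A")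
      case True
      then have "z = o' \<or> z = t" using z(2) B(2) B'(2) by blast
      then show ?thesis using N(3) z(1) \<beta>(3) by blast
    next
      case False
      then show ?thesis using z N(4,5) BL by blast
    qed
    then have "(N - (\<beta> \<union> \<beta>')) \<inter> (B \<union> B') = {}" by blast
    then show "H1 \<inter> (B \<union> B') = {}" "H2 \<inter> (B \<union> B') = {}" using H(1) by blast+
  qed
  \<comment> \<open>Every point of a Jordan curve is a limit of points on either side; this gives one point for each value of \<open>c\<close>.\<close>
  have "open (N \<inter> outside L')" using N(1) jordan_facts(3)[OF L'] by blast
  have "b \<in> L" using b \<beta> by blast
  obtain z1 where z1: "z1 \<in> inside L" "z1 \<in> N \<inter> outside L'"
    using frontier_point_near[of b "inside L" "N \<inter> outside L'"] \<open>open (N \<inter> outside L')\<close> \<open>b \<in> L\<close> b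
      jordan_facts(8)[OF L] by auto
  obtain z0 where z0: "z0 \<in> outside L" "z0 \<in> N \<inter> outside L'"
    using frontier_point_near[of b "outside L" "N \<inter> outside L'"] \<open>open (N \<inter> outside L')\<close> \<open>b \<in> L\<close> b
      jordan_facts(9)[OF L] by auto
  have "open (N \<inter> outside L)" using N(1) jordan_facts(3)[OF L] by blast
  have "b' \<in> L'" using b' \<beta> by blast
  obtain z2 where z2: "z2 \<in> inside L'" "z2 \<in> N \<inter> outside L"
    using frontier_point_near[of b' "inside L'" "N \<inter> outside L"] \<open>open (N \<inter> outside L)\<close> \<open>b' \<in> L'\<close> b'
      jordan_facts(8)[OF L'] by auto
  have c: "c z1 = \<epsilon>" "c z0 = 0" "c z2 = - \<epsilon>"
    using z1 z0 z2 e e' \<open>\<epsilon> = \<epsilon>'\<close> unfolding cd by auto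
  have mem: "z \<in> H1 \<union> H2" if "z \<in> N" "z \<notin> L" "z \<notin> L'" for z
  proof -
    have "z \<notin> \<beta> \<union> \<beta>'" using that(2,3) \<beta>(1,2) by auto
    then show ?thesis using that(1) H(1) by auto
  qed
  have "z1 \<notin> L" "z0 \<notin> L" "z2 \<notin> L" "z1 \<notin> L'" "z0 \<notin> L'" "z2 \<notin> L'"
    using z1 z0 z2 out unfolding disjoint_iff by blast+
  then have "z1 \<in> H1 \<union> H2" "z0 \<in> H1 \<union> H2" "z2 \<in> H1 \<union> H2"
    using mem z1 z0 z2 by auto
  moreover have "c z1 \<noteq> c z0" "c z1 \<noteq> c z2" "c z0 \<noteq> c z2"
    using c e(1) by auto
  ultimately show False
    using const[OF H(2) _ _ avoid(1)] const[OF H(3) _ _ avoid(2)] by (metis UnE)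
qed

section \<open>Links, chains and cycles\<close>

text \<open>What remains of the two graphs after the end pieces of all edges are discarded. The colour of a link
says which graph it comes from. The assumption \<open>passes\<close> is the absence of a crossing that is extremal
on both of its edges: one of the two curves both enters and leaves. The assumption \<open>four_corners\<close> is where two
edges meet at most once.\<close>

locale link_system =
  fixes \<Lambda> :: "'l set" and img :: "'l \<Rightarrow> complex set" and X :: "complex set" and colour :: "'l \<Rightarrow> bool"
  assumes finite_links: "finite \<Lambda>" and finite_X: "finite X"
    and link: "\<And>l. l \<in> \<Lambda> \<Longrightarrow> \<exists>p q. arc_between (img l) p q \<and> img l \<inter> X = {p,q}"
    and link_disjoint: "\<And>l m. \<lbrakk>l \<in> \<Lambda>; m \<in> \<Lambda>; l \<noteq> m\<rbrakk> \<Longrightarrow> img l \<inter> img m \<subseteq> X"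
    and passes: "\<And>x. x \<in> X \<Longrightarrow> \<exists>s. card {l \<in> \<Lambda>. x \<in> img l \<and> colour l = s} = 2"
    and two_sided: "\<And>x s \<beta> \<beta>' W. \<lbrakk>x \<in> X; {l \<in> \<Lambda>. x \<in> img l \<and> colour l = s} = {\<beta>, \<beta>'}; \<beta> \<noteq> \<beta>'; open W; x \<in> W\<rbrakk>
      \<Longrightarrow> \<exists>N H1 H2. open N \<and> x \<in> N \<and> N \<subseteq> W \<and> connected H1 \<and> connected H2 \<and>
            N - (img \<beta> \<union> img \<beta>') = H1 \<union> H2"
    and four_corners: "\<And>C. \<lbrakk>C \<subseteq> \<Lambda>; C \<noteq> {}; \<And>x l. x \<in> X \<Longrightarrow> l \<in> C \<Longrightarrow> x \<in> img l \<Longrightarrow> \<exists>m\<in>C. m \<noteq> l \<and> x \<in> img m\<rbrakk>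
      \<Longrightarrow> 4 \<le> card {x \<in> X. \<exists>a\<in>C. \<exists>b\<in>C. x \<in> img a \<and> x \<in> img b \<and> colour a \<noteq> colour b}"
begin

definition star :: "complex \<Rightarrow> bool \<Rightarrow> 'l set" where
  "star x s = {l \<in> \<Lambda>. x \<in> img l \<and> colour l = s}"

definition supp :: "'l set \<Rightarrow> complex set" where
  "supp C = (\<Union>l\<in>C. img l)"

abbreviation disc :: "'l set \<Rightarrow> complex set" where
  "disc C \<equiv> inside (supp C)"

definition inc :: "'l set \<Rightarrow> complex \<Rightarrow> 'l set" where
  "inc C x = {l \<in> C. x \<in> img l}"

text \<open>Links of the same colour at a point belong to the same curve, so a cycle changes colour exactly where
it leaves a curve.\<close>

definition corner :: "'l set \<Rightarrow> complex \<Rightarrow> bool" where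
  "corner C x \<longleftrightarrow> (\<exists>a\<in>inc C x. \<exists>b\<in>inc C x. colour a \<noteq> colour b)"

text \<open>The degree condition is kept in the definition since it is not evident from the topology of the
union; the same applies to chains.\<close>

definition cycle :: "'l set \<Rightarrow> bool" where
  "cycle C \<longleftrightarrow> C \<subseteq> \<Lambda> \<and> jordan (supp C) \<and> (\<forall>x\<in>X \<inter> supp C. card (inc C x) = 2)"

definition chain :: "'l set \<Rightarrow> complex \<Rightarrow> complex \<Rightarrow> bool" where
  "chain P p q \<longleftrightarrow> P \<subseteq> \<Lambda> \<and> arc_between (supp P) p q \<and> p \<in> X \<and> q \<in> X \<and>
     card (inc P p) = 1 \<and> card (inc P q) = 1 \<and> (\<forall>x\<in>X \<inter> supp P - {p,q}. card (inc P x) = 2)"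

text \<open>This avoids angles. At a corner at least one of the two curves passes straight through, so there is a
third branch. The interior angle at the corner is reflex if and only if such a branch enters the
inside.\<close>

definition reflex :: "'l set \<Rightarrow> complex \<Rightarrow> bool" where
  "reflex C x \<longleftrightarrow> (\<exists>l\<in>\<Lambda> - C. x \<in> img l \<and> img l - X \<subseteq> disc C)"

definition turning :: "'l set \<Rightarrow> complex \<Rightarrow> int" where
  "turning C x = (if corner C x then if reflex C x then -1 else 1 else 0)"

text \<open>The number of convex corners minus the number of reflex corners; up to a factor \<open>\<pi>/2\<close> the total turning
of the boundary of the inside.\<close>

definition total_turning :: "'l set \<Rightarrow> int" where
  "total_turning C = (\<Sum>x\<in>X \<inter> supp C. turning C x)"

lemma turning_bounds: "-1 \<le> turning C x" "turning C x \<le> 1"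
  unfolding turning_def by auto

lemma turning_eq_1: "turning C x = 1 \<longleftrightarrow> corner C x \<and> \<not> reflex C x"
  unfolding turning_def by auto

lemma finite_sub: "C \<subseteq> \<Lambda> \<Longrightarrow> finite C"
  using finite_links finite_subset by blast

lemma finite_inc: "C \<subseteq> \<Lambda> \<Longrightarrow> finite (inc C x)"
  using finite_sub unfolding inc_def by auto

lemma supp_Un: "supp (C \<union> D) = supp C \<union> supp D" and supp_insert: "supp (insert l C) = img l \<union> supp C"
  and supp_single: "supp {l} = img l"
  unfolding supp_def by auto

lemma inc_Un: "inc (C \<union> D) x = inc C x \<union> inc D x"
  unfolding inc_def by auto

lemma inc_empty: "x \<notin> supp C \<Longrightarrow> inc C x = {}"
  unfolding inc_def supp_def by auto

lemma img_sub_supp: "l \<in> C \<Longrightarrow> img l \<subseteq> supp C"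
  unfolding supp_def by auto

lemma link_arc:
  assumes "l \<in> \<Lambda>" "img l \<inter> X = {p,q}"
  shows "arc_between (img l) p q"
proof -
  obtain p' q' where "arc_between (img l) p' q'" "img l \<inter> X = {p',q'}"
    using link[OF assms(1)] by blast
  then show ?thesis using assms(2) arc_between_sym by (metis doubleton_eq_iff)
qed

lemma link_ends:
  assumes "l \<in> \<Lambda>" "x \<in> img l" "x \<in> X"
  obtains z where "img l \<inter> X = {x,z}" "x \<noteq> z" "arc_between (img l) x z"
proof -
  obtain p q where pq: "arc_between (img l) p q" "img l \<inter> X = {p,q}"
    using link[OF assms(1)] by blast
  then have "x = p \<or> x = q" using assms by blast
  then show thesis
    using that[of q] that[of p] pq arc_between_sym[OF pq(1)] arc_between_facts(5)[OF pq(1)]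
    by (metis insert_commute)
qed

lemma link_closed: "l \<in> \<Lambda> \<Longrightarrow> closed (img l)"
  using link arc_between_facts(1) compact_imp_closed by metis

text \<open>Statements about the side of a cycle on which a link lies concern its interior; the last two parts
lead from the interior to the end points.\<close>

lemma link_inner:
  assumes "l \<in> \<Lambda>"
  shows "connected (img l - X)" "img l - X \<noteq> {}" "img l \<subseteq> closure (img l - X)"
    "\<And>x. x \<in> img l \<Longrightarrow> connected (insert x (img l - X))"
proof -
  obtain p q where pq: "arc_between (img l) p q" "img l \<inter> X = {p,q}"
    using link[OF assms(1)] by blast
  have eq: "img l - X = img l - {p,q}" using pq by blast
  note f = arc_between_facts[OF pq(1)]
  show 1: "connected (img l - X)" "img l - X \<noteq> {}" using f eq by auto
  show 2: "connected (insert x (img l - X))" if x: "x \<in> img l" for x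
  proof (cases "x \<in> X")
    case True
    then obtain z where z: "img l \<inter> X = {x,z}" "x \<noteq> z" "arc_between (img l) x z"
      using link_ends[OF assms x True] by blast
    then have "insert x (img l - X) = img l - {z}" using x by blast
    then show ?thesis using arc_between_connected_minus_end[OF z(3)] by simp
  next
    case False
    then show ?thesis using 1 x by (simp add: insert_absorb)
  qed
  show "img l \<subseteq> closure (img l - X)"
    using connected_insert_closure 1 2 by blast
qed

lemma link_avoids:
  assumes "l \<in> \<Lambda>" "C \<subseteq> \<Lambda>" "l \<notin> C"
  shows "(img l - X) \<inter> supp C = {}"
  using link_disjoint[OF assms(1)] assms unfolding supp_def by blast

lemma supp_closed: "C \<subseteq> \<Lambda> \<Longrightarrow> closed (supp C)"
  unfolding supp_def using finite_sub link_closed by blast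

lemma cycle_jordan: "cycle C \<Longrightarrow> jordan (supp C)"
  and cycle_sub: "cycle C \<Longrightarrow> C \<subseteq> \<Lambda>"
  unfolding cycle_def by auto

lemma link_side:
  assumes "cycle C" "l \<in> \<Lambda>" "l \<notin> C"
  shows "img l - X \<subseteq> disc C \<or> img l - X \<subseteq> outside (supp C)"
proof -
  have a: "(img l - X) \<inter> supp C = {}" using link_avoids assms cycle_sub by blast
  show ?thesis
    using connected_subset_inside[OF cycle_jordan[OF assms(1)] link_inner(1)[OF assms(2)] a]
      connected_subset_outside[OF cycle_jordan[OF assms(1)] link_inner(1)[OF assms(2)] a] by blast
qed

lemma link_inside_from:
  assumes "cycle C" "l \<in> \<Lambda>" "l \<notin> C" "x \<in> img l" "x \<in> disc C"
  shows "img l - X \<subseteq> disc C"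
proof -
  have a: "(img l - X) \<inter> supp C = {}" using link_avoids assms cycle_sub by blast
  have "x \<notin> supp C" using assms(5) inside_no_overlap by blast
  then have "insert x (img l - X) \<inter> supp C = {}" using a by blast
  then have "insert x (img l - X) \<subseteq> disc C"
    using connected_subset_inside[OF cycle_jordan[OF assms(1)] link_inner(4)[OF assms(2,4)]] assms(5) by blast
  then show ?thesis by blast
qed

lemma link_inside_to:
  assumes "cycle C" "l \<in> \<Lambda>" "x \<in> img l" "x \<notin> supp C" "img l - X \<subseteq> disc C"
  shows "x \<in> disc C"
proof -
  have "(img l - X) \<inter> supp C = {}" using assms(5) inside_no_overlap by blast
  then have "insert x (img l - X) \<inter> supp C = {}" using assms by blast
  then have "insert x (img l - X) \<subseteq> disc C"
    using connected_subset_inside[OF cycle_jordan[OF assms(1)] link_inner(4)[OF assms(2,3)]] assms(5)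
      link_inner(2)[OF assms(2)] by blast
  then show ?thesis by blast
qed

lemma not_reflex_outside:
  assumes "cycle C" "\<not> reflex C x" "l \<in> \<Lambda>" "l \<notin> C" "x \<in> img l"
  shows "img l - X \<subseteq> outside (supp C)"
  using link_side[OF assms(1,3,4)] assms unfolding reflex_def by blast

lemma chain_sym: "chain P p q \<Longrightarrow> chain P q p"
  unfolding chain_def using arc_between_sym by (auto simp: insert_commute)

lemma chain_ends_in: "chain P p q \<Longrightarrow> p \<in> supp P" "chain P p q \<Longrightarrow> q \<in> supp P" "chain P p q \<Longrightarrow> p \<noteq> q"
  unfolding chain_def using arc_between_facts by blast+

lemma chain_single:
  assumes "l \<in> \<Lambda>" "img l \<inter> X = {p,q}"
  shows "chain {l} p q"
proof -
  have a: "arc_between (img l) p q" using link_arc assms by blast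
  have pq: "p \<in> img l" "q \<in> img l" "p \<in> X" "q \<in> X" using assms(2) by blast+
  have "inc {l} p = {l}" "inc {l} q = {l}" using pq unfolding inc_def by auto
  moreover have "X \<inter> supp {l} - {p,q} = {}" using assms(2) unfolding supp_single by blast
  ultimately show ?thesis unfolding chain_def using a pq assms(1) by (auto simp: supp_single)
qed

lemma chain_extend:
  assumes P: "chain P p q" and l: "l \<in> \<Lambda>" "img l \<inter> X = {q,r}" and r: "r \<notin> supp P"
  shows "chain (insert l P) p r"
proof -
  have sub: "P \<subseteq> \<Lambda>" and arc: "arc_between (supp P) p q" and X: "p \<in> X" "q \<in> X"
    using P unfolding chain_def by auto
  have pq: "p \<in> supp P" "q \<in> supp P" "p \<noteq> q" using chain_ends_in P by auto
  have ql: "q \<in> img l" "r \<in> img l" "r \<in> X" using l(2) by blast+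
  have lP: "l \<notin> P" using r ql img_sub_supp by blast
  have "supp P \<inter> img l \<subseteq> X" using link_disjoint[OF l(1)] sub lP unfolding supp_def by blast
  then have i: "supp P \<inter> img l = {q}" using l(2) r pq ql by blast
  have "arc_between (supp P \<union> img l) p r"
    using arc_between_join[OF arc link_arc[OF l] i] .
  moreover have "supp (insert l P) = supp P \<union> img l" unfolding supp_insert by blast
  moreover have "inc (insert l P) p = inc P p" using i pq unfolding inc_def by blast
  moreover have "inc (insert l P) r = {l}" using r ql unfolding inc_def supp_def by blast
  moreover have "card (inc (insert l P) x) = 2" if x: "x \<in> X \<inter> supp (insert l P) - {p,r}" for x
  proof (cases "x = q")
    case True
    then have "inc (insert l P) x = insert l (inc P q)" using ql unfolding inc_def by blast
    moreover have "l \<notin> inc P q" using lP unfolding inc_def by blast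
    ultimately show ?thesis using finite_inc[OF sub] P unfolding chain_def by simp
  next
    case False
    then have "x \<notin> img l" using x l(2) by blast
    then have "inc (insert l P) x = inc P x" "x \<in> supp P"
      using x unfolding inc_def supp_def by blast+
    then show ?thesis using False x P unfolding chain_def by simp
  qed
  ultimately show ?thesis unfolding chain_def using X ql P sub l(1) unfolding chain_def by simp
qed

lemma chain_disjoint:
  assumes "chain P p q" "chain Q p q" "supp P \<inter> supp Q = {p,q}"
  shows "P \<inter> Q = {}"
proof (rule ccontr)
  assume "P \<inter> Q \<noteq> {}"
  then obtain l where l: "l \<in> P" "l \<in> Q" by blast
  then have "img l \<subseteq> {p,q}" using assms(3) unfolding supp_def by blast
  then have "img l - X = {}" using assms(1) unfolding chain_def by blast
  then show False using link_inner(2)[of l] l assms(1) unfolding chain_def by blast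
qed

lemma chain_close:
  assumes P: "chain P p q" and Q: "chain Q p q" and i: "supp P \<inter> supp Q = {p,q}"
  shows "cycle (P \<union> Q)"
proof -
  have sub: "P \<subseteq> \<Lambda>" "Q \<subseteq> \<Lambda>" using P Q unfolding chain_def by auto
  have d: "P \<inter> Q = {}" using chain_disjoint assms by blast
  have "jordan (supp P \<union> supp Q)"
    using jordan_join[OF _ arc_between_sym i] P Q unfolding chain_def by blast
  moreover have "card (inc (P \<union> Q) x) = 2" if x: "x \<in> X \<inter> supp (P \<union> Q)" for x
  proof (cases "x \<in> {p,q}")
    case True
    have "inc P x \<inter> inc Q x = {}" using d unfolding inc_def by blast
    then have "card (inc (P \<union> Q) x) = card (inc P x) + card (inc Q x)"
      unfolding inc_Un using finite_inc sub by (simp add: card_Un_disjoint)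
    moreover have "card (inc P x) = 1" "card (inc Q x) = 1"
      using True P Q unfolding chain_def by auto
    ultimately show ?thesis by simp
  next
    case False
    then consider "x \<in> supp P" "x \<notin> supp Q" | "x \<in> supp Q" "x \<notin> supp P"
      using x i unfolding supp_Un by blast
    then show ?thesis
    proof cases
      case 1
      then show ?thesis using False x P inc_empty[of x Q] unfolding chain_def inc_Un by simp
    next
      case 2
      then show ?thesis using False x Q inc_empty[of x P] unfolding chain_def inc_Un by simp
    qed
  qed
  ultimately show ?thesis unfolding cycle_def supp_Un using sub by blast
qed

text \<open>Removing \<open>p\<close> and \<open>q\<close> disconnects the cycle, and interiors of links are connected, so each link lies in
one of the two arcs. Conversely the links cover each arc, because only finitely many points are
lost by omitting the vertices.\<close>

lemma cycle_split:
  assumes C: "cycle C" and p: "p \<in> X" "p \<in> supp C" and q: "q \<in> X" "q \<in> supp C" and "p \<noteq> q"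
  obtains P Q where "chain P p q" "chain Q p q" "supp P \<inter> supp Q = {p,q}" "P \<union> Q = C"
proof -
  have sub: "C \<subseteq> \<Lambda>" using C cycle_sub by blast
  obtain U D where UD: "arc_between U p q" "arc_between D q p" "U \<inter> D = {p,q}" "U \<union> D = supp C"
    using jordan_double_arc[OF cycle_jordan[OF C] p(2) q(2) \<open>p \<noteq> q\<close>] by blast
  have cl: "closed U" "closed D"
    using arc_between_facts(1)[OF UD(1)] arc_between_facts(1)[OF UD(2)] compact_imp_closed by auto
  define P where "P = {l \<in> C. img l \<subseteq> U}"
  define Q where "Q = {l \<in> C. img l \<subseteq> D}"
  have side: "img l \<subseteq> U \<or> img l \<subseteq> D" if l: "l \<in> C" for l
  proof -
    have lL: "l \<in> \<Lambda>" using l sub by blast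
    have s: "img l - X \<subseteq> U \<union> D" using UD(4) img_sub_supp[OF l] by blast
    have n: "p \<notin> img l - X" "q \<notin> img l - X" using p q by auto
    have "img l - X \<subseteq> U \<or> img l - X \<subseteq> D"
    proof (cases "(img l - X) \<inter> U = {}")
      case False
      then show ?thesis
        using connected_in_double_arc[OF UD(1-3) link_inner(1)[OF lL] s n] by blast
    qed (use s in blast)
    then show ?thesis using link_inner(3)[OF lL] cl closure_minimal by (meson order_trans)
  qed
  have PQ: "P \<union> Q = C" using side unfolding P_def Q_def by blast
  have dj: "P \<inter> Q = {}"
  proof (rule ccontr)
    assume "P \<inter> Q \<noteq> {}"
    then obtain l where l: "l \<in> C" "img l \<subseteq> U \<inter> D" unfolding P_def Q_def by blast
    then have "img l - X = {}" using UD(3) p q by auto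
    then show False using link_inner(2)[of l] l sub by blast
  qed
  have dense: "V \<subseteq> closure (V - X)" if V: "arc_between V a b" for V a b
  proof
    fix x assume x: "x \<in> V"
    obtain y where "y \<in> V" "y \<noteq> x" using arc_between_facts[OF V] by metis
    then have "x islimpt V"
      using connected_imp_perfect[OF arc_between_facts(2)[OF V] x] x by (metis singletonD)
    then have "x islimpt (V - X) \<union> X" by (rule islimpt_subset) blast
    then have "x islimpt V - X" using islimpt_Un_finite[OF finite_X] by (metis sup_commute)
    then show "x \<in> closure (V - X)" unfolding closure_def by blast
  qed
  have supp: "supp P = U" "supp Q = D"
  proof -
    have s: "supp P \<subseteq> U" "supp Q \<subseteq> D" unfolding supp_def P_def Q_def by auto
    have c: "supp P \<union> supp Q = U \<union> D" using PQ UD(4) supp_Un by metis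
    have pqX: "{p,q} \<subseteq> X" using p q by blast
    have "z \<in> supp P" if "z \<in> U" "z \<notin> X" for z using that c s(2) UD(3) pqX by blast
    then have "U - X \<subseteq> supp P" by blast
    moreover have "z \<in> supp Q" if "z \<in> D" "z \<notin> X" for z using that c s(1) UD(3) pqX by blast
    then have "D - X \<subseteq> supp Q" by blast
    moreover have "closed (supp P)" "closed (supp Q)" using supp_closed PQ sub by blast+
    ultimately have "U \<subseteq> supp P" "D \<subseteq> supp Q"
      using dense[OF UD(1)] dense[OF UD(2)] closure_minimal by (meson order_trans)+
    then show "supp P = U" "supp Q = D" using s by blast+
  qed
  have i: "supp P \<inter> supp Q = {p,q}" using supp UD(3) by simp
  have subs: "P \<subseteq> \<Lambda>" "Q \<subseteq> \<Lambda>" using PQ sub by blast+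
  have two: "card (inc C x) = 2" if "x \<in> X" "x \<in> supp C" for x
    using that C unfolding cycle_def by blast
  have inc: "inc C x = inc P x \<union> inc Q x" for x using PQ inc_Un by metis
  have ends: "card (inc P x) = 1" "card (inc Q x) = 1" if "x \<in> {p,q}" for x
  proof -
    have "x \<in> supp P" "x \<in> supp Q" using i that by blast+
    then have "inc P x \<noteq> {}" "inc Q x \<noteq> {}" unfolding inc_def supp_def by blast+
    then have "card (inc P x) \<noteq> 0" "card (inc Q x) \<noteq> 0" using finite_inc subs by auto
    moreover have "card (inc C x) = card (inc P x) + card (inc Q x)"
      unfolding inc using dj finite_inc subs by (intro card_Un_disjoint) (auto simp: inc_def)
    moreover have "card (inc C x) = 2" using two that p q by blast
    ultimately show "card (inc P x) = 1" "card (inc Q x) = 1" by auto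
  qed
  have mid: "card (inc P x) = 2" if "x \<in> X \<inter> supp P - {p,q}" for x
  proof -
    have "inc Q x = {}" using that i inc_empty by blast
    then show ?thesis using inc two[of x] that UD(4) supp by auto
  qed
  have mid': "card (inc Q x) = 2" if "x \<in> X \<inter> supp Q - {p,q}" for x
  proof -
    have "inc P x = {}" using that i inc_empty by blast
    then show ?thesis using inc two[of x] that UD(4) supp by auto
  qed
  have "chain P p q" unfolding chain_def using subs supp UD p q ends mid by simp
  moreover have "chain Q p q" unfolding chain_def
    using subs supp arc_between_sym[OF UD(2)] p q ends mid' by simp
  ultimately show thesis using that i PQ by blast
qed

end

section \<open>Cutting a cycle along a chord\<close>

context link_system
begin

lemma corner_mono_eq: "inc C x = inc D x \<Longrightarrow> corner C x = corner D x"
  unfolding corner_def by simp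

text \<open>Away from the chord \<open>P\<close> the inside of the cycle and the inside of the part agree locally, so a reflex
corner remains reflex.\<close>

lemma theta_side_vertex:
  assumes C: "cycle (Q1 \<union> Q2)" and C1: "cycle (Q1 \<union> P)" and C2: "cycle (Q2 \<union> P)"
    and dj: "disc (Q1 \<union> P) \<inter> disc (Q2 \<union> P) = {}"
    and un: "disc (Q1 \<union> P) \<union> disc (Q2 \<union> P) \<union> (supp P - {p,q}) = disc (Q1 \<union> Q2)"
    and x: "x \<in> supp Q1" "x \<notin> supp Q2" "x \<notin> supp P"
  shows "turning (Q1 \<union> P) x \<le> turning (Q1 \<union> Q2) x"
proof -
  have "inc (Q1 \<union> P) x = inc (Q1 \<union> Q2) x" using inc_empty x unfolding inc_Un by simp
  then have c: "corner (Q1 \<union> P) x = corner (Q1 \<union> Q2) x" by (rule corner_mono_eq)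
  have "reflex (Q1 \<union> P) x" if r: "reflex (Q1 \<union> Q2) x"
  proof -
    obtain l where l: "l \<in> \<Lambda>" "l \<notin> Q1 \<union> Q2" "x \<in> img l" "img l - X \<subseteq> disc (Q1 \<union> Q2)"
      using r unfolding reflex_def by blast
    have "l \<notin> P" using x(3) l(3) img_sub_supp by blast
    then have l1: "l \<notin> Q1 \<union> P" and l2: "l \<notin> Q2 \<union> P" using l(2) by auto
    have "img l - X \<subseteq> disc (Q1 \<union> P)"
    proof (rule ccontr)
      assume n: "\<not> img l - X \<subseteq> disc (Q1 \<union> P)"
      have "img l - X \<subseteq> outside (supp (Q1 \<union> P))" using link_side[OF C1 l(1) l1] n by blast
      then have "(img l - X) \<inter> disc (Q1 \<union> P) = {}"
        using jordan_facts(6)[OF cycle_jordan[OF C1]] by blast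
      moreover have "(img l - X) \<inter> supp P = {}"
        using link_avoids[OF l(1) cycle_sub[OF C1] l1] unfolding supp_Un by blast
      ultimately have "img l - X \<subseteq> disc (Q2 \<union> P)" using l(4) un by blast
      then have "x \<in> closure (disc (Q2 \<union> P))"
        using link_inner(3)[OF l(1)] l(3) closure_mono by blast
      moreover have "x \<notin> supp (Q2 \<union> P)" using x unfolding supp_Un by blast
      ultimately have "x \<in> disc (Q2 \<union> P)"
        using jordan_facts(8)[OF cycle_jordan[OF C2]] jordan_facts(1)[OF cycle_jordan[OF C2]]
        unfolding frontier_def by (auto simp: interior_open)
      then have "x \<in> disc (Q1 \<union> Q2)" using un by blast
      then show False using x(1) inside_no_overlap[of "supp (Q1 \<union> Q2)"] unfolding supp_Un by blast
    qed
    then show ?thesis unfolding reflex_def using l(1,3) l1 by blast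
  qed
  then show ?thesis unfolding turning_def c by auto
qed

lemma card2_other:
  assumes "card S = 2" "a \<in> S"
  obtains b where "S = {a,b}" "b \<noteq> a"
proof -
  obtain u v where "S = {u,v}" "u \<noteq> v" using assms(1) by (auto simp: card_2_iff)
  then show thesis using that[of u] that[of v] assms(2) by blast
qed

lemma third_link:
  assumes x: "x \<in> X" and "colour a \<noteq> colour b"
  obtains l where "l \<in> \<Lambda>" "x \<in> img l" "l \<noteq> a" "l \<noteq> b"
proof -
  obtain s where "card {l \<in> \<Lambda>. x \<in> img l \<and> colour l = s} = 2" using passes[OF x] by blast
  then obtain u v where uv: "{l \<in> \<Lambda>. x \<in> img l \<and> colour l = s} = {u,v}" "u \<noteq> v"
    by (auto simp: card_2_iff)
  then have m: "u \<in> \<Lambda>" "x \<in> img u" "colour u = s" "v \<in> \<Lambda>" "x \<in> img v" "colour v = s" by blast+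
  show thesis
  proof (cases "u = a \<or> u = b")
    case True
    then show thesis using that[of v] m uv(2) assms(2) by metis
  qed (use that m in blast)
qed

text \<open>A corner of the chord is a corner of both parts, and the third branch there lies in one of the two
insides; it makes the corner reflex in that part and so compensates for the other.\<close>

lemma theta_path_vertex:
  assumes C: "cycle (Q1 \<union> Q2)" and C1: "cycle (Q1 \<union> P)" and C2: "cycle (Q2 \<union> P)"
    and un: "disc (Q1 \<union> P) \<union> disc (Q2 \<union> P) \<union> (supp P - {p,q}) = disc (Q1 \<union> Q2)"
    and x: "x \<in> X" "x \<in> supp P" "x \<notin> supp Q1" "x \<notin> supp Q2" "x \<noteq> p" "x \<noteq> q"
  shows "turning (Q1 \<union> P) x + turning (Q2 \<union> P) x \<le> 0"
proof -
  have i: "inc (Q1 \<union> P) x = inc P x" "inc (Q2 \<union> P) x = inc P x"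
    using inc_empty x unfolding inc_Un by simp_all
  then have c: "corner (Q1 \<union> P) x = corner P x" "corner (Q2 \<union> P) x = corner P x"
    unfolding corner_def by simp_all
  show ?thesis
  proof (cases "corner P x")
    case False
    then show ?thesis unfolding turning_def c by simp
  next
    case True
    have "card (inc P x) = 2" using C1 x i unfolding cycle_def supp_Un by (metis IntI UnI2)
    moreover obtain a b where ab: "a \<in> inc P x" "b \<in> inc P x" "colour a \<noteq> colour b"
      using True unfolding corner_def by blast
    ultimately have iP: "inc P x = {a,b}" by (metis card2_other insertE singletonD)
    obtain l where l: "l \<in> \<Lambda>" "x \<in> img l" "l \<noteq> a" "l \<noteq> b" using third_link[OF x(1) ab(3)] by blast
    have "l \<notin> P" using iP l unfolding inc_def by blast
    moreover have lC: "l \<notin> Q1 \<union> Q2" using x(3,4) l(2) img_sub_supp by blast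
    ultimately have l12: "l \<notin> Q1 \<union> P" "l \<notin> Q2 \<union> P" by auto
    have "x \<in> disc (Q1 \<union> Q2)" using un x by blast
    then have "img l - X \<subseteq> disc (Q1 \<union> Q2)" using link_inside_from[OF C l(1) lC l(2)] by blast
    moreover have "(img l - X) \<inter> supp P = {}"
      using link_avoids[OF l(1) cycle_sub[OF C1] l12(1)] unfolding supp_Un by blast
    ultimately have s: "img l - X \<subseteq> disc (Q1 \<union> P) \<union> disc (Q2 \<union> P)" using un by blast
    have "reflex (Q1 \<union> P) x \<or> reflex (Q2 \<union> P) x"
    proof (cases "img l - X \<subseteq> disc (Q1 \<union> P)")
      case True
      then show ?thesis unfolding reflex_def using l l12 by blast
    next
      case False
      then have "img l - X \<subseteq> outside (supp (Q1 \<union> P))" using link_side[OF C1 l(1) l12(1)] by blast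
      then have "img l - X \<subseteq> disc (Q2 \<union> P)"
        using s jordan_facts(6)[OF cycle_jordan[OF C1]] by blast
      then show ?thesis unfolding reflex_def using l l12 by blast
    qed
    then show ?thesis unfolding turning_def c using True by auto
  qed
qed

text \<open>If the cycle has no corner at \<open>p\<close>, each part gains at most 1. If it has a corner, it may lose 1 there; but
the chord has the colour of one of the two links of the cycle at \<open>p\<close>, so one part goes straight through
\<open>p\<close> and only the other can gain 1.\<close>

lemma theta_end_vertex:
  assumes Q1: "chain Q1 p q" and Q2: "chain Q2 p q" and P: "chain P p q"
  shows "turning (Q1 \<union> P) p + turning (Q2 \<union> P) p \<le> turning (Q1 \<union> Q2) p + 2"
proof -
  obtain a where a: "inc Q1 p = {a}" using Q1 unfolding chain_def by (metis card_1_singletonE)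
  obtain b where b: "inc Q2 p = {b}" using Q2 unfolding chain_def by (metis card_1_singletonE)
  obtain l where l: "inc P p = {l}" using P unfolding chain_def by (metis card_1_singletonE)
  have 1: "corner (Q1 \<union> P) p \<longleftrightarrow> colour a \<noteq> colour l" "corner (Q2 \<union> P) p \<longleftrightarrow> colour b \<noteq> colour l"
    "corner (Q1 \<union> Q2) p \<longleftrightarrow> colour a \<noteq> colour b"
    unfolding corner_def inc_Un a b l by auto
  show ?thesis
  proof (cases "colour a = colour b")
    case True
    then have "turning (Q1 \<union> Q2) p = 0" using 1 unfolding turning_def by simp
    then show ?thesis using turning_bounds(2)[of "Q1 \<union> P" p] turning_bounds(2)[of "Q2 \<union> P" p] by linarith
  next
    case False
    then have "turning (Q1 \<union> P) p = 0 \<or> turning (Q2 \<union> P) p = 0"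
      using 1 unfolding turning_def by auto
    then show ?thesis
      using turning_bounds(2)[of "Q1 \<union> P" p] turning_bounds(2)[of "Q2 \<union> P" p] turning_bounds(1)[of "Q1 \<union> Q2" p]
      by linarith
  qed
qed

lemma total_turning_Un:
  assumes "chain Q p q" "chain P p q" "supp Q \<inter> supp P = {p,q}"
  shows "total_turning (Q \<union> P) = turning (Q \<union> P) p + turning (Q \<union> P) q
    + (\<Sum>x\<in>X \<inter> supp Q - {p,q}. turning (Q \<union> P) x) + (\<Sum>x\<in>X \<inter> supp P - {p,q}. turning (Q \<union> P) x)"
proof -
  have pX: "p \<in> X" "q \<in> X" using assms(1) unfolding chain_def by auto
  note pq = pX chain_ends_in(3)[OF assms(1)]
  have "X \<inter> supp (Q \<union> P) = {p,q} \<union> ((X \<inter> supp Q - {p,q}) \<union> (X \<inter> supp P - {p,q}))"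
  proof -
    have "p \<in> supp Q" "q \<in> supp Q" using chain_ends_in[OF assms(1)] by auto
    then show ?thesis unfolding supp_Un using pq by auto
  qed
  then have "total_turning (Q \<union> P) =
    (\<Sum>x\<in>{p,q} \<union> ((X \<inter> supp Q - {p,q}) \<union> (X \<inter> supp P - {p,q})). turning (Q \<union> P) x)"
    unfolding total_turning_def by simp
  also have "\<dots> = (\<Sum>x\<in>{p,q}. turning (Q \<union> P) x) +
     (\<Sum>x\<in>(X \<inter> supp Q - {p,q}) \<union> (X \<inter> supp P - {p,q}). turning (Q \<union> P) x)"
    using finite_X by (intro sum.union_disjoint) auto
  also have "(\<Sum>x\<in>(X \<inter> supp Q - {p,q}) \<union> (X \<inter> supp P - {p,q}). turning (Q \<union> P) x) =
    (\<Sum>x\<in>X \<inter> supp Q - {p,q}. turning (Q \<union> P) x) + (\<Sum>x\<in>X \<inter> supp P - {p,q}. turning (Q \<union> P) x)"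
  proof (rule sum.union_disjoint)
    show "(X \<inter> supp Q - {p,q}) \<inter> (X \<inter> supp P - {p,q}) = {}" using assms(3) by blast
  qed (use finite_X in auto)
  finally show ?thesis using pq by simp
qed

text \<open>The combinatorial form of the additivity of curvature: the quantity \<open>4 - total_turning\<close> of the whole
is at most the sum over the two parts. Each end of the chord contributes at most 2, nothing else
contributes positively.\<close>

lemma theta_total_turning:
  assumes Q1: "chain Q1 p q" and Q2: "chain Q2 p q" and P: "chain P p q"
    and i: "supp Q1 \<inter> supp Q2 = {p,q}" and iP: "supp P \<inter> supp (Q1 \<union> Q2) = {p,q}"
    and ins: "supp P - {p,q} \<subseteq> disc (Q1 \<union> Q2)"
  shows "cycle (Q1 \<union> P)" "cycle (Q2 \<union> P)"
    "total_turning (Q1 \<union> P) + total_turning (Q2 \<union> P) \<le> total_turning (Q1 \<union> Q2) + 4"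
    "disc (Q1 \<union> P) \<subset> disc (Q1 \<union> Q2)" "disc (Q2 \<union> P) \<subset> disc (Q1 \<union> Q2)"
proof -
  have pq1: "{p,q} \<subseteq> supp Q1" "{p,q} \<subseteq> supp Q2" "{p,q} \<subseteq> supp P" using i iP by blast+
  have i1: "supp Q1 \<inter> supp P = {p,q}" "supp Q2 \<inter> supp P = {p,q}"
    using iP pq1 unfolding supp_Un by blast+
  show C1: "cycle (Q1 \<union> P)" using chain_close[OF Q1 P i1(1)] .
  show C2: "cycle (Q2 \<union> P)" using chain_close[OF Q2 P i1(2)] .
  have C: "cycle (Q1 \<union> Q2)" using chain_close[OF Q1 Q2 i] .
  have arcs: "arc_between (supp Q1) p q" "arc_between (supp Q2) p q" "arc_between (supp P) p q"
    using Q1 Q2 P unfolding chain_def by auto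
  have Pne: "supp P - {p,q} \<noteq> {}" using arc_between_facts(7)[OF arcs(3)] .
  then have ne: "supp P \<inter> inside (supp Q1 \<union> supp Q2) \<noteq> {}" using ins unfolding supp_Un by blast
  note ts = theta_split[OF arcs i i1 ne]
  have dj: "disc (Q1 \<union> P) \<inter> disc (Q2 \<union> P) = {}" using ts(1) unfolding supp_Un .
  have un: "disc (Q1 \<union> P) \<union> disc (Q2 \<union> P) \<union> (supp P - {p,q}) = disc (Q1 \<union> Q2)"
    using ts(2) unfolding supp_Un .
  have "(supp P - {p,q}) \<inter> disc (Q1 \<union> P) = {}" "(supp P - {p,q}) \<inter> disc (Q2 \<union> P) = {}"
    using inside_no_overlap[of "supp (Q1 \<union> P)"] inside_no_overlap[of "supp (Q2 \<union> P)"]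
      unfolding supp_Un by blast+
  then show "disc (Q1 \<union> P) \<subset> disc (Q1 \<union> Q2)" "disc (Q2 \<union> P) \<subset> disc (Q1 \<union> Q2)"
    using un Pne by blast+
  have s1: "(\<Sum>x\<in>X \<inter> supp Q1 - {p,q}. turning (Q1 \<union> P) x) \<le> (\<Sum>x\<in>X \<inter> supp Q1 - {p,q}. turning (Q1 \<union> Q2) x)"
  proof (rule sum_mono)
    fix x assume x: "x \<in> X \<inter> supp Q1 - {p,q}"
    then have "x \<notin> supp Q2" "x \<notin> supp P" using i i1 by blast+
    then show "turning (Q1 \<union> P) x \<le> turning (Q1 \<union> Q2) x"
      using theta_side_vertex[OF C C1 C2 dj un] x by blast
  qed
  have s2: "(\<Sum>x\<in>X \<inter> supp Q2 - {p,q}. turning (Q2 \<union> P) x) \<le> (\<Sum>x\<in>X \<inter> supp Q2 - {p,q}. turning (Q1 \<union> Q2) x)"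
  proof (rule sum_mono)
    fix x assume x: "x \<in> X \<inter> supp Q2 - {p,q}"
    then have "x \<notin> supp Q1" "x \<notin> supp P" using i i1 by blast+
    then show "turning (Q2 \<union> P) x \<le> turning (Q1 \<union> Q2) x"
      using theta_side_vertex[of Q2 Q1 P p q x] C C1 C2 dj un x
        by (simp add: Un_commute Int_commute)
  qed
  have s3: "(\<Sum>x\<in>X \<inter> supp P - {p,q}. turning (Q1 \<union> P) x) + (\<Sum>x\<in>X \<inter> supp P - {p,q}. turning (Q2 \<union> P) x) \<le> 0"
    unfolding sum.distrib[symmetric]
  proof (rule sum_nonpos)
    fix x assume x: "x \<in> X \<inter> supp P - {p,q}"
    then have "x \<notin> supp Q1" "x \<notin> supp Q2" using i1 by blast+
    then show "turning (Q1 \<union> P) x + turning (Q2 \<union> P) x \<le> 0"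
      using theta_path_vertex[OF C C1 C2 un] x by blast
  qed
  have s4: "turning (Q1 \<union> P) p + turning (Q2 \<union> P) p \<le> turning (Q1 \<union> Q2) p + 2"
    using theta_end_vertex[OF Q1 Q2 P] .
  have s5: "turning (Q1 \<union> P) q + turning (Q2 \<union> P) q \<le> turning (Q1 \<union> Q2) q + 2"
    using theta_end_vertex[OF chain_sym[OF Q1] chain_sym[OF Q2] chain_sym[OF P]] .
  show "total_turning (Q1 \<union> P) + total_turning (Q2 \<union> P) \<le> total_turning (Q1 \<union> Q2) + 4"
    unfolding total_turning_Un[OF Q1 P i1(1)] total_turning_Un[OF Q2 P i1(2)] total_turning_Un[OF Q1 Q2 i]
    using s1 s2 s3 s4 s5 by linarith
qed

section \<open>Zigzags\<close>

text \<open>Here \<open>x\<close> and \<open>y\<close> will be consecutive corners of a path and \<open>D\<close> the links of the path from just before \<open>x\<close>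
to just after \<open>y\<close>. If the path turns to opposite sides at \<open>x\<close> and \<open>y\<close>, then no disc bounded by a
cycle through \<open>D\<close> is convex at both; this consequence makes sense without an orientation.\<close>

definition safe :: "complex \<Rightarrow> complex \<Rightarrow> 'l set \<Rightarrow> bool" where
  "safe x y D \<longleftrightarrow> (\<forall>C. cycle C \<and> D \<subseteq> C \<longrightarrow> \<not> (turning C x = 1 \<and> turning C y = 1))"

lemma inc_cycle_eq:
  assumes "cycle C" "a \<in> C" "b \<in> C" "a \<noteq> b" "x \<in> img a" "x \<in> img b" "x \<in> X"
  shows "inc C x = {a,b}"
proof -
  have "card (inc C x) = 2" using assms img_sub_supp unfolding cycle_def by blast
  moreover have "a \<in> inc C x" "b \<in> inc C x" using assms unfolding inc_def by auto
  ultimately show ?thesis using assms(4) by (metis card2_other insertE singletonD)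
qed

text \<open>The path comes along \<open>a\<close>, turns at \<open>x\<close> into the run \<open>R\<close> and has the choice between \<open>\<beta>\<close> and \<open>\<beta>'\<close> at \<open>y\<close>. If
both choices could be completed to cycles with convex corners at \<open>x\<close> and \<open>y\<close>, then these cycles would
contradict \<open>not_both_turns_convex\<close>, applied to their common arc. This arc starts at a point \<open>o'\<close> inside
\<open>a\<close>, so that \<open>x\<close> is not one of its ends.\<close>

lemma one_branch_safe:
  assumes a: "a \<in> \<Lambda>" "x \<in> img a" and R: "chain R x y" "\<And>m. m \<in> R \<Longrightarrow> colour m \<noteq> colour a"
    and star_x: "card (star x (\<not> colour a)) = 2" and star_y: "star y (colour a) = {\<beta>, \<beta>'}" "\<beta> \<noteq> \<beta>'"
  shows "safe x y (insert \<beta> (insert a R)) \<or> safe x y (insert \<beta>' (insert a R))"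
proof (rule ccontr)
  assume "\<not> ?thesis"
  then obtain C C' where C: "cycle C" "insert \<beta> (insert a R) \<subseteq> C" "turning C x = 1" "turning C y = 1"
    and C': "cycle C'" "insert \<beta>' (insert a R) \<subseteq> C'" "turning C' x = 1" "turning C' y = 1"
    unfolding safe_def by blast
  have Rsub: "R \<subseteq> \<Lambda>" and Rarc: "arc_between (supp R) x y" and X: "x \<in> X" "y \<in> X"
    using R(1) unfolding chain_def by auto
  obtain r where r: "inc R x = {r}" using R(1) unfolding chain_def by (metis card_1_singletonE)
  obtain r' where r': "inc R y = {r'}" using R(1) unfolding chain_def by (metis card_1_singletonE)
  have rR: "r \<in> R" "x \<in> img r" "r' \<in> R" "y \<in> img r'" using r r' unfolding inc_def by blast+
  have \<beta>: "\<beta> \<in> \<Lambda>" "y \<in> img \<beta>" "colour \<beta> = colour a" "\<beta>' \<in> \<Lambda>" "y \<in> img \<beta>'" "colour \<beta>' = colour a"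
    using star_y unfolding star_def by blast+
  have ra: "r \<noteq> a" "a \<notin> R" "r' \<noteq> \<beta>" "r' \<noteq> \<beta>'" using R(2) rR \<beta> by blast+
  have incx: "inc C x = {a,r}" "inc C' x = {a,r}"
    using inc_cycle_eq[of _ a r x] C C' rR a ra X by auto
  have incy: "inc C y = {r',\<beta>}" "inc C' y = {r',\<beta>'}"
    using inc_cycle_eq[of C r' \<beta> y] inc_cycle_eq[of C' r' \<beta>' y] C C' rR \<beta> ra X by auto
  have "r \<in> star x (\<not> colour a)" using rR Rsub R(2)[of r] unfolding star_def by auto
  then obtain e where e: "star x (\<not> colour a) = {r,e}" "e \<noteq> r" using star_x card2_other by metis
  have eL: "e \<in> \<Lambda>" "x \<in> img e" "colour e = (\<not> colour a)" using e unfolding star_def by blast+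
  have "e \<noteq> a" using eL(3) by auto
  then have "e \<notin> C" "e \<notin> C'" using incx eL e(2) unfolding inc_def by blast+
  then have E: "img e - X \<subseteq> outside (supp C)" "img e - X \<subseteq> outside (supp C')"
    using not_reflex_outside C C' eL unfolding turning_eq_1 by blast+
  have "\<beta>' \<notin> inc C y" "\<beta> \<notin> inc C' y" using incy ra star_y(2) by auto
  then have "\<beta>' \<notin> C" "\<beta> \<notin> C'" using \<beta> unfolding inc_def by blast+
  then have B: "img \<beta>' - X \<subseteq> outside (supp C)" "img \<beta> - X \<subseteq> outside (supp C')"
    using not_reflex_outside C C' \<beta> unfolding turning_eq_1 by blast+
  obtain z where z: "img a \<inter> X = {x,z}" "x \<noteq> z" "arc_between (img a) x z"
    using link_ends[OF a X(1)] by blast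
  obtain o' where o': "o' \<in> img a" "o' \<notin> X" using link_inner(2)[OF a(1)] by blast
  have "o' \<noteq> x" "o' \<noteq> z" using o' z by blast+
  then obtain A0 where A0: "arc_between A0 x o'" "A0 \<subseteq> img a" "z \<notin> A0"
    using arc_between_initial[OF z(3) o'(1)] by blast
  have "A0 \<inter> supp R \<subseteq> X" using link_disjoint[OF a(1)] Rsub ra(2) A0(2) unfolding supp_def by blast
  then have "A0 \<inter> supp R = {x}"
    using z(1) A0 arc_between_facts(3)[OF A0(1)] arc_between_facts(3)[OF Rarc] by blast
  then have A: "arc_between (A0 \<union> supp R) o' y"
    using arc_between_join[OF arc_between_sym[OF A0(1)] Rarc] by blast
  have sub: "A0 \<union> supp R \<subseteq> supp C" "A0 \<union> supp R \<subseteq> supp C'"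
    using A0(2) C(2) C'(2) unfolding supp_def by blast+
  have xy: "x \<noteq> y" using chain_ends_in(3)[OF R(1)] .
  \<comment> \<open>In \<open>W\<close> only the links at \<open>y\<close> are visible.\<close>
  define W where "W = - (\<Union>m\<in>{m \<in> \<Lambda>. y \<notin> img m}. img m) \<inter> - {o'}"
  have "open W" unfolding W_def
    using finite_links link_closed by (intro open_Int open_Compl closed_UN) auto
  moreover have "y \<in> W" unfolding W_def using X o' by blast
  moreover have "{l \<in> \<Lambda>. y \<in> img l \<and> colour l = colour a} = {\<beta>, \<beta>'}"
    using star_y(1) unfolding star_def .
  ultimately obtain N H1 H2 where N: "open N" "y \<in> N" "N \<subseteq> W" "connected H1" "connected H2"
    "N - (img \<beta> \<union> img \<beta>') = H1 \<union> H2" using two_sided[OF X(2) _ star_y(2)] by meson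
  have near: "m \<in> inc D y" if "D \<subseteq> \<Lambda>" "m \<in> D" "w \<in> N" "w \<in> img m" for D m w
    using that N(3) unfolding W_def inc_def by blast
  have NL: "N \<inter> supp D \<subseteq> (A0 \<union> supp R) \<union> img \<gamma>" if "D \<subseteq> \<Lambda>" "inc D y = {r',\<gamma>}" for D \<gamma>
  proof
    fix w assume w: "w \<in> N \<inter> supp D"
    then obtain m where m: "m \<in> D" "w \<in> img m" unfolding supp_def by blast
    then have "m = r' \<or> m = \<gamma>" using near[OF that(1) m(1)] w that(2) by blast
    then show "w \<in> (A0 \<union> supp R) \<union> img \<gamma>" using m(2) rR(3) img_sub_supp by blast
  qed
  have "y \<in> closure (img \<beta> - X)" "y \<in> closure (img \<beta>' - X)" using link_inner(3) \<beta> by blast+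
  then have "N \<inter> (img \<beta> - X) \<noteq> {}" "N \<inter> (img \<beta>' - X) \<noteq> {}"
    using open_Int_closure_eq_empty[OF N(1)] N(2) by blast+
  then obtain b b' where b: "b \<in> N" "b \<in> img \<beta>" "b \<notin> X" and b': "b' \<in> N" "b' \<in> img \<beta>'" "b' \<notin> X"
    by blast
  show False
  proof (rule not_both_turns_convex[OF cycle_jordan[OF C(1)] cycle_jordan[OF C'(1)] A sub])
    show "x \<in> A0 \<union> supp R - {o',y}" using xy X(1) o' arc_between_facts(3)[OF Rarc] by blast
    show "connected (insert x (img e - X))" "img e - X \<noteq> {}" using link_inner eL by blast+
    show "img \<beta> \<subseteq> supp C" "img \<beta>' \<subseteq> supp C'" using C(2) C'(2) img_sub_supp by blast+
    show "o' \<notin> N" using N(3) unfolding W_def by blast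
    show "N - (img \<beta> \<union> img \<beta>') = H1 \<union> H2" "connected H1" "connected H2" by (fact N)+
  qed (use E B N NL[OF cycle_sub[OF C(1)] incy(1)] NL[OF cycle_sub[OF C'(1)] incy(2)] b b' \<beta> in auto)
qed

end

section \<open>Cycles of small turning\<close>

text \<open>The partial sums never exceed 1, and a partial sum 1 is attained only when the last nonzero term is 1,
which is the invariant of the induction.\<close>

lemma alternating_sum_le_1:
  fixes f :: "nat \<Rightarrow> int"
  assumes "\<And>j. f j \<in> {-1, 0, 1}"
    and "\<And>j k. \<lbrakk>i < j; j < k; k \<le> n; f j = 1; f k = 1; \<And>m. j < m \<Longrightarrow> m < k \<Longrightarrow> f m = 0\<rbrakk> \<Longrightarrow> False"
  shows "(\<Sum>j\<in>{i<..n}. f j) \<le> 1"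
proof -
  have "(\<Sum>j\<in>{i<..n}. f j) \<le> 0 \<or>
    ((\<Sum>j\<in>{i<..n}. f j) = 1 \<and> (\<exists>j. i < j \<and> j \<le> n \<and> f j = 1 \<and> (\<forall>m. j < m \<longrightarrow> m \<le> n \<longrightarrow> f m = 0)))"
    using assms(2)
  proof (induction n)
    case 0
    then show ?case by simp
  next
    case (Suc n)
    have IH: "(\<Sum>j\<in>{i<..n}. f j) \<le> 0 \<or>
      ((\<Sum>j\<in>{i<..n}. f j) = 1 \<and> (\<exists>j. i < j \<and> j \<le> n \<and> f j = 1 \<and> (\<forall>m. j < m \<longrightarrow> m \<le> n \<longrightarrow> f m = 0)))"
    proof (rule Suc.IH)
      fix j k assume "i < j" "j < k" "k \<le> n" "f j = 1" "f k = 1" "\<And>m. j < m \<Longrightarrow> m < k \<Longrightarrow> f m = 0"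
      then show False using Suc.prems[of j k] by auto
    qed
    show ?case
    proof (cases "i < Suc n")
      case False
      then show ?thesis by simp
    next
      case True
      then have "{i<..Suc n} = insert (Suc n) {i<..n}" by auto
      then have s: "(\<Sum>j\<in>{i<..Suc n}. f j) = f (Suc n) + (\<Sum>j\<in>{i<..n}. f j)" by simp
      consider "f (Suc n) = -1" | "f (Suc n) = 0" | "f (Suc n) = 1"
        using assms(1)[of "Suc n"] by blast
      then show ?thesis
      proof cases
        case 1
        then show ?thesis using IH s by linarith
      next
        case 2
        then show ?thesis using IH s by (metis add_0 le_Suc_eq)
      next
        case 3
        have "(\<Sum>j\<in>{i<..n}. f j) \<le> 0"
        proof (rule ccontr)
          assume "\<not> ?thesis"
          then obtain j where j: "i < j" "j \<le> n" "f j = 1" "\<And>m. j < m \<Longrightarrow> m \<le> n \<Longrightarrow> f m = 0"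
            using IH by blast
          show False using Suc.prems[of j "Suc n"] j 3 by auto
        qed
        then consider "(\<Sum>j\<in>{i<..Suc n}. f j) \<le> 0" | "(\<Sum>j\<in>{i<..Suc n}. f j) = 1"
          using s 3 by linarith
        then show ?thesis using 3 True by cases auto
      qed
    qed
  qed
  then show ?thesis by linarith
qed

context link_system
begin

text \<open>Walks are indexed by natural numbers, so that a final segment of a walk is again described by the same
functions.\<close>

definition steps :: "nat \<Rightarrow> nat \<Rightarrow> (nat \<Rightarrow> 'l) \<Rightarrow> (nat \<Rightarrow> complex) \<Rightarrow> bool" where
  "steps i k l y \<longleftrightarrow> (\<forall>j. i \<le> j \<longrightarrow> j < k \<longrightarrow> l j \<in> \<Lambda> \<and> img (l j) \<inter> X = {y j, y (Suc j)} \<and> y j \<noteq> y (Suc j))"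

lemma stepsD:
  assumes "steps i k l y" "i \<le> j" "j < k"
  shows "l j \<in> \<Lambda>" "img (l j) \<inter> X = {y j, y (Suc j)}" "y j \<in> img (l j)" "y (Suc j) \<in> img (l j)"
    "y j \<in> X" "y (Suc j) \<in> X"
  using assms unfolding steps_def by blast+

lemma steps_chain:
  assumes "steps i k l y" "i < k" "inj_on y {i..k}"
  shows "chain (l ` {i..<k}) (y i) (y k) \<and> X \<inter> supp (l ` {i..<k}) = y ` {i..k}"
  using assms
proof (induction k)
  case 0
  then show ?case by simp
next
  case (Suc k)
  show ?case
  proof (cases "i = k")
    case True
    note s = stepsD[OF Suc.prems(1), of k]
    have "{i..Suc k} = {k, Suc k}" using True by auto
    then have "l ` {i..<Suc k} = {l k}" "y ` {i..Suc k} = {y k, y (Suc k)}" using True by auto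
    then show ?thesis using chain_single[OF s(1,2)] s(2) True by (auto simp: supp_single)
  next
    case False
    then have ik: "i < k" using Suc.prems by simp
    have st: "steps i k l y" using Suc.prems(1) unfolding steps_def by auto
    have inj: "inj_on y {i..k}" using Suc.prems(3) by (rule inj_on_subset) auto
    have IH: "chain (l ` {i..<k}) (y i) (y k)" "X \<inter> supp (l ` {i..<k}) = y ` {i..k}"
      using Suc.IH[OF st ik inj] by auto
    note s = stepsD[OF Suc.prems(1), of k]
    have "y (Suc k) \<notin> y ` {i..k}" using Suc.prems(2,3) unfolding inj_on_def by fastforce
    then have "y (Suc k) \<notin> supp (l ` {i..<k})" using IH(2) s(6) ik by auto
    then have "chain (insert (l k) (l ` {i..<k})) (y i) (y (Suc k))"
      using chain_extend[OF IH(1)] s(1,2) ik by auto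
    moreover have "l ` {i..<Suc k} = insert (l k) (l ` {i..<k})"
      using ik by (simp add: atLeastLessThanSuc)
    moreover have "X \<inter> supp (insert (l k) (l ` {i..<k})) = y ` {i..Suc k}"
    proof -
      have "X \<inter> supp (insert (l k) (l ` {i..<k})) = {y k, y (Suc k)} \<union> y ` {i..k}"
        using s(2) ik IH(2) unfolding supp_insert by auto
      also have "\<dots> = y ` {i..Suc k}" using ik by (auto simp: atLeastAtMostSuc_conv)
      finally show ?thesis .
    qed
    ultimately show ?thesis by simp
  qed
qed

definition turn :: "(nat \<Rightarrow> 'l) \<Rightarrow> nat \<Rightarrow> bool" where
  "turn l j \<longleftrightarrow> colour (l j) \<noteq> colour (l (j - 1))"

text \<open>The turns of a zigzag are at points where the curve that is entered passes straight through. This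
provides the branch in the back that \<open>one_branch_safe\<close> needs at its first corner.\<close>

definition zigzag :: "nat \<Rightarrow> (nat \<Rightarrow> 'l) \<Rightarrow> (nat \<Rightarrow> complex) \<Rightarrow> bool" where
  "zigzag n l y \<longleftrightarrow> steps 0 n l y \<and>
     (\<forall>j. 0 < j \<longrightarrow> j < n \<longrightarrow> l j \<noteq> l (j - 1) \<and> (turn l j \<longrightarrow> card (star (y j) (colour (l j))) = 2)) \<and>
     (\<forall>j k. 0 < j \<longrightarrow> j < k \<longrightarrow> k < n \<longrightarrow> turn l j \<longrightarrow> turn l k \<longrightarrow> (\<forall>i. j < i \<longrightarrow> i < k \<longrightarrow> \<not> turn l i) \<longrightarrow>
        safe (y j) (y k) (l ` {j - 1..k}))"

text \<open>Go straight on if the current curve continues. Otherwise the transversal curve passes through and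
offers two branches; take one that is safe with respect to the preceding turn, if there is one.\<close>

lemma zigzag_extend:
  assumes z: "zigzag n l y" and n: "0 < n" and inj: "inj_on y {..n}"
  obtains m z where "zigzag (Suc n) (l(n := m)) (y(Suc n := z))"
proof -
  note result = that
  have st: "steps 0 n l y" using z unfolding zigzag_def by blast
  define a where "a = l (n - 1)"
  define x where "x = y n"
  have a: "a \<in> \<Lambda>" "x \<in> img a" "x \<in> X"
    using stepsD[OF st, of "n - 1"] n unfolding a_def x_def by auto
  \<comment> \<open>Any link \<open>m\<close> at the end \<open>x\<close> will do that respects the three conditions on a zigzag at index \<open>n\<close>.\<close>
  have main: thesis if m: "m \<in> \<Lambda>" "x \<in> img m" "m \<noteq> a"
    and t: "colour m \<noteq> colour a \<Longrightarrow> card (star x (colour m)) = 2"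
    and s: "\<And>j. \<lbrakk>colour m \<noteq> colour a; 0 < j; j < n; turn l j; \<And>i. j < i \<Longrightarrow> i < n \<Longrightarrow> \<not> turn l i\<rbrakk>
       \<Longrightarrow> safe (y j) x (insert m (l ` {j - 1..<n}))" for m
  proof -
    obtain w where w: "img m \<inter> X = {x,w}" "x \<noteq> w" using link_ends[OF m(1,2) a(3)] by blast
    define l' where "l' = l(n := m)"
    define y' where "y' = y(Suc n := w)"
    have tn: "turn l' j = turn l j" if "j < n" for j using that unfolding turn_def l'_def by auto
    have tnn: "turn l' n \<longleftrightarrow> colour m \<noteq> colour a" unfolding turn_def l'_def a_def using n by auto
    have "steps 0 (Suc n) l' y'"
      unfolding steps_def
    proof (intro allI impI)
      fix j assume "j < Suc n"
      then consider "j < n" | "j = n" by linarith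
      then show "l' j \<in> \<Lambda> \<and> img (l' j) \<inter> X = {y' j, y' (Suc j)} \<and> y' j \<noteq> y' (Suc j)"
      proof cases
        case 1
        then show ?thesis using st unfolding steps_def l'_def y'_def by auto
      next
        case 2
        then show ?thesis using w m unfolding l'_def y'_def x_def by auto
      qed
    qed
    moreover have "l' j \<noteq> l' (j - 1) \<and> (turn l' j \<longrightarrow> card (star (y' j) (colour (l' j))) = 2)" if "0 < j" "j < Suc n" for j
    proof (cases "j = n")
      case True
      then show ?thesis using t tnn m n unfolding l'_def y'_def x_def a_def by auto
    next
      case False
      then have "j < n" using that by simp
      then show ?thesis using z tn[of j] that unfolding zigzag_def l'_def y'_def by auto
    qed
    moreover have "safe (y' j) (y' k) (l' ` {j - 1..k})"
      if jk: "0 < j" "j < k" "k < Suc n" "turn l' j" "turn l' k" "\<forall>i. j < i \<longrightarrow> i < k \<longrightarrow> \<not> turn l' i" for j k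
    proof (cases "k = n")
      case True
      have "l' ` {j - 1..n} = insert m (l ` {j - 1..<n})"
      proof -
        have "{j - 1..n} = insert n {j - 1..<n}" using jk(2) True by auto
        then show ?thesis unfolding l'_def by auto
      qed
      moreover have "safe (y j) x (insert m (l ` {j - 1..<n}))"
        using s[of j] jk tn tnn True by auto
      ultimately show ?thesis using True jk unfolding y'_def x_def by simp
    next
      case False
      then have "k < n" using that by simp
      moreover have "l' ` {j - 1..k} = l ` {j - 1..k}" using \<open>k < n\<close> unfolding l'_def by auto
      moreover have "\<forall>i. j < i \<longrightarrow> i < k \<longrightarrow> \<not> turn l i" using jk(6) tn \<open>k < n\<close> by auto
      moreover have "turn l j" "turn l k" using jk tn \<open>k < n\<close> by auto
      ultimately show ?thesis using z jk(1,2) unfolding zigzag_def y'_def by simp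
    qed
    ultimately have "zigzag (Suc n) l' y'" unfolding zigzag_def by blast
    then show thesis using result unfolding l'_def y'_def by blast
  qed
  show thesis
  proof (cases "card (star x (colour a)) = 2")
    case True
    have "a \<in> star x (colour a)" using a unfolding star_def by blast
    then obtain m where m: "star x (colour a) = {a,m}" "m \<noteq> a" using card2_other True by metis
    then have "m \<in> \<Lambda>" "x \<in> img m" "colour m = colour a" unfolding star_def by blast+
    then show thesis using main[of m] m(2) by blast
  next
    case False
    obtain s where s: "card {l \<in> \<Lambda>. x \<in> img l \<and> colour l = s} = 2" using passes[OF a(3)] by blast
    then have c2: "card (star x (\<not> colour a)) = 2"
      using False unfolding star_def by (cases "s = colour a") auto
    then obtain \<beta> \<beta>' where b: "star x (\<not> colour a) = {\<beta>,\<beta>'}" "\<beta> \<noteq> \<beta>'" by (auto simp: card_2_iff)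
    have mb: "m \<in> \<Lambda>" "x \<in> img m" "colour m = (\<not> colour a)" "m \<noteq> a" if "m \<in> {\<beta>,\<beta>'}" for m
      using that b(1)[symmetric] unfolding star_def by auto
    show thesis
    proof (cases "\<exists>j. 0 < j \<and> j < n \<and> turn l j")
      case False
      then show thesis using main[of \<beta>] mb[of \<beta>] c2 by auto
    next
      case True
      \<comment> \<open>the last turn; from there to \<open>x\<close> the zigzag runs along a single curve\<close>
      define j where "j = (GREATEST j. 0 < j \<and> j < n \<and> turn l j)"
      have j: "0 < j \<and> j < n \<and> turn l j" unfolding j_def
        by (rule GreatestI_ex_nat[where b = n, OF True]) auto
      have jmax: "k \<le> j" if "0 < k" "k < n" "turn l k" for k unfolding j_def
        by (rule Greatest_le_nat[where b = n]) (use that in auto)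
      have run: "colour (l i) = colour a" if "j \<le> i" "i < n" for i
        using that
      proof (induction "n - i" arbitrary: i)
        case 0
        then show ?case by simp
      next
        case (Suc d)
        show ?case
        proof (cases "Suc i = n")
          case True
          then show ?thesis unfolding a_def by auto
        next
          case False
          then have "colour (l (Suc i)) = colour a" using Suc by auto
          moreover have "\<not> turn l (Suc i)" using jmax[of "Suc i"] Suc.prems False by auto
          ultimately show ?thesis unfolding turn_def by simp
        qed
      qed
      have st': "steps j n l y" using st unfolding steps_def by auto
      have "inj_on y {j..n}" using inj by (rule inj_on_subset) auto
      then have ch: "chain (l ` {j..<n}) (y j) x"
        using steps_chain[OF st'] j unfolding x_def by blast
      have b0: "l (j - 1) \<in> \<Lambda>" "y j \<in> img (l (j - 1))" using stepsD[OF st, of "j - 1"] j by auto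
      have sg: "colour (l (j - 1)) = (\<not> colour a)" using j run[of j] unfolding turn_def by auto
      have "card (star (y j) (colour (l j))) = 2" using z j unfolding zigzag_def by blast
      then have cj: "card (star (y j) (colour a)) = 2" using run[of j] j by simp
      have im: "insert (l (j - 1)) (l ` {j..<n}) = l ` {j - 1..<n}"
      proof -
        have "{j - 1..<n} = insert (j - 1) {j..<n}" using j by auto
        then show ?thesis by simp
      qed
      have "safe (y j) x (insert \<beta> (l ` {j - 1..<n})) \<or> safe (y j) x (insert \<beta>' (l ` {j - 1..<n}))"
        unfolding im[symmetric]
        by (rule one_branch_safe[OF b0 ch]) (use run sg cj b in auto)
      then obtain m where m: "m \<in> {\<beta>,\<beta>'}" "safe (y j) x (insert m (l ` {j - 1..<n}))" by blast
      show thesis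
      proof (rule main[of m])
        fix k assume k: "0 < k" "k < n" "turn l k" "\<And>i. k < i \<Longrightarrow> i < n \<Longrightarrow> \<not> turn l i"
        then have "k = j" using jmax[of k] j by (metis le_neq_implies_less)
        then show "safe (y k) x (insert m (l ` {k - 1..<n}))" using m by simp
      qed (use mb[OF m(1)] c2 in auto)
    qed
  qed
qed

text \<open>A zigzag can always be extended, but there are only finitely many vertices.\<close>

lemma zigzag_closes:
  assumes l0: "l0 \<in> \<Lambda>" "p \<in> img l0" "p \<in> X"
  obtains n l y where "zigzag (Suc n) l y" "l 0 = l0" "y 0 = p" "inj_on y {..n}" "\<And>j. 0 < j \<Longrightarrow> j \<le> n \<Longrightarrow> y j \<notin> F"
    "y (Suc n) \<in> F \<union> y ` {..n}"
proof (rule ccontr)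
  assume na: "\<not> thesis"
  have "\<exists>l y. zigzag (Suc n) l y \<and> l 0 = l0 \<and> y 0 = p \<and> inj_on y {..n} \<and> (\<forall>j. 0 < j \<longrightarrow> j \<le> n \<longrightarrow> y j \<notin> F)" for n
  proof (induction n)
    case 0
    obtain z where z: "img l0 \<inter> X = {p,z}" "p \<noteq> z" using link_ends[OF l0] by blast
    define y where "y j = (if j = 0 then p else z)" for j :: nat
    have "zigzag (Suc 0) (\<lambda>_. l0) y" unfolding zigzag_def steps_def y_def using l0 z by auto
    moreover have "y 0 = p" unfolding y_def by simp
    ultimately show ?case by auto
  next
    case (Suc n)
    then obtain l y where ly: "zigzag (Suc n) l y" "l 0 = l0" "y 0 = p" "inj_on y {..n}" "\<forall>j. 0 < j \<longrightarrow> j \<le> n \<longrightarrow> y j \<notin> F"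
      by blast
    then have new: "y (Suc n) \<notin> F" "y (Suc n) \<notin> y ` {..n}" using na that by blast+
    then have inj: "inj_on y {..Suc n}" using ly(4) by (simp add: atMost_Suc)
    obtain m z where mz: "zigzag (Suc (Suc n)) (l(Suc n := m)) (y(Suc (Suc n) := z))"
      using zigzag_extend[OF ly(1) _ inj] by blast
    moreover have "inj_on (y(Suc (Suc n) := z)) {..Suc n}"
      using inj by (rule inj_on_cong[THEN iffD1, rotated]) auto
    moreover have "(y(Suc (Suc n) := z)) j \<notin> F" if "0 < j" "j \<le> Suc n" for j
      using ly(5) new that by (cases "j = Suc n") auto
    moreover have "(l(Suc n := m)) 0 = l0" "(y(Suc (Suc n) := z)) 0 = p" using ly(2,3) by simp_all
    ultimately show ?case by blast
  qed
  then obtain l y where ly: "zigzag (Suc (card X)) l y" "inj_on y {..card X}" by blast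
  have "y ` {..card X} \<subseteq> X"
    using ly(1) stepsD(5) unfolding zigzag_def by fastforce
  then have "card {..card X} \<le> card X" using card_inj_on_le[OF ly(2)] finite_X by blast
  then show False by simp
qed

text \<open>The corners of the loop other than its starting point come from turns of the zigzag, among which no two
consecutive ones are convex. They contribute at most 1, and the starting point at most 1 more.\<close>

lemma zigzag_loop:
  assumes z: "zigzag (Suc n) l y" and inj: "inj_on y {..n}" and i: "i \<le> n" "y (Suc n) = y i"
  shows "cycle (l ` {i..n})" "total_turning (l ` {i..n}) \<le> 2"
proof -
  have st: "steps 0 (Suc n) l y" using z unfolding zigzag_def by blast
  note s = stepsD[OF st]
  have "y n \<noteq> y (Suc n)" using st unfolding steps_def by blast
  then have iln: "i < n" using i by (metis le_neq_implies_less)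
  have st': "steps i n l y" using st unfolding steps_def by auto
  have inj': "inj_on y {i..n}" using inj by (rule inj_on_subset) auto
  have R: "chain (l ` {i..<n}) (y i) (y n)" "X \<inter> supp (l ` {i..<n}) = y ` {i..n}"
    using steps_chain[OF st' iln inj'] by auto
  have ln: "l n \<in> \<Lambda>" "img (l n) \<inter> X = {y n, y i}" using s[of n] i by auto
  have L: "chain {l n} (y i) (y n)" using chain_sym[OF chain_single[OF ln]] .
  have new: "l n \<noteq> l j" if "i \<le> j" "j < n" for j
  proof (cases "j = n - 1")
    case True
    then show ?thesis using z iln unfolding zigzag_def by auto
  next
    case False
    then have "n \<noteq> j" "n \<noteq> Suc j" using that by auto
    then have "y n \<notin> {y j, y (Suc j)}" using inj that by (simp add: inj_on_eq_iff)
    then show ?thesis using ln(2) s(2)[of j] that by auto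
  qed
  have Rsub: "l ` {i..<n} \<subseteq> \<Lambda>" using R(1) unfolding chain_def by blast
  have "l n \<notin> l ` {i..<n}" using new by (metis imageE atLeastLessThan_iff)
  then have "supp (l ` {i..<n}) \<inter> img (l n) \<subseteq> X"
    using link_disjoint[OF ln(1)] Rsub unfolding supp_def by blast
  then have int: "supp (l ` {i..<n}) \<inter> supp {l n} = {y i, y n}"
    using ln(2) chain_ends_in(1,2)[OF R(1)] unfolding supp_single by blast
  have eq: "l ` {i..<n} \<union> {l n} = l ` {i..n}"
  proof -
    have "{i..n} = insert n {i..<n}" using iln by auto
    then show ?thesis by simp
  qed
  show C: "cycle (l ` {i..n})" using chain_close[OF R(1) L int] unfolding eq .
  define C where "C = l ` {i..n}"
  have verts: "X \<inter> supp C = y ` {i..n}"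
  proof -
    have "X \<inter> supp C = X \<inter> supp (l ` {i..<n}) \<union> X \<inter> img (l n)"
      unfolding C_def eq[symmetric] supp_Un supp_single by blast
    also have "X \<inter> img (l n) = {y n, y i}" using ln(2) by blast
    also have "X \<inter> supp (l ` {i..<n}) \<union> {y n, y i} = y ` {i..n}" using R(2) iln by auto
    finally show ?thesis .
  qed
  have tj: "corner C (y j) \<longleftrightarrow> turn l j" if j: "i < j" "j \<le> n" for j
  proof -
    have "j - 1 \<in> {i..n}" "j \<in> {i..n}" using j by auto
    then have "l (j - 1) \<in> C" "l j \<in> C" unfolding C_def by blast+
    moreover have "l j \<noteq> l (j - 1)" using z j unfolding zigzag_def by auto
    moreover have "y j \<in> img (l j)" "y j \<in> img (l (j - 1))" "y j \<in> X"
      using s[of j] s[of "j - 1"] j by auto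
    ultimately have "inc C (y j) = {l (j - 1), l j}"
      using inc_cycle_eq[of C "l (j - 1)" "l j"] C unfolding C_def by auto
    then show ?thesis unfolding corner_def turn_def by auto
  qed
  have "total_turning C = (\<Sum>j\<in>{i..n}. turning C (y j))"
    unfolding total_turning_def verts using inj' by (simp add: sum.reindex)
  also have "{i..n} = insert i {i<..n}" using iln by auto
  also have "(\<Sum>j\<in>insert i {i<..n}. turning C (y j)) = turning C (y i) + (\<Sum>j\<in>{i<..n}. turning C (y j))" by simp
  also have "(\<Sum>j\<in>{i<..n}. turning C (y j)) \<le> 1"
  proof (rule alternating_sum_le_1)
    show "turning C (y j) \<in> {-1,0,1}" for j unfolding turning_def by simp
    fix j k assume jk: "i < j" "j < k" "k \<le> n" "turning C (y j) = 1" "turning C (y k) = 1"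
      and between: "\<And>m. j < m \<Longrightarrow> m < k \<Longrightarrow> turning C (y m) = 0"
    have "turn l j" "turn l k" using jk tj[of j] tj[of k] unfolding turning_eq_1 by auto
    moreover have "\<not> turn l m" if "j < m" "m < k" for m
      using between[OF that] tj[of m] that jk unfolding turning_def by (auto split: if_splits)
    ultimately have "safe (y j) (y k) (l ` {j - 1..k})" using z jk unfolding zigzag_def by auto
    moreover have "l ` {j - 1..k} \<subseteq> C" using jk unfolding C_def by auto
    ultimately show False using C jk unfolding safe_def C_def by blast
  qed
  finally show "total_turning (l ` {i..n}) \<le> 2"
    using turning_bounds(2)[of C "y i"] unfolding C_def by linarith
qed

text \<open>With four corners and turning less than 4 there is a reflex corner \<open>p\<close>, and a link \<open>l0\<close> enters the
inside there. The zigzag starting with \<open>l0\<close> stays inside until it meets the cycle or itself, and in both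
cases it bounds, alone or together with a part of the cycle, a strictly smaller region.\<close>

lemma smaller_cycle:
  assumes C: "cycle C" and t: "total_turning C < 4"
  obtains C' where "cycle C'" "total_turning C' < 4" "disc C' \<subset> disc C"
proof -
  have sub: "C \<subseteq> \<Lambda>" using C cycle_sub by blast
  have J: "jordan (supp C)" using cycle_jordan[OF C] .
  have "C \<noteq> {}" using jordan_facts(12)[OF J] unfolding supp_def by auto
  have corner_eq: "{x \<in> X. \<exists>a\<in>C. \<exists>b\<in>C. x \<in> img a \<and> x \<in> img b \<and> colour a \<noteq> colour b} = {x \<in> X \<inter> supp C. corner C x}"
    unfolding corner_def inc_def supp_def by blast
  have "4 \<le> card {x \<in> X \<inter> supp C. corner C x}"
    unfolding corner_eq[symmetric]
  proof (rule four_corners[OF sub \<open>C \<noteq> {}\<close>])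
    fix x l assume x: "x \<in> X" "l \<in> C" "x \<in> img l"
    then have "card (inc C x) = 2" using C img_sub_supp unfolding cycle_def by blast
    moreover have "l \<in> inc C x" using x unfolding inc_def by blast
    ultimately obtain m where "inc C x = {l,m}" "m \<noteq> l" using card2_other by metis
    then show "\<exists>m\<in>C. m \<noteq> l \<and> x \<in> img m" unfolding inc_def by blast
  qed
  moreover have "total_turning C = card {x \<in> X \<inter> supp C. corner C x}" if "\<And>x. x \<in> X \<inter> supp C \<Longrightarrow> corner C x \<Longrightarrow> \<not> reflex C x"
  proof -
    have "total_turning C = (\<Sum>x\<in>X \<inter> supp C. if corner C x then 1 else 0)"
      unfolding total_turning_def by (rule sum.cong) (use that in \<open>auto simp: turning_def\<close>)
    also have "\<dots> = card {x \<in> X \<inter> supp C. corner C x}"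
      using finite_X by (simp add: sum.If_cases Int_def)
    finally show ?thesis .
  qed
  ultimately obtain p where p: "p \<in> X" "p \<in> supp C" "reflex C p" using t by fastforce
  then obtain l0 where l0: "l0 \<in> \<Lambda>" "l0 \<notin> C" "p \<in> img l0" "img l0 - X \<subseteq> disc C"
    unfolding reflex_def by blast
  obtain n l y where z: "zigzag (Suc n) l y" "l 0 = l0" "y 0 = p" "inj_on y {..n}"
    and new: "\<And>j. 0 < j \<Longrightarrow> j \<le> n \<Longrightarrow> y j \<notin> supp C" and close: "y (Suc n) \<in> supp C \<union> y ` {..n}"
    using zigzag_closes[OF l0(1,3) p(1), of "supp C"] by blast
  have st: "steps 0 (Suc n) l y" using z unfolding zigzag_def by blast
  note s = stepsD[OF st]
  have ins: "img (l j) - X \<subseteq> disc C \<and> (0 < j \<longrightarrow> y j \<in> disc C)" if "j \<le> n" for j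
    using that
  proof (induction j)
    case 0
    then show ?case using l0 z by simp
  next
    case (Suc j)
    have yin: "y (Suc j) \<in> disc C"
      using link_inside_to[OF C s(1) s(4) new[of "Suc j"]] Suc by auto
    have "y (Suc j) \<notin> supp C" using new Suc.prems by simp
    then have "l (Suc j) \<notin> C" using s(3)[of "Suc j"] Suc.prems img_sub_supp by fastforce
    then show ?case using link_inside_from[OF C s(1) _ s(3) yin] yin Suc.prems by auto
  qed
  show thesis
  proof (cases "y (Suc n) \<in> y ` {..n}")
    case True
    then obtain i where i: "i \<le> n" "y (Suc n) = y i" by auto
    note L = zigzag_loop[OF z(1,4) i]
    have vin: "y j \<in> supp C \<union> disc C" if "j \<le> n" for j
      using ins[OF that] p z(3) by (cases "j = 0") auto
    have "img (l j) \<subseteq> supp C \<union> disc C" if "j \<le> n" for j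
    proof -
      have "y (Suc j) \<in> supp C \<union> disc C"
        using vin[of "Suc j"] vin[of i] i that by (cases "j = n") auto
      moreover have "img (l j) \<subseteq> (img (l j) - X) \<union> {y j, y (Suc j)}" using s(2)[of j] that by auto
      ultimately show ?thesis using vin[OF that] ins[OF that] by blast
    qed
    then have sub': "supp (l ` {i..n}) \<subseteq> supp C \<union> disc C" unfolding supp_def[of "l ` _"]
      by fastforce
    obtain w where "w \<in> img (l n) - X" using link_inner(2)[OF s(1)[of n]] by auto
    then have "w \<in> supp (l ` {i..n})" "w \<in> disc C"
      using ins[of n] i(1) unfolding supp_def[of "l ` _"] by auto
    moreover have "disc C \<inter> supp C = {}" by (rule inside_no_overlap)
    ultimately have "supp (l ` {i..n}) \<noteq> supp C" by blast
    then show thesis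
      using that[OF L(1)] L(2) inside_jordan_psubset[OF J cycle_jordan[OF L(1)] sub'] by linarith
  next
    case False
    define q where "q = y (Suc n)"
    have inj: "inj_on y {0..Suc n}" using False z(4) by (simp add: atMost_Suc atLeast0AtMost)
    have q: "q \<in> X" "q \<in> supp C" "q \<noteq> p"
      using s(6)[of n] False close z(3) unfolding q_def by auto
    define P where "P = l ` {0..<Suc n}"
    have P: "chain P p q" "X \<inter> supp P = y ` {0..Suc n}"
      using steps_chain[OF st _ inj] z(3) unfolding P_def q_def by auto
    have Pin: "supp P - {p,q} \<subseteq> disc C"
    proof
      fix w assume w: "w \<in> supp P - {p,q}"
      then obtain j where "j \<in> {0..<Suc n}" and wj: "w \<in> img (l j)" unfolding P_def supp_def
        by blast
      then have j: "j \<le> n" "w \<in> img (l j)" by auto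
      show "w \<in> disc C"
      proof (cases "w \<in> X")
        case True
        then have "w \<in> y ` {0..Suc n}" using w P(2) by blast
        then obtain k where "k \<le> Suc n" "w = y k" by auto
        then have "0 < k" "k \<le> n" using w z(3) unfolding q_def by (auto simp: le_Suc_eq intro: gr0I)
        then show ?thesis using ins[of k] \<open>w = y k\<close> by auto
      next
        case False
        then show ?thesis using j ins[of j] by blast
      qed
    qed
    obtain Q1 Q2 where Q: "chain Q1 p q" "chain Q2 p q" "supp Q1 \<inter> supp Q2 = {p,q}" "Q1 \<union> Q2 = C"
      using cycle_split[OF C p(1,2) q(1,2)] q(3) by metis
    have "disc C \<inter> supp C = {}" by (rule inside_no_overlap)
    then have int: "supp P \<inter> supp (Q1 \<union> Q2) = {p,q}"
      using Pin p q chain_ends_in(1,2)[OF P(1)] unfolding Q(4) by blast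
    note th = theta_total_turning[OF Q(1,2) P(1) Q(3) int, unfolded Q(4), OF Pin]
    have "total_turning (Q1 \<union> P) < 4 \<or> total_turning (Q2 \<union> P) < 4" using th(3) t by linarith
    then show thesis using that th by blast
  qed
qed

theorem no_links: "\<Lambda> = {}"
proof (rule ccontr)
  assume "\<Lambda> \<noteq> {}"
  then obtain l0 where l0: "l0 \<in> \<Lambda>" by blast
  obtain p where p: "p \<in> img l0" "p \<in> X" using link[OF l0] by blast
  define \<I> where "\<I> = {disc C | C. cycle C \<and> total_turning C < 4}"
  have "\<I> \<subseteq> (\<lambda>C. disc C) ` Pow \<Lambda>" unfolding \<I>_def using cycle_sub by blast
  then have "finite \<I>" using finite_links finite_surj by (metis finite_Pow_iff)
  obtain n l y where z: "zigzag (Suc n) l y" "inj_on y {..n}" "y (Suc n) \<in> {} \<union> y ` {..n}"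
    by (rule zigzag_closes[OF l0 p, of "{}"]) (rule that)
  then obtain i where "i \<le> n" "y (Suc n) = y i" by auto
  then have "disc (l ` {i..n}) \<in> \<I>" unfolding \<I>_def using zigzag_loop[OF z(1,2)] by force
  then obtain I where I: "I \<in> \<I>" "\<And>I'. I' \<in> \<I> \<Longrightarrow> I' \<subseteq> I \<Longrightarrow> I = I'"
    using finite_has_minimal[OF \<open>finite \<I>\<close>] by blast
  obtain C where C: "cycle C" "total_turning C < 4" "I = disc C" using I(1) unfolding \<I>_def by blast
  obtain C' where C': "cycle C'" "total_turning C' < 4" "disc C' \<subset> disc C"
    using smaller_cycle[OF C(1,2)] by blast
  then show False using I(2)[of "disc C'"] C(3) unfolding \<I>_def by blast
qed

end

section \<open>Two families of curves in the plane\<close>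

definition extremal_on :: "'a set \<Rightarrow> (real \<Rightarrow> 'a) \<Rightarrow> real \<Rightarrow> bool" where
  "extremal_on Y e t \<longleftrightarrow> (\<forall>t'\<in>{0..<t}. e t' \<notin> Y) \<or> (\<forall>t'\<in>{t<..1}. e t' \<notin> Y)"

text \<open>The two families are indexed by truth values, so that statements about both need to be made only once.
A curve may be a loop and may meet other curves of its family at its ends, hence only interiors of
curves are assumed injective and disjoint.\<close>

locale plane_curves =
  fixes \<C> :: "bool \<Rightarrow> (real \<Rightarrow> complex) set" and K :: "bool \<Rightarrow> complex set" and X :: "complex set"
  assumes K_def: "K s = (\<Union>c\<in>\<C> s. c ` {0..1})" and X_def: "X = K True \<inter> K False"
    and finite_curves: "finite (\<C> s)"
    and curve_path: "c \<in> \<C> s \<Longrightarrow> path c"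
    and curve_inj: "c \<in> \<C> s \<Longrightarrow> inj_on c {0<..<1}"
    and curve_ends: "c \<in> \<C> s \<Longrightarrow> c 0 \<notin> X" "c \<in> \<C> s \<Longrightarrow> c 1 \<notin> X"
    and curves_disjoint: "\<lbrakk>c \<in> \<C> s; d \<in> \<C> s; c \<noteq> d\<rbrakk> \<Longrightarrow> c ` {0<..<1} \<inter> d ` {0<..<1} = {}"
    and meet_once: "\<lbrakk>c \<in> \<C> s; d \<in> \<C> (\<not> s); x \<in> c ` {0..1} \<inter> d ` {0..1}; y \<in> c ` {0..1} \<inter> d ` {0..1}\<rbrakk> \<Longrightarrow> x = y"
    and locally_two_sided: "\<lbrakk>x \<in> X; open W; x \<in> W\<rbrakk> \<Longrightarrow> \<exists>N H1 H2. open N \<and> x \<in> N \<and> N \<subseteq> W \<and>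
          connected H1 \<and> connected H2 \<and> N - K s = H1 \<union> H2"
begin

definition hits :: "(real \<Rightarrow> complex) \<Rightarrow> real set" where
  "hits c = {t \<in> {0..1}. c t \<in> X}"

lemma X_curve:
  assumes "x \<in> X"
  obtains c t where "c \<in> \<C> s" "t \<in> hits c" "c t = x"
proof -
  have "x \<in> K s" using assms unfolding X_def by (cases s) auto
  then obtain c t where "c \<in> \<C> s" "t \<in> {0..1}" "c t = x" unfolding K_def by auto
  then show thesis using that assms unfolding hits_def by blast
qed

lemma hits_inner: "\<lbrakk>c \<in> \<C> s; t \<in> hits c\<rbrakk> \<Longrightarrow> 0 < t \<and> t < 1"
  using curve_ends unfolding hits_def
    by (metis (mono_tags, lifting) atLeastAtMost_iff less_eq_real_def mem_Collect_eq)

lemma inner_unique: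
  assumes "c \<in> \<C> s" "d \<in> \<C> s" "0 < t" "t < 1" "0 < u" "u < 1" "c t = d u"
  shows "c = d \<and> t = u"
proof -
  have "c t \<in> c ` {0<..<1}" using assms(3,4) by simp
  moreover have "c t \<in> d ` {0<..<1}" unfolding assms(7) using assms(5,6) by simp
  ultimately have "c = d" using curves_disjoint[OF assms(1,2)] by blast
  then show ?thesis using inj_onD[OF curve_inj[OF assms(1)], of t u] assms by auto
qed

lemma hits_unique:
  assumes "c \<in> \<C> s" "d \<in> \<C> s" "t \<in> hits c" "u \<in> {0..1}" "c t = d u"
  shows "c = d \<and> t = u"
proof -
  have "u \<in> hits d" using assms unfolding hits_def by auto
  then show ?thesis using inner_unique hits_inner assms by blast
qed

lemma finite_X: "finite X"
proof -
  have "finite (c ` {0..1} \<inter> d ` {0..1})" if "c \<in> \<C> True" "d \<in> \<C> False" for c d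
  proof (cases "c ` {0..1} \<inter> d ` {0..1} = {}")
    case False
    then obtain x where x: "x \<in> c ` {0..1} \<inter> d ` {0..1}" by blast
    have "d \<in> \<C> (\<not> True)" using that(2) by simp
    then have "c ` {0..1} \<inter> d ` {0..1} \<subseteq> {x}" using meet_once[OF that(1) _ _ x] by blast
    then show ?thesis by (rule finite_subset) simp
  qed simp
  moreover have "X = (\<Union>c\<in>\<C> True. \<Union>d\<in>\<C> False. c ` {0..1} \<inter> d ` {0..1})" unfolding X_def K_def
    by blast
  ultimately show ?thesis using finite_curves by (metis (no_types, lifting) finite_UN_I)
qed

lemma finite_hits: "c \<in> \<C> s \<Longrightarrow> finite (hits c)"
proof -
  assume c: "c \<in> \<C> s"
  have "inj_on c (hits c)"
  proof (rule inj_onI)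
    fix t u assume "t \<in> hits c" "u \<in> hits c" "c t = c u"
    then show "t = u" using hits_unique[OF c c, of t u] unfolding hits_def by blast
  qed
  moreover have "c ` hits c \<subseteq> X" unfolding hits_def by auto
  ultimately show ?thesis using finite_X by (meson finite_imageD finite_subset)
qed

text \<open>A link is the part of the curve \<open>c\<close> between two consecutive crossing times. The family is recorded
because a function could belong to both.\<close>

definition links :: "(bool \<times> (real \<Rightarrow> complex) \<times> real \<times> real) set" where
  "links = {(s, c, a, b). c \<in> \<C> s \<and> a \<in> hits c \<and> b \<in> hits c \<and> a < b \<and> hits c \<inter> {a<..<b} = {}}"

definition limg :: "bool \<times> (real \<Rightarrow> complex) \<times> real \<times> real \<Rightarrow> complex set" where
  "limg = (\<lambda>(s, c, a, b). c ` {a..b})"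

lemma linksD:
  assumes "(s,c,a,b) \<in> links"
  shows "c \<in> \<C> s" "a \<in> hits c" "b \<in> hits c" "a < b" "\<And>t. t \<in> hits c \<Longrightarrow> a \<le> t \<Longrightarrow> t \<le> b \<Longrightarrow> t = a \<or> t = b"
    "0 < a" "b < 1"
proof -
  show 1: "c \<in> \<C> s" "a \<in> hits c" "b \<in> hits c" "a < b" using assms unfolding links_def by auto
  show "t = a \<or> t = b" if "t \<in> hits c" "a \<le> t" "t \<le> b" for t
    using assms that unfolding links_def by (auto simp: order.order_iff_strict)
  show "0 < a" "b < 1" using hits_inner[OF 1(1)] 1 by blast+
qed

lemma finite_links: "finite links"
proof -
  have "links \<subseteq> (\<Union>s. \<Union>c\<in>\<C> s. {s} \<times> {c} \<times> hits c \<times> hits c)" unfolding links_def by auto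
  moreover have "finite (\<Union>s. \<Union>c\<in>\<C> s. {s} \<times> {c} \<times> hits c \<times> hits c)"
    using finite_curves finite_hits by (intro finite_UN_I) auto
  ultimately show ?thesis by (rule finite_subset)
qed

lemma link_arc:
  assumes l: "(s,c,a,b) \<in> links"
  shows "arc_between (c ` {a..b}) (c a) (c b)" "c ` {a..b} \<inter> X = {c a, c b}"
proof -
  note d = linksD[OF l]
  have "inj_on c {a..b}" by (rule inj_on_subset[OF curve_inj[OF d(1)]]) (use d in auto)
  moreover have "path (subpath a b c)" using curve_path[OF d(1)] d by (intro path_subpath) auto
  ultimately have "arc (subpath a b c)"
    unfolding arc_subpath_eq using d by (simp add: closed_segment_eq_real_ivl)
  moreover have "path_image (subpath a b c) = c ` {a..b}" using d by (simp add: path_image_subpath)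
  ultimately show "arc_between (c ` {a..b}) (c a) (c b)"
    using arc_betweenI[of "subpath a b c"] by (simp add: pathstart_subpath pathfinish_subpath)
  have "c t \<in> X \<longleftrightarrow> t = a \<or> t = b" if "t \<in> {a..b}" for t
  proof
    assume "c t \<in> X"
    then have "t \<in> hits c" using that d unfolding hits_def by auto
    then show "t = a \<or> t = b" using d(5) that by auto
  qed (use d in \<open>auto simp: hits_def\<close>)
  then show "c ` {a..b} \<inter> X = {c a, c b}" using d(4) by auto
qed

lemma link_at:
  assumes "c \<in> \<C> s" "t \<in> hits c" and l: "(s,c',a,b) \<in> links" "c t \<in> c' ` {a..b}"
  shows "c' = c \<and> (t = a \<or> t = b)"
proof -
  note d = linksD[OF l(1)]
  obtain u where u: "u \<in> {a..b}" "c t = c' u" using l(2) by blast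
  moreover have "u \<in> {0..1}" using u d(6,7) by auto
  ultimately have "c = c' \<and> t = u" using hits_unique[OF assms(1) d(1) assms(2)] by blast
  then show ?thesis using d(5)[of t] assms(2) u by auto
qed

lemma link_succ_unique:
  "\<lbrakk>(s,c,a,b) \<in> links; (s,c,a,b') \<in> links\<rbrakk> \<Longrightarrow> b = b'"
  using linksD(5)[of s c a b b'] linksD(5)[of s c a b' b] linksD(3,4)
    by (metis less_irrefl less_le_not_le linear)

lemma link_pred_unique:
  "\<lbrakk>(s,c,a,b) \<in> links; (s,c,a',b) \<in> links\<rbrakk> \<Longrightarrow> a = a'"
  using linksD(5)[of s c a b a'] linksD(5)[of s c a' b a] linksD(2,4)
    by (metis less_irrefl less_le_not_le linear)

lemma links_disjoint:
  assumes l: "l \<in> links" and m: "m \<in> links" and "l \<noteq> m"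
  shows "limg l \<inter> limg m \<subseteq> X"
proof
  fix x assume x: "x \<in> limg l \<inter> limg m"
  obtain s c a b where l': "l = (s,c,a,b)" by (metis prod_cases4)
  obtain s' c' a' b' where m': "m = (s',c',a',b')" by (metis prod_cases4)
  note d = linksD[OF l[unfolded l']] and d' = linksD[OF m[unfolded m']]
  obtain t where t: "t \<in> {a..b}" "x = c t" using x unfolding l' limg_def by auto
  obtain t' where t': "t' \<in> {a'..b'}" "x = c' t'" using x unfolding m' limg_def by auto
  have "t \<in> {0..1}" "t' \<in> {0..1}" using t(1) t'(1) d(6,7) d'(6,7) by auto
  then have "x \<in> K s" "x \<in> K s'" using t(2) t'(2) d(1) d'(1) unfolding K_def by blast+
  show "x \<in> X"
  proof (cases "s = s'")
    case False
    then show ?thesis using \<open>x \<in> K s\<close> \<open>x \<in> K s'\<close> unfolding X_def by (cases s; cases s') auto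
  next
    case True
    then have eq: "c = c'" "t = t'" using inner_unique[OF d(1), of c' t t'] d d' t t' by auto
    show ?thesis
    proof (rule ccontr)
      assume "x \<notin> X"
      then have "t \<notin> hits c" using t unfolding hits_def by auto
      then have "a < t" "t < b" "a' < t" "t < b'"
        using d(2,3) d'(2,3) t t' eq by (auto simp: order.order_iff_strict)
      then have "a = a'" "b = b'"
        using d(5)[of a'] d(5)[of b'] d'(5)[of a] d'(5)[of b] d d' eq
          by (auto simp: not_less le_less_linear) (linarith+)
      then show False using \<open>l \<noteq> m\<close> l' m' eq True by simp
    qed
  qed
qed

lemma star_two:
  assumes c: "c \<in> \<C> s" and t: "t \<in> hits c" and ne: "\<not> extremal_on X c t"
  shows "card {l \<in> links. c t \<in> limg l \<and> fst l = s} = 2"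
proof -
  have fin: "finite (hits c)" using finite_hits[OF c] .
  have A: "hits c \<inter> {..<t} \<noteq> {}" "hits c \<inter> {t<..} \<noteq> {}"
  proof -
    obtain u where "u \<in> {0..<t}" "c u \<in> X" using ne unfolding extremal_on_def by blast
    then have "u \<in> hits c \<inter> {..<t}" using t unfolding hits_def by auto
    then show "hits c \<inter> {..<t} \<noteq> {}" by blast
    obtain u where "u \<in> {t<..1}" "c u \<in> X" using ne unfolding extremal_on_def by blast
    then have "u \<in> hits c \<inter> {t<..}" using t unfolding hits_def by auto
    then show "hits c \<inter> {t<..} \<noteq> {}" by blast
  qed
  define a where "a = Max (hits c \<inter> {..<t})"
  define b where "b = Min (hits c \<inter> {t<..})"
  have a: "a \<in> hits c" "a < t" "\<And>u. u \<in> hits c \<Longrightarrow> u < t \<Longrightarrow> u \<le> a"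
    using Max_in[OF _ A(1)] Max_ge[of "hits c \<inter> {..<t}"] fin unfolding a_def by auto
  have b: "b \<in> hits c" "t < b" "\<And>u. u \<in> hits c \<Longrightarrow> t < u \<Longrightarrow> b \<le> u"
    using Min_in[OF _ A(2)] Min_le[of "hits c \<inter> {t<..}"] fin unfolding b_def by auto
  have l: "(s,c,a,t) \<in> links" "(s,c,t,b) \<in> links" unfolding links_def using a b c t by force+
  have "{l \<in> links. c t \<in> limg l \<and> fst l = s} = {(s,c,a,t), (s,c,t,b)}"
  proof
    show "{(s,c,a,t), (s,c,t,b)} \<subseteq> {l \<in> links. c t \<in> limg l \<and> fst l = s}"
      using l a b unfolding limg_def by auto
    show "{l \<in> links. c t \<in> limg l \<and> fst l = s} \<subseteq> {(s,c,a,t), (s,c,t,b)}"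
    proof
      fix m assume m: "m \<in> {l \<in> links. c t \<in> limg l \<and> fst l = s}"
      obtain s' c' a' b' where m': "m = (s',c',a',b')" by (metis prod_cases4)
      then have "s' = s" and ml: "(s,c',a',b') \<in> links" "c t \<in> c' ` {a'..b'}"
        using m unfolding limg_def by auto
      moreover have "c' = c \<and> (t = a' \<or> t = b')" using link_at[OF c t ml] .
      ultimately show "m \<in> {(s,c,a,t), (s,c,t,b)}"
        using link_succ_unique[of s c t b b'] link_pred_unique[of s c a t a'] l m' by auto
    qed
  qed
  then show ?thesis using a(2) by simp
qed

text \<open>The other curves of the family and the rest of \<open>c\<close> form a closed set not containing \<open>x\<close>. Near \<open>x\<close> the
whole family is therefore just the union of the two links.\<close>

lemma links_two_sided:
  assumes x: "x \<in> X" and st: "{l \<in> links. x \<in> limg l \<and> fst l = s} = {\<beta>, \<beta>'}" "\<beta> \<noteq> \<beta>'" and W: "open W" "x \<in> W"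
  shows "\<exists>N H1 H2. open N \<and> x \<in> N \<and> N \<subseteq> W \<and> connected H1 \<and> connected H2 \<and>
            N - (limg \<beta> \<union> limg \<beta>') = H1 \<union> H2"
proof -
  obtain c t where c: "c \<in> \<C> s" "t \<in> hits c" "c t = x" using X_curve[OF x] by blast
  have form: "\<exists>a b. l = (s,c,a,b) \<and> l \<in> links \<and> (t = a \<or> t = b)" if l: "l \<in> {\<beta>,\<beta>'}" for l
  proof -
    obtain s' c' a b where l': "l = (s',c',a,b)" by (metis prod_cases4)
    have "l \<in> links" "x \<in> limg l" "fst l = s" using l st(1) by blast+
    then show ?thesis using link_at[OF c(1,2), of c' a b] c(3) unfolding l' limg_def by auto
  qed
  have "\<exists>a b. {\<beta>,\<beta>'} = {(s,c,a,t),(s,c,t,b)} \<and> (s,c,a,t) \<in> links \<and> (s,c,t,b) \<in> links"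
  proof -
    obtain a b where ab: "\<beta> = (s,c,a,b)" "\<beta> \<in> links" "t = a \<or> t = b" using form by blast
    obtain a' b' where ab': "\<beta>' = (s,c,a',b')" "\<beta>' \<in> links" "t = a' \<or> t = b'" using form by blast
    have "t = a \<and> t = b' \<or> t = b \<and> t = a'"
      using ab ab' st(2) link_succ_unique[of s c t b b'] link_pred_unique[of s c a t a'] by auto
    then show ?thesis
    proof
      assume "t = a \<and> t = b'"
      then have "\<beta> = (s,c,t,b)" "\<beta>' = (s,c,a',t)" using ab ab' by simp_all
      then show ?thesis using ab(2) ab'(2) by blast
    next
      assume "t = b \<and> t = a'"
      then have "\<beta> = (s,c,a,t)" "\<beta>' = (s,c,t,b')" using ab ab' by simp_all
      then show ?thesis using ab(2) ab'(2) by blast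
    qed
  qed
  then obtain a b where ab: "{\<beta>,\<beta>'} = {(s,c,a,t),(s,c,t,b)}" "(s,c,a,t) \<in> links" "(s,c,t,b) \<in> links"
    by blast
  note da = linksD[OF ab(2)] and db = linksD[OF ab(3)]
  have "limg \<beta> \<union> limg \<beta>' = limg (s,c,a,t) \<union> limg (s,c,t,b)"
  proof -
    have "limg \<beta> \<union> limg \<beta>' = \<Union>(limg ` {\<beta>,\<beta>'})" by simp
    then show ?thesis unfolding ab(1) by simp
  qed
  also have "\<dots> = c ` {a..b}"
  proof -
    have "{a..b} = {a..t} \<union> {t..b}" using da db by auto
    then show ?thesis unfolding limg_def by auto
  qed
  finally have im: "limg \<beta> \<union> limg \<beta>' = c ` {a..b}" .
  define D where "D = c ` {0..a} \<union> c ` {b..1} \<union> (\<Union>d\<in>\<C> s - {c}. d ` {0..1})"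
  have cl: "closed (d ` {u..v})" if "d \<in> \<C> s" "0 \<le> u" "v \<le> 1" for d u v
  proof -
    have "continuous_on {0..1} d" using curve_path[OF that(1)] unfolding path_def .
    then have "continuous_on {u..v} d" by (rule continuous_on_subset) (use that in auto)
    then show ?thesis using compact_continuous_image compact_imp_closed compact_Icc by blast
  qed
  have "closed D" unfolding D_def using cl[OF c(1)] cl da db finite_curves
    by (intro closed_Un closed_UN) auto
  moreover have "x \<notin> D"
  proof
    assume "x \<in> D"
    then have "(\<exists>u. u \<in> {0..1} \<and> c t = c u \<and> (u \<le> a \<or> b \<le> u)) \<or>
      (\<exists>d u. d \<in> \<C> s \<and> d \<noteq> c \<and> u \<in> {0..1} \<and> c t = d u)"
    proof -
      consider "x \<in> c ` {0..a}" | "x \<in> c ` {b..1}" | "x \<in> (\<Union>d\<in>\<C> s - {c}. d ` {0..1})"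
        using \<open>x \<in> D\<close> unfolding D_def by blast
      then show ?thesis
      proof cases
        case 1
        then obtain u where "u \<in> {0..a}" "x = c u" by blast
        then have "u \<in> {0..1} \<and> c t = c u \<and> (u \<le> a \<or> b \<le> u)" using c(3) da(4) db(4,7) by auto
        then show ?thesis by blast
      next
        case 2
        then obtain u where "u \<in> {b..1}" "x = c u" by blast
        then have "u \<in> {0..1} \<and> c t = c u \<and> (u \<le> a \<or> b \<le> u)" using c(3) da(4,6) db(4) by auto
        then show ?thesis by blast
      next
        case 3
        then show ?thesis using c(3) by blast
      qed
    qed
    then show False
    proof
      assume "\<exists>u. u \<in> {0..1} \<and> c t = c u \<and> (u \<le> a \<or> b \<le> u)"
      then obtain u where "u \<in> {0..1}" "c t = c u" "u \<le> a \<or> b \<le> u" by blast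
      then show False using hits_unique[OF c(1) c(1) c(2)] da(4) db(4) by fastforce
    next
      assume "\<exists>d u. d \<in> \<C> s \<and> d \<noteq> c \<and> u \<in> {0..1} \<and> c t = d u"
      then show False using hits_unique[OF c(1) _ c(2)] by blast
    qed
  qed
  ultimately have W': "open (W - D)" "x \<in> W - D" using W by auto
  obtain N H1 H2 where N: "open N" "x \<in> N" "N \<subseteq> W - D" "connected H1" "connected H2" "N - K s = H1 \<union> H2"
    using locally_two_sided[OF x W', of s] by blast
  have "c ` {0..1} \<subseteq> c ` {0..a} \<union> c ` {a..b} \<union> c ` {b..1}"
    unfolding image_Un[symmetric] by (rule image_mono) auto
  then have cD: "c ` {0..1} \<subseteq> D \<union> c ` {a..b}" unfolding D_def by auto
  have "d ` {0..1} \<subseteq> D \<union> c ` {a..b}" if "d \<in> \<C> s" for d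
    using cD that unfolding D_def by (cases "d = c") auto
  then have "K s \<subseteq> D \<union> c ` {a..b}" unfolding K_def by (rule UN_least)
  moreover have "{a..b} \<subseteq> {0..1}" using da(6) db(7) by auto
  then have "c ` {a..b} \<subseteq> K s" unfolding K_def using c(1) by blast
  ultimately have "N - c ` {a..b} = N - K s" using N(3) by auto
  then have "N - (limg \<beta> \<union> limg \<beta>') = H1 \<union> H2" using N(6) im by simp
  moreover have "N \<subseteq> W" using N(3) by auto
  ultimately show ?thesis using N(1,2,4,5) by blast
qed

text \<open>Each curve used by \<open>C\<close> contains at least two corners: the first and the last point of \<open>C\<close> on it, where \<open>C\<close>
can only continue along the other family. Take two corners on one curve. The transversal curves through
them differ, as two curves meet at most once, and each has a further corner.\<close>

lemma links_four_corners:
  assumes C: "C \<subseteq> links" "C \<noteq> {}"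
    and deg: "\<And>x l. x \<in> X \<Longrightarrow> l \<in> C \<Longrightarrow> x \<in> limg l \<Longrightarrow> \<exists>m\<in>C. m \<noteq> l \<and> x \<in> limg m"
  shows "4 \<le> card {x \<in> X. \<exists>a\<in>C. \<exists>b\<in>C. x \<in> limg a \<and> x \<in> limg b \<and> fst a \<noteq> fst b}" (is "4 \<le> card ?Cor")
proof -
  have finC: "finite C" using C(1) finite_links finite_subset by blast
  have two: "\<exists>t1 t2. t1 \<in> hits c \<and> t2 \<in> hits c \<and> t1 \<noteq> t2 \<and> c t1 \<in> ?Cor \<and> c t2 \<in> ?Cor"
    if l: "(s,c,a,b) \<in> C" for s c a b
  proof -
    have c: "c \<in> \<C> s" using l C linksD by blast
    have other: "c t \<in> ?Cor" if m: "(s,c,a',b') \<in> C" "t = a' \<or> t = b'"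
      and only: "\<And>a'' b''. (s,c,a'',b'') \<in> C \<Longrightarrow> t = a'' \<or> t = b'' \<Longrightarrow> (s,c,a'',b'') = (s,c,a',b')" for a' b' t
    proof -
      note d = linksD[OF subsetD[OF C(1) m(1)]]
      have t: "t \<in> hits c" using m d by auto
      then have tX: "c t \<in> X" unfolding hits_def by auto
      have "c t \<in> limg (s,c,a',b')" using m d unfolding limg_def by auto
      then obtain m' where m': "m' \<in> C" "m' \<noteq> (s,c,a',b')" "c t \<in> limg m'"
        using deg[OF tX m(1)] by blast
      obtain s'' c'' a'' b'' where m'': "m' = (s'',c'',a'',b'')" by (metis prod_cases4)
      have "s'' \<noteq> s"
      proof
        assume "s'' = s"
        then have "c'' = c \<and> (t = a'' \<or> t = b'')"
          using link_at[OF c t, of c'' a'' b''] m' C(1) unfolding m'' limg_def by auto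
        then show False using only[of a'' b''] m' \<open>s'' = s\<close> unfolding m'' by auto
      qed
      then show ?thesis using tX m(1) m'(1,3) \<open>c t \<in> limg (s,c,a',b')\<close> unfolding m'' by force
    qed
    define A where "A = {a'. \<exists>b'. (s,c,a',b') \<in> C}"
    define B where "B = {b'. \<exists>a'. (s,c,a',b') \<in> C}"
    have "A \<subseteq> (\<lambda>(s,c,a,b). a) ` C" "B \<subseteq> (\<lambda>(s,c,a,b). b) ` C" unfolding A_def B_def by force+
    then have fin: "finite A" "finite B" using finC finite_subset by blast+
    have ne: "A \<noteq> {}" "B \<noteq> {}" using l unfolding A_def B_def by blast+
    obtain b0 where b0: "(s,c,Min A,b0) \<in> C" using Min_in[OF fin(1) ne(1)] unfolding A_def by blast
    obtain a1 where a1: "(s,c,a1,Max B) \<in> C" using Max_in[OF fin(2) ne(2)] unfolding B_def by blast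
    have mn: "Min A \<le> a'" and mx: "b' \<le> Max B" if "(s,c,a',b') \<in> C" for a' b'
      using that fin Min_le[of A a'] Max_ge[of B b'] unfolding A_def B_def by blast+
    have lt: "a' < b'" if "(s,c,a',b') \<in> C" for a' b' using that C(1) linksD(4) by blast
    have "c (Min A) \<in> ?Cor"
    proof (rule other[OF b0])
      fix a'' b'' assume m: "(s,c,a'',b'') \<in> C" "Min A = a'' \<or> Min A = b''"
      then have "Min A = a''" using mn[OF m(1)] lt[OF m(1)] by auto
      then show "(s,c,a'',b'') = (s,c,Min A,b0)" using link_succ_unique b0 m C(1) by blast
    qed simp
    moreover have "c (Max B) \<in> ?Cor"
    proof (rule other[OF a1])
      fix a'' b'' assume m: "(s,c,a'',b'') \<in> C" "Max B = a'' \<or> Max B = b''"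
      then have "Max B = b''" using mx[OF m(1)] lt[OF m(1)] by auto
      then show "(s,c,a'',b'') = (s,c,a1,Max B)" using link_pred_unique a1 m C(1) by blast
    qed simp
    moreover have "Min A \<in> hits c" "Max B \<in> hits c"
      using linksD(2)[OF subsetD[OF C(1) b0]] linksD(3)[OF subsetD[OF C(1) a1]] .
    moreover have "Min A \<noteq> Max B" using lt[OF b0] mx[OF b0] by auto
    ultimately show ?thesis by blast
  qed
  have second: "\<exists>t'\<in>hits c. t' \<noteq> t \<and> c t' \<in> ?Cor" if m: "(s,c,a,b) \<in> C" for s c a b t
  proof -
    obtain t1 t2 where t12: "t1 \<in> hits c" "t2 \<in> hits c" "t1 \<noteq> t2" "c t1 \<in> ?Cor" "c t2 \<in> ?Cor"
      using two[OF m] by (elim exE conjE) (rule that)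
    show ?thesis
    proof (cases "t1 = t")
      case True
      then show ?thesis using t12(2,3,5) by (intro bexI[of _ t2]) simp_all
    next
      case False
      then show ?thesis using t12(1,4) by (intro bexI[of _ t1]) simp_all
    qed
  qed
  have cross: "\<exists>d u a b. (\<not> s,d,a,b) \<in> C \<and> d \<in> \<C> (\<not> s) \<and> u \<in> hits d \<and> d u = x" if x: "x \<in> ?Cor" for x s
  proof -
    obtain l where l: "l \<in> C" "x \<in> limg l" "fst l = (\<not> s)" using x by (cases s) auto
    obtain s' d a b where l': "l = (s',d,a,b)" by (metis prod_cases4)
    have s': "s' = (\<not> s)" using l l' by simp
    note dd = linksD[OF subsetD[OF C(1) l(1)[unfolded l']]]
    obtain u where u: "u \<in> {a..b}" "d u = x" using l(2) unfolding l' limg_def by auto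
    then have "u \<in> hits d" using x dd unfolding hits_def by auto
    then show ?thesis using l(1) dd(1) u(2) unfolding l' s' by blast
  qed
  obtain s c a b where l: "(s,c,a,b) \<in> C" using C(2) by (metis ex_in_conv prod_cases4)
  have c: "c \<in> \<C> s" using l C linksD by blast
  obtain t1 t2 where t: "t1 \<in> hits c" "t2 \<in> hits c" "t1 \<noteq> t2" "c t1 \<in> ?Cor" "c t2 \<in> ?Cor"
    using two[OF l] by blast
  have tI: "t1 \<in> {0..1}" "t2 \<in> {0..1}" using t unfolding hits_def by auto
  have x12: "c t1 \<noteq> c t2" using hits_unique[OF c c t(1) tI(2)] t(3) by auto
  obtain d1 u1 a1 b1 where d1: "(\<not> s,d1,a1,b1) \<in> C" "d1 \<in> \<C> (\<not> s)" "u1 \<in> hits d1" "d1 u1 = c t1"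
    using cross[OF t(4)] by blast
  obtain d2 u2 a2 b2 where d2: "(\<not> s,d2,a2,b2) \<in> C" "d2 \<in> \<C> (\<not> s)" "u2 \<in> hits d2" "d2 u2 = c t2"
    using cross[OF t(5)] by blast
  have "d1 \<noteq> d2"
  proof
    assume "d1 = d2"
    moreover have "u1 \<in> {0..1}" "u2 \<in> {0..1}" using d1 d2 unfolding hits_def by auto
    ultimately have "c t1 \<in> c ` {0..1} \<inter> d1 ` {0..1}" "c t2 \<in> c ` {0..1} \<inter> d1 ` {0..1}"
      using d1(4) d2(4) tI by (metis IntI imageI)+
    then show False using meet_once[OF c d1(2)] x12 by blast
  qed
  then have dd: "d1 v \<noteq> d2 w" if "v \<in> hits d1" "w \<in> hits d2" for v w
    using hits_unique[OF d1(2) d2(2) that(1), of w] that unfolding hits_def by auto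
  obtain v1 where v1: "v1 \<in> hits d1" "v1 \<noteq> u1" "d1 v1 \<in> ?Cor" using second[OF d1(1)] by blast
  obtain v2 where v2: "v2 \<in> hits d2" "v2 \<noteq> u2" "d2 v2 \<in> ?Cor" using second[OF d2(1)] by blast
  have e1: "d1 v1 \<noteq> d1 u1"
    using hits_unique[OF d1(2) d1(2) v1(1), of u1] d1(3) v1(2) unfolding hits_def by auto
  have e2: "d2 v2 \<noteq> d2 u2"
    using hits_unique[OF d2(2) d2(2) v2(1), of u2] d2(3) v2(2) unfolding hits_def by auto
  have dist: "card {c t1, c t2, d1 v1, d2 v2} = 4"
    using x12 e1 e2 dd[OF v1(1) v2(1)] dd[OF v1(1) d2(3)] dd[OF d1(3) v2(1)] d1(4) d2(4) by auto
  have "{c t1, c t2, d1 v1, d2 v2} \<subseteq> ?Cor" using t v1 v2 by blast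
  then have "card {c t1, c t2, d1 v1, d2 v2} \<le> card ?Cor" using finite_X by (intro card_mono) auto
  then show ?thesis using dist by simp
qed

theorem extremal_crossing:
  assumes "X \<noteq> {}"
  shows "\<exists>c\<in>\<C> True. \<exists>d\<in>\<C> False. \<exists>t\<in>{0..1}. \<exists>u\<in>{0..1}. c t = d u \<and> extremal_on X c t \<and> extremal_on X d u"
proof (rule ccontr)
  assume no: "\<not> ?thesis"
  have passes: "\<exists>s. card {l \<in> links. x \<in> limg l \<and> fst l = s} = 2" if x: "x \<in> X" for x
  proof -
    obtain c t where c: "c \<in> \<C> True" "t \<in> hits c" "c t = x" using X_curve[OF x] by blast
    obtain d u where d: "d \<in> \<C> False" "u \<in> hits d" "d u = x" using X_curve[OF x] by blast
    have "\<not> extremal_on X c t \<or> \<not> extremal_on X d u" using no c d unfolding hits_def by auto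
    then show ?thesis using star_two[OF c(1,2)] star_two[OF d(1,2)] unfolding c(3) d(3) by blast
  qed
  interpret link_system links limg X fst
  proof
    show "finite links" by (rule finite_links)
    show "finite X" by (rule finite_X)
    show "\<exists>p q. arc_between (limg l) p q \<and> limg l \<inter> X = {p, q}" if "l \<in> links" for l
    proof -
      obtain s c a b where "l = (s,c,a,b)" by (metis prod_cases4)
      then show ?thesis using link_arc[of s c a b] that unfolding limg_def by auto
    qed
  qed (fact links_disjoint passes links_two_sided links_four_corners)+
  obtain x where "x \<in> X" using assms by blast
  then obtain s where "card {l \<in> links. x \<in> limg l \<and> fst l = s} = 2" using passes by blast
  then show False using no_links by simp
qed

end

section \<open>Planar covers of the sphere and of the projective plane\<close>

text \<open>For a unit vector \<open>y\<close> this is the orthogonal projection onto the line spanned by \<open>y\<close>. It identifies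
exactly antipodal points and so realises the projective plane in a Euclidean space, where path lifting
for covering spaces applies.\<close>

definition projector :: "real^3 \<Rightarrow> real^3^3" where
  "projector y = (\<chi> i j. y$i * y$j)"

lemma projector_mult: "projector y *v v = (y \<bullet> v) *\<^sub>R y"
  by (simp add: projector_def vec_eq_iff matrix_vector_mult_def inner_vec_def sum_distrib_right sum_distrib_left mult_ac)

lemma projector_uminus: "projector (- y) = projector y"
  by (simp add: projector_def)

lemma continuous_on_projector: "continuous_on A projector"
  unfolding projector_def by (intro continuous_intros)

lemma projector_eq:
  assumes "x \<in> sphere 0 1" "y \<in> sphere 0 1" "projector x = projector y"
  shows "x = y \<or> x = - y"
proof -
  have n: "norm x = 1" "norm y = 1" using assms by auto
  have x: "x = (y \<bullet> x) *\<^sub>R y"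
    using projector_mult[of x x] projector_mult[of y x] assms(3) n by (simp add: dot_square_norm)
  then have "\<bar>y \<bullet> x\<bar> = 1" using n by (metis mult.right_neutral norm_scaleR)
  then have "y \<bullet> x = 1 \<or> y \<bullet> x = -1" by linarith
  then show ?thesis using x by auto
qed

text \<open>The lines not orthogonal to \<open>a\<close> are evenly covered by the two open hemispheres with poles \<open>a\<close> and \<open>-a\<close>;
projecting \<open>a\<close> onto the line and normalising recovers the point of the hemisphere.\<close>

lemma antipodal_covering: "covering_space (sphere 0 1) projector (projector ` sphere 0 1)"
proof -
  let ?p = projector
  note mult = projector_mult and neg = projector_uminus and cont = continuous_on_projector
  have cm: "continuous_on UNIV (\<lambda>m::real^3^3. m *v v)" for v
    by (intro linear_continuous_on bounded_linearI' )  (simp_all add: matrix_vector_mult_add_rdistrib scaleR_matrix_vector_assoc)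
  show "covering_space (sphere 0 1) ?p (?p ` sphere 0 1)"
    unfolding covering_space_def
  proof (intro conjI ballI)
    show "continuous_on (sphere 0 1) ?p" by (rule cont)
    fix x assume "x \<in> ?p ` sphere 0 1"
    then obtain a where a: "norm a = 1" "x = ?p a" by auto
    define T where "T = ?p ` sphere 0 1 \<inter> {m. m *v a \<noteq> 0}"
    define u where "u \<sigma> = {y \<in> sphere 0 1. 0 < \<sigma> * (y \<bullet> a)}" for \<sigma> :: real
    have pT: "?p y \<in> T \<longleftrightarrow> y \<bullet> a \<noteq> 0" if "y \<in> sphere 0 1" for y
      using that unfolding T_def mem_Collect_eq Int_iff mult by auto
    have hom: "homeomorphism (u \<sigma>) T ?p (\<lambda>m. (\<sigma> / norm (m *v a)) *\<^sub>R (m *v a))" if s: "\<sigma> = 1 \<or> \<sigma> = -1" for \<sigma>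
    proof -
      have inv: "(\<sigma> / norm (?p y *v a)) *\<^sub>R (?p y *v a) = y" if y: "y \<in> u \<sigma>" for y
      proof -
        have n: "norm y = 1" "0 < \<sigma> * (y \<bullet> a)" using y unfolding u_def by auto
        then have "\<bar>y \<bullet> a\<bar> = \<sigma> * (y \<bullet> a)" using s by auto
        then show ?thesis using n s unfolding mult by auto
      qed
      have im: "?p ` u \<sigma> = T"
      proof
        show "?p ` u \<sigma> \<subseteq> T" using pT s unfolding u_def by auto
        show "T \<subseteq> ?p ` u \<sigma>"
        proof
          fix m assume m: "m \<in> T"
          then obtain y where y: "y \<in> sphere 0 1" "m = ?p y" unfolding T_def by blast
          then have "y \<bullet> a \<noteq> 0" using pT m by blast
          then have "y \<in> u \<sigma> \<or> - y \<in> u \<sigma>" using y s unfolding u_def by auto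
          then show "m \<in> ?p ` u \<sigma>" using y neg by (metis imageI)
        qed
      qed
      show ?thesis
      proof (rule homeomorphismI)
        show "continuous_on (u \<sigma>) ?p" by (rule cont)
        show "continuous_on T (\<lambda>m. (\<sigma> / norm (m *v a)) *\<^sub>R (m *v a))"
          using continuous_on_subset[OF cm, of T a] by (intro continuous_intros) (auto simp: T_def)
        show "?p ` u \<sigma> \<subseteq> T" using im by simp
        show "(\<lambda>m. (\<sigma> / norm (m *v a)) *\<^sub>R (m *v a)) ` T \<subseteq> u \<sigma>" using im inv by auto
        show "(\<sigma> / norm (?p y *v a)) *\<^sub>R (?p y *v a) = y" if "y \<in> u \<sigma>" for y using inv that .
        show "?p ((\<sigma> / norm (m *v a)) *\<^sub>R (m *v a)) = m" if "m \<in> T" for m using im inv that by auto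
      qed
    qed
    have op: "openin (top_of_set (sphere 0 1)) (u \<sigma>)" for \<sigma>
    proof -
      have "open {y::real^3. 0 < \<sigma> * (y \<bullet> a)}" by (intro open_Collect_less continuous_intros)
      moreover have "u \<sigma> = sphere 0 1 \<inter> {y. 0 < \<sigma> * (y \<bullet> a)}" unfolding u_def by blast
      ultimately show ?thesis by (metis openin_open_Int)
    qed
    show "\<exists>T. x \<in> T \<and> openin (top_of_set (?p ` sphere 0 1)) T \<and>
      (\<exists>v. \<Union>v = sphere 0 1 \<inter> ?p -` T \<and> (\<forall>u\<in>v. openin (top_of_set (sphere 0 1)) u) \<and> pairwise disjnt v \<and>
        (\<forall>u\<in>v. \<exists>q. homeomorphism u T ?p q))"
    proof (intro exI conjI)
      show "x \<in> T" using pT[of a] a by (auto simp: dot_square_norm)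
      have "open {m::real^3^3. m *v a \<noteq> 0}" using cm by (intro open_Collect_neq continuous_intros)
      then show "openin (top_of_set (?p ` sphere 0 1)) T" unfolding T_def by blast
      show "\<Union>{u 1, u (-1)} = sphere 0 1 \<inter> ?p -` T" using pT unfolding u_def by (auto simp: neq_iff)
      show "\<forall>u\<in>{u 1, u (-1)}. openin (top_of_set (sphere 0 1)) u" using op by blast
      show "pairwise disjnt {u 1, u (-1)}" unfolding u_def
        by (auto simp: pairwise_insert disjnt_def)
      show "\<forall>u\<in>{u 1, u (-1)}. \<exists>q. homeomorphism u T ?p q" using hom by blast
    qed
  qed simp
qed

text \<open>All lifts of \<open>e\<close>, each represented by a single function: functions differing only outside the unit interval
would count as different members.\<close>

definition lifts :: "('b::real_normed_vector) set \<Rightarrow> ('b \<Rightarrow> 'a) \<Rightarrow> (real \<Rightarrow> 'a) \<Rightarrow> (real \<Rightarrow> 'b) set \<Rightarrow> bool" where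
  "lifts M \<psi> e L \<longleftrightarrow> finite L \<and> (\<forall>c\<in>L. path c \<and> path_image c \<subseteq> M \<and> (\<forall>t\<in>{0..1}. \<psi> (c t) = e t)) \<and>
     (\<forall>c\<in>L. \<forall>d\<in>L. \<forall>t\<in>{0..1}. c t = d t \<longrightarrow> c = d) \<and>
     (\<forall>w\<in>M. \<forall>t\<in>{0..1}. \<psi> w = e t \<longrightarrow> (\<exists>c\<in>L. c t = w))"

text \<open>These are the properties of a covering over \<open>T\<close> that transport normal pairs. A covering in the strict
sense is lost when a point of the sphere is removed but its antipode is not.\<close>

definition lifting_map :: "('b::real_normed_vector) set \<Rightarrow> 'a topology \<Rightarrow> 'a set \<Rightarrow> ('b \<Rightarrow> 'a) \<Rightarrow> bool" where
  "lifting_map M S T \<psi> \<longleftrightarrow>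
     continuous_map (top_of_set M) S \<psi> \<and> open_map (top_of_set M) S \<psi> \<and>
     (\<forall>w\<in>M. \<exists>V. openin (top_of_set M) V \<and> w \<in> V \<and> inj_on \<psi> V) \<and> T \<subseteq> \<psi> ` M \<and>
     (\<forall>e. pathin S e \<and> e ` {0..1} \<subseteq> T \<longrightarrow> (\<exists>L. lifts M \<psi> e L))"

lemma pathin_path: "pathin (top_of_set M) c \<longleftrightarrow> path c \<and> path_image c \<subseteq> M"
  unfolding pathin_def path_def path_image_def by auto

lemma two_sphere_cover:
  assumes "is_two_sphere S"
  obtains \<pi> where "lifting_map (sphere (0::real^3) 1) S (topspace S) \<pi>"
proof -
  let ?M = "sphere (0::real^3) 1"
  obtain h \<pi> where hp: "homeomorphic_maps S (top_of_set ?M) h \<pi>"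
    using assms unfolding is_two_sphere_def homeomorphic_space_def by blast
  have hom: "homeomorphic_map (top_of_set ?M) S \<pi>" "continuous_map S (top_of_set ?M) h"
    using hp unfolding homeomorphic_maps_map by (auto intro: homeomorphic_imp_continuous_map)
  have inv: "\<And>x. x \<in> topspace S \<Longrightarrow> \<pi> (h x) = x" "\<And>y. y \<in> ?M \<Longrightarrow> h (\<pi> y) = y"
    using hp unfolding homeomorphic_maps_def by auto
  have "lifting_map ?M S (topspace S) \<pi>"
    unfolding lifting_map_def
  proof (intro conjI ballI allI impI)
    show "continuous_map (top_of_set ?M) S \<pi>" "open_map (top_of_set ?M) S \<pi>"
      using hom homeomorphic_imp_continuous_map homeomorphic_imp_open_map by auto
    show "\<exists>V. openin (top_of_set ?M) V \<and> w \<in> V \<and> inj_on \<pi> V" if "w \<in> ?M" for w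
      using that homeomorphic_imp_injective_map[OF hom(1)] by (intro exI[of _ ?M]) auto
    show "topspace S \<subseteq> \<pi> ` ?M" using homeomorphic_imp_surjective_map[OF hom(1)] by simp
    fix e assume e: "pathin S e \<and> e ` {0..1} \<subseteq> topspace S"
    have "pathin (top_of_set ?M) (h \<circ> e)"
      using e hom(2) unfolding pathin_def by (metis continuous_map_compose)
    then have p: "path (h \<circ> e)" "path_image (h \<circ> e) \<subseteq> ?M" unfolding pathin_path by auto
    have "h y \<in> ?M" if "y \<in> topspace S" for y
      using hom(2) that by (metis continuous_map_image_subset_topspace image_subset_iff topspace_euclidean_subtopology)
    then have "lifts ?M \<pi> e {h \<circ> e}" 
      unfolding lifts_def
    proof (intro conjI ballI impI)
      show "\<exists>c\<in>{h \<circ> e}. c t = w" if "w \<in> ?M" "\<pi> w = e t" for w t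
        using inv(2)[OF that(1)] that(2) by simp
    qed (use p inv(1) e in \<open>auto simp: image_subset_iff\<close>)
    then show "\<exists>L. lifts ?M \<pi> e L" by blast
  qed
  then show thesis using that by blast
qed

text \<open>The projection of the given quotient is compared with \<open>projector\<close> by a continuous map \<open>k\<close>; a path is lifted
by lifting its image under \<open>k\<close>. The second lift is the antipode of the first.\<close>

lemma projective_plane_cover:
  assumes "is_projective_plane S"
  obtains \<pi> where "lifting_map (sphere (0::real^3) 1) S (topspace S) \<pi>"
proof -
  let ?M = "sphere (0::real^3) 1"
  obtain q where q: "quotient_map (top_of_set ?M) S q"
    and fib: "\<And>x y. x \<in> ?M \<Longrightarrow> y \<in> ?M \<Longrightarrow> q x = q y \<longleftrightarrow> x = y \<or> x = - y"
    using assms unfolding is_projective_plane_def by blast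
  have im: "q ` ?M = topspace S" using quotient_imp_surjective_map[OF q] by simp
  have pc: "continuous_map (top_of_set ?M) (top_of_set (projector ` ?M)) projector"
    using continuous_on_projector by (auto simp: continuous_map_in_subtopology)
  have pq: "projector x = projector y"
    if "x \<in> topspace (top_of_set ?M)" "y \<in> topspace (top_of_set ?M)" "q x = q y" for x y
    using fib[of x y] that projector_uminus[of y] by auto
  obtain k where k: "continuous_map S (top_of_set (projector ` ?M)) k"
    and kq: "\<And>x. x \<in> topspace (top_of_set ?M) \<Longrightarrow> k (q x) = projector x"
    by (rule quotient_map_lift_exists[OF q pc]) (rule pq, assumption+, rule that)
  have "lifting_map ?M S (topspace S) q"
    unfolding lifting_map_def
  proof (intro conjI ballI allI impI)
    show "continuous_map (top_of_set ?M) S q" using q by (rule quotient_imp_continuous_map)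
    show "open_map (top_of_set ?M) S q"
      unfolding open_map_def
    proof (intro allI impI)
      fix U assume U: "openin (top_of_set ?M) U"
      then have UM: "U \<subseteq> ?M" by (auto dest: openin_imp_subset)
      obtain O' where O': "open O'" "U = ?M \<inter> O'" using U unfolding openin_open by blast
      have "{x \<in> ?M. q x \<in> q ` U} = ?M \<inter> (O' \<union> uminus ` O')"
      proof
        show "{x \<in> ?M. q x \<in> q ` U} \<subseteq> ?M \<inter> (O' \<union> uminus ` O')"
        proof
          fix x assume x: "x \<in> {x \<in> ?M. q x \<in> q ` U}"
          then obtain y where y: "y \<in> U" "q x = q y" by blast
          then have "x = y \<or> x = - y" using fib x UM by blast
          then show "x \<in> ?M \<inter> (O' \<union> uminus ` O')" using x y O' by blast
        qed
        show "?M \<inter> (O' \<union> uminus ` O') \<subseteq> {x \<in> ?M. q x \<in> q ` U}"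
        proof
          fix x assume x: "x \<in> ?M \<inter> (O' \<union> uminus ` O')"
          then have "x \<in> U \<or> - x \<in> U" using O' by auto
          moreover have "q x = q (- x)" using fib[of x "- x"] x by auto
          ultimately have "q x \<in> q ` U" by (metis imageI)
          then show "x \<in> {x \<in> ?M. q x \<in> q ` U}" using x by blast
        qed
      qed
      moreover have "openin (top_of_set ?M) (?M \<inter> (O' \<union> uminus ` O'))"
        using O'(1) open_negations[OF O'(1)] by (intro openin_open_Int open_Un) auto
      ultimately have "openin (top_of_set ?M) {x \<in> topspace (top_of_set ?M). q x \<in> q ` U}" by simp
      moreover have "q ` U \<subseteq> topspace S" using im UM by blast
      ultimately show "openin S (q ` U)" using q unfolding quotient_map_def by blast
    qed
    show "\<exists>V. openin (top_of_set ?M) V \<and> w \<in> V \<and> inj_on q V" if w: "w \<in> ?M" for w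
    proof (intro exI conjI)
      have "open {y. 0 < y \<bullet> w}" by (intro open_Collect_less continuous_intros)
      then show "openin (top_of_set ?M) (?M \<inter> {y. 0 < y \<bullet> w})" by (rule openin_open_Int)
      show "w \<in> ?M \<inter> {y. 0 < y \<bullet> w}" using w by (auto simp: dot_square_norm)
      show "inj_on q (?M \<inter> {y. 0 < y \<bullet> w})"
      proof (rule inj_onI)
        fix x y assume xy: "x \<in> ?M \<inter> {y. 0 < y \<bullet> w}" "y \<in> ?M \<inter> {y. 0 < y \<bullet> w}" "q x = q y"
        then have "x = y \<or> x = - y" using fib by blast
        then show "x = y" using xy by auto
      qed
    qed
    show "topspace S \<subseteq> q ` ?M" using im by simp
    fix e assume e: "pathin S e \<and> e ` {0..1} \<subseteq> topspace S"
    have "pathin (top_of_set (projector ` ?M)) (k \<circ> e)"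
      using e k unfolding pathin_def by (metis continuous_map_compose)
    then have ke: "path (k \<circ> e)" "path_image (k \<circ> e) \<subseteq> projector ` ?M" unfolding pathin_path by auto
    obtain c where c: "path c" "path_image c \<subseteq> ?M" "\<And>t. t \<in> {0..1} \<Longrightarrow> projector (c t) = (k \<circ> e) t"
      using covering_space_lift_path[OF antipodal_covering ke] by blast
    have cM: "c t \<in> ?M" if "t \<in> {0..1}" for t using c(2) that unfolding path_image_def by blast
    have qc: "q (c t) = e t" if t: "t \<in> {0..1}" for t
    proof -
      obtain y where y: "y \<in> ?M" "e t = q y" using e t im by blast
      then have "projector (c t) = projector y" using c(3)[OF t] kq by simp
      then have "c t = y \<or> c t = - y" using projector_eq cM[OF t] y by blast
      then show ?thesis using fib[OF cM[OF t] y(1)] y(2) by simp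
    qed
    define c' where "c' = (\<lambda>t. - c t)"
    have neg: "q (- x) = q x" "- x \<in> ?M" if "x \<in> ?M" for x using fib[of "- x" x] that by auto
    have c': "path c'" "path_image c' \<subseteq> ?M"
      using c(1,2) unfolding c'_def path_def path_image_def by (auto intro: continuous_on_minus)
    have ne: "c t \<noteq> c' t" if "t \<in> {0..1}" for t
    proof
      assume "c t = c' t"
      then have "c t = 0" unfolding c'_def by (simp add: eq_neg_iff_add_eq_0 flip: scaleR_2)
      then show False using cM[OF that] by simp
    qed
    have "lifts ?M q e {c, c'}"
      unfolding lifts_def
    proof (intro conjI ballI impI)
      show "path d" "path_image d \<subseteq> ?M" if "d \<in> {c, c'}" for d using that c c' by auto
      show "q (d t) = e t" if "d \<in> {c, c'}" "t \<in> {0..1}" for d t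
        using that qc neg(1)[OF cM] unfolding c'_def by auto
      show "d = d'" if "d \<in> {c, c'}" "d' \<in> {c, c'}" "t \<in> {0..1}" "d t = d' t" for d d' t
        using that ne[OF that(3)] by auto
      show "\<exists>d\<in>{c, c'}. d t = w" if "w \<in> ?M" "t \<in> {0..1}" "q w = e t" for w t
      proof -
        have "q w = q (c t)" using qc that by simp
        then have "w = c t \<or> w = - c t" using fib that(1) cM[OF that(2)] by blast
        then show ?thesis unfolding c'_def by auto
      qed
    qed simp
    then show "\<exists>L. lifts ?M q e L" by blast
  qed
  then show thesis using that by blast
qed

lemma punctured_plane_cover:
  assumes \<pi>: "lifting_map (sphere (0::real^3) 1) S (topspace S) \<pi>" and z: "z \<in> topspace S"
  obtains \<psi> :: "complex \<Rightarrow> 'a" where "lifting_map UNIV S (topspace S - {z}) \<psi>"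
proof -
  let ?M = "sphere (0::real^3) 1"
  have cont: "continuous_map (top_of_set ?M) S \<pi>" and op: "open_map (top_of_set ?M) S \<pi>"
    and inj: "\<And>w. w \<in> ?M \<Longrightarrow> \<exists>V. openin (top_of_set ?M) V \<and> w \<in> V \<and> inj_on \<pi> V"
    and surj: "topspace S \<subseteq> \<pi> ` ?M"
    and lift: "\<And>e. pathin S e \<Longrightarrow> e ` {0..1} \<subseteq> topspace S \<Longrightarrow> \<exists>L. lifts ?M \<pi> e L"
    using \<pi> unfolding lifting_map_def by blast+
  obtain b where b: "b \<in> ?M" "\<pi> b = z" using surj z by blast
  have "(?M - {b}) homeomorphic (UNIV :: complex set)"
    by (rule homeomorphic_punctured_sphere_affine[OF _ b(1)]) (simp_all add: aff_dim_UNIV)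
  then obtain g h where gh: "homeomorphism (?M - {b}) (UNIV :: complex set) g h"
    unfolding homeomorphic_def by blast
  have h: "continuous_on UNIV h" "range h = ?M - {b}" "\<And>w. g (h w) = w" and g: "continuous_on (?M - {b}) g" "\<And>y. y \<in> ?M - {b} \<Longrightarrow> h (g y) = y"
    using gh unfolding homeomorphism_def by auto
  have hM: "h w \<in> ?M" "h w \<noteq> b" for w using h(2) by blast+
  have hc: "continuous_map euclidean (top_of_set ?M) h"
    using h(1) hM by (auto simp: continuous_map_in_subtopology)
  have "lifting_map (UNIV :: complex set) S (topspace S - {z}) (\<pi> \<circ> h)"
    unfolding lifting_map_def subtopology_UNIV
  proof (intro conjI ballI allI impI)
    show "continuous_map euclidean S (\<pi> \<circ> h)" using continuous_map_compose[OF hc cont] .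
    show "open_map euclidean S (\<pi> \<circ> h)"
      unfolding open_map_def
    proof (intro allI impI)
      fix U :: "complex set" assume "openin euclidean U"
      then have "openin (top_of_set (?M - {b})) (h ` U)"
        using homeomorphism_imp_open_map[OF homeomorphism_symD[OF gh], of U] by simp
      moreover have "openin (top_of_set ?M) (?M - {b})" by (simp add: openin_delete)
      ultimately have "openin (top_of_set ?M) (h ` U)" by (rule openin_trans)
      then show "openin S ((\<pi> \<circ> h) ` U)"
        using op unfolding open_map_def image_comp[symmetric] by blast
    qed
    show "\<exists>V. openin euclidean V \<and> w \<in> V \<and> inj_on (\<pi> \<circ> h) V" for w
    proof -
      obtain V where V: "openin (top_of_set ?M) V" "h w \<in> V" "inj_on \<pi> V"
        using inj[OF hM(1)] by blast
      have "openin euclidean (h -` V)"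
        using openin_continuous_map_preimage[OF hc V(1)] by (simp add: vimage_def)
      moreover have "inj_on (\<pi> \<circ> h) (h -` V)"
        using V(3) h(3) by (metis comp_inj_on_iff image_vimage_subset inj_on_inverseI inj_on_subset)
      ultimately show ?thesis using V(2) by blast
    qed
    show "topspace S - {z} \<subseteq> (\<pi> \<circ> h) ` UNIV"
    proof
      fix x assume x: "x \<in> topspace S - {z}"
      then obtain y where y: "y \<in> ?M" "x = \<pi> y" using surj by blast
      then have "h (g y) = y" using g(2)[of y] b x by auto
      then show "x \<in> (\<pi> \<circ> h) ` UNIV" using y by (metis comp_apply rangeI)
    qed
    fix e assume e: "pathin S e \<and> e ` {0..1} \<subseteq> topspace S - {z}"
    then obtain L where L: "lifts ?M \<pi> e L" using lift[of e] by blast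
    have cM: "c t \<in> ?M - {b}" if "c \<in> L" "t \<in> {0..1}" for c t
    proof -
      have "path_image c \<subseteq> ?M" "\<pi> (c t) = e t" using L that unfolding lifts_def by blast+
      moreover have "c t \<in> path_image c" using that(2) unfolding path_image_def by blast
      moreover have "e t \<noteq> z" using e that(2) by blast
      ultimately show ?thesis using b(2) by auto
    qed
    have "lifts UNIV (\<pi> \<circ> h) e ((\<lambda>c. g \<circ> c) ` L)"
      unfolding lifts_def
    proof (intro conjI ballI impI)
      show "finite ((\<lambda>c. g \<circ> c) ` L)" using L unfolding lifts_def by blast
      fix d assume d: "d \<in> (\<lambda>c. g \<circ> c) ` L"
      then obtain c where c: "c \<in> L" "d = g \<circ> c" by blast
      have "path_image c \<subseteq> ?M - {b}" using cM[OF c(1)] unfolding path_image_def by blast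
      then have "continuous_on (path_image c) g" using continuous_on_subset[OF g(1)] by blast
      moreover have "path c" using L c(1) unfolding lifts_def by blast
      ultimately show "path d" unfolding c(2) using path_continuous_image by blast
      show "(\<pi> \<circ> h) (d t) = e t" if "t \<in> {0..1}" for t
        using g(2)[OF cM[OF c(1) that]] L c that unfolding lifts_def by simp
      fix d' t assume d': "d' \<in> (\<lambda>c. g \<circ> c) ` L" "t \<in> {0..1}" "d t = d' t"
      then obtain c' where c': "c' \<in> L" "d' = g \<circ> c'" by blast
      have "c t = c' t" using g(2) cM[OF c(1) d'(2)] cM[OF c'(1) d'(2)] d'(3) c c' by (metis comp_apply)
      then show "d = d'" using L c c' d'(2) unfolding lifts_def by blast
    next
      fix w t assume w: "t \<in> {0..1::real}" "(\<pi> \<circ> h) w = e t"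
      then obtain c where "c \<in> L" "c t = h w" using L hM(1)[of w] unfolding lifts_def by fastforce
      then show "\<exists>d\<in>(\<lambda>c. g \<circ> c) ` L. d t = w" using h(3) by (intro bexI[of _ "g \<circ> c"]) auto
    qed auto
    then show "\<exists>L. lifts UNIV (\<pi> \<circ> h) e L" by blast
  qed
  then show thesis using that by blast
qed

section \<open>Transversality and local sides\<close>

text \<open>The form in which transversality enters the argument. It refers to neighbourhoods instead of charts and
so is preserved by local homeomorphisms.\<close>

definition two_sided_at :: "'a topology \<Rightarrow> 'a set \<Rightarrow> 'a \<Rightarrow> bool" where
  "two_sided_at S A x \<longleftrightarrow> (\<forall>W. openin S W \<and> x \<in> W \<longrightarrow>
     (\<exists>N H1 H2. openin S N \<and> x \<in> N \<and> N \<subseteq> W \<and> connectedin S H1 \<and> connectedin S H2 \<and> N - A = H1 \<union> H2))"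

text \<open>Isolated vertices belong to the support but to no curve; they have to be avoided near a crossing.\<close>

definition edge_points :: "'a embedded_graph \<Rightarrow> 'a set" where
  "edge_points G = (\<Union>e\<in>edges G. e ` {0..1})"

lemma support_edge_points: "support G = verts G \<union> edge_points G"
  unfolding support_def edge_points_def ..

text \<open>A small disc around the centre of the chart avoids the finite set \<open>F\<close> and is divided into two half
discs by the line \<open>f = 0\<close>.\<close>

lemma chart_two_sided:
  fixes f :: "complex \<Rightarrow> real"
  assumes U: "openin S U" "x \<in> U" and hom: "homeomorphic_map (subtopology S U) (top_of_set (ball (0 :: complex) 1)) \<phi>"
    and \<phi>x: "\<phi> x = 0" and im: "\<phi> ` (U \<inter> (F \<union> A)) = {z \<in> ball 0 1. f z = 0}"
    and f: "bounded_linear f" and F: "finite F" "x \<notin> F"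
  shows "two_sided_at S A x"
  unfolding two_sided_at_def
proof (intro allI impI)
  fix W assume W: "openin S W \<and> x \<in> W"
  have top: "topspace (subtopology S U) = U" using openin_subset[OF U(1)] by (simp add: Int_absorb1)
  obtain g where g: "homeomorphic_maps (subtopology S U) (top_of_set (ball (0 :: complex) 1)) \<phi> g"
    using hom homeomorphic_map_maps by blast
  have \<phi>c: "continuous_map (subtopology S U) (top_of_set (ball 0 1)) \<phi>"
    and gc: "continuous_map (top_of_set (ball 0 1)) (subtopology S U) g"
    and g\<phi>: "\<And>y. y \<in> U \<Longrightarrow> g (\<phi> y) = y" and \<phi>g: "\<And>z. z \<in> ball 0 1 \<Longrightarrow> \<phi> (g z) = z"
    using g top unfolding homeomorphic_maps_def by auto
  have \<phi>b: "\<phi> y \<in> ball 0 1" if "y \<in> U" for y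
    using \<phi>c that top by (metis continuous_map_image_subset_topspace image_subset_iff topspace_euclidean_subtopology)
  have gU: "g z \<in> U" if "z \<in> ball 0 1" for z
    using gc that top by (metis continuous_map_image_subset_topspace image_subset_iff topspace_euclidean_subtopology)
  define Q where "Q = \<phi> ` (W \<inter> U) - \<phi> ` (F \<inter> U)"
  have "openin (subtopology S U) (W \<inter> U)" using W by (auto simp: openin_subtopology)
  then have "openin (top_of_set (ball 0 1)) (\<phi> ` (W \<inter> U))"
    using homeomorphic_imp_open_map[OF hom] unfolding open_map_def by blast
  then have "open (\<phi> ` (W \<inter> U))" using openin_open_trans open_ball by blast
  then have "open Q" unfolding Q_def using F by (intro open_Diff finite_imp_closed) auto
  moreover have "0 \<in> Q"
  proof -
    have "0 \<in> \<phi> ` (W \<inter> U)" using W U \<phi>x by (metis IntI imageI)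
    moreover have "0 \<notin> \<phi> ` (F \<inter> U)"
    proof
      assume "0 \<in> \<phi> ` (F \<inter> U)"
      then obtain v where v: "v \<in> F" "v \<in> U" "\<phi> v = \<phi> x" using \<phi>x by auto
      have "v = g (\<phi> v)" using g\<phi>[OF v(2)] ..
      also have "\<dots> = x" unfolding v(3) by (rule g\<phi>[OF U(2)])
      finally show False using v(1) F(2) by simp
    qed
    ultimately show ?thesis unfolding Q_def by blast
  qed
  ultimately obtain r where r: "0 < r" "ball 0 r \<subseteq> Q" using openE by blast
  have Qb: "Q \<subseteq> ball 0 1" unfolding Q_def using \<phi>b by blast
  have rb: "ball (0::complex) r \<subseteq> ball 0 1" using r Qb by blast
  define N where "N = {y \<in> U. \<phi> y \<in> ball 0 r}"
  define H where "H s = g ` (ball 0 r \<inter> {z. 0 < s * f z})" for s :: real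
  have conn: "connectedin S (H s)" for s
  proof -
    have "convex {z. 0 < s * f z}"
    proof -
      have "{z. 0 < s * f z} = (\<lambda>z. s * f z) -` {0<..}" by auto
      moreover have "linear (\<lambda>z. s * f z)"
        using f by (intro bounded_linear.linear bounded_linear_mult_right[THEN bounded_linear_compose])
      ultimately show ?thesis using convex_linear_vimage[of "\<lambda>z. s * f z" "{0<..}"] by simp
    qed
    then have "connected (ball 0 r \<inter> {z. 0 < s * f z})" by (intro convex_connected convex_Int) auto
    then have "connectedin (top_of_set (ball 0 1)) (ball 0 r \<inter> {z. 0 < s * f z})"
      using rb by (auto simp: connectedin_subtopology)
    then have "connectedin (subtopology S U) (H s)"
      unfolding H_def by (rule connectedin_continuous_map_image[OF gc])
    then show ?thesis by (simp add: connectedin_subtopology)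
  qed
  have "openin (subtopology S U) N"
  proof -
    have "openin (top_of_set (ball 0 1)) (ball (0::complex) r)"
      using rb by (simp add: openin_open_eq)
    from openin_continuous_map_preimage[OF \<phi>c this] show ?thesis unfolding top N_def .
  qed
  then have "openin S N" using U(1) openin_trans_full by blast
  moreover have "x \<in> N" unfolding N_def using U \<phi>x r by simp
  moreover have "N \<subseteq> W"
  proof
    fix y assume y: "y \<in> N"
    then have "\<phi> y \<in> \<phi> ` (W \<inter> U)" using r unfolding N_def Q_def by blast
    then obtain w where "w \<in> W" "w \<in> U" "\<phi> y = \<phi> w" by blast
    then show "y \<in> W" using g\<phi>[of w] g\<phi>[of y] y unfolding N_def by auto
  qed
  moreover have "N - A = H 1 \<union> H (-1)"
  proof -
    have zero: "y \<in> A \<longleftrightarrow> f (\<phi> y) = 0" if y: "y \<in> N" for y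
    proof -
      have yU: "y \<in> U" and "\<phi> y \<notin> \<phi> ` (F \<inter> U)" using y r unfolding N_def Q_def by blast+
      then have "y \<notin> F" by blast
      have "f (\<phi> y) = 0 \<longleftrightarrow> \<phi> y \<in> \<phi> ` (U \<inter> (F \<union> A))" unfolding im using \<phi>b[OF yU] by simp
      also have "\<dots> \<longleftrightarrow> y \<in> F \<union> A"
      proof
        assume "\<phi> y \<in> \<phi> ` (U \<inter> (F \<union> A))"
        then obtain w where "w \<in> U" "w \<in> F \<union> A" "\<phi> y = \<phi> w" by blast
        then show "y \<in> F \<union> A" using g\<phi>[of w] g\<phi>[of y] yU by auto
      qed (use yU in blast)
      finally show ?thesis using \<open>y \<notin> F\<close> by blast
    qed
    have "N - A = {y \<in> N. 0 < 1 * f (\<phi> y)} \<union> {y \<in> N. 0 < -1 * f (\<phi> y)}"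
      using zero by (auto simp: neq_iff)
    moreover have "{y \<in> N. 0 < s * f (\<phi> y)} = H s" for s
    proof
      show "{y \<in> N. 0 < s * f (\<phi> y)} \<subseteq> H s"
      proof
        fix y assume y: "y \<in> {y \<in> N. 0 < s * f (\<phi> y)}"
        then have "\<phi> y \<in> ball 0 r \<inter> {z. 0 < s * f z}" "y = g (\<phi> y)" using g\<phi> unfolding N_def by auto
        then show "y \<in> H s" unfolding H_def by (metis imageI)
      qed
      show "H s \<subseteq> {y \<in> N. 0 < s * f (\<phi> y)}"
      proof
        fix y assume "y \<in> H s"
        then obtain z where z: "z \<in> ball 0 r" "0 < s * f z" "y = g z" unfolding H_def by blast
        then have "z \<in> ball 0 1" using rb by blast
        then show "y \<in> {y \<in> N. 0 < s * f (\<phi> y)}" using z \<phi>g gU unfolding N_def by simp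
      qed
    qed
    ultimately show ?thesis by (simp only:)
  qed
  ultimately show "\<exists>N H1 H2. openin S N \<and> x \<in> N \<and> N \<subseteq> W \<and> connectedin S H1 \<and> connectedin S H2 \<and> N - A = H1 \<union> H2"
    using conn by blast
qed

lemma transversal_two_sided:
  assumes "transversal_at S G G' x" "finite (verts G)" "finite (verts G')" "x \<notin> verts G" "x \<notin> verts G'"
  shows "two_sided_at S (edge_points G) x" "two_sided_at S (edge_points G') x"
proof -
  obtain U \<phi> where U: "openin S U" "x \<in> U"
    "homeomorphic_map (subtopology S U) (top_of_set (ball (0 :: complex) 1)) \<phi>" "\<phi> x = 0"
    "\<phi> ` (U \<inter> (verts G \<union> edge_points G)) = {z \<in> ball 0 1. Im z = 0}"
    "\<phi> ` (U \<inter> (verts G' \<union> edge_points G')) = {z \<in> ball 0 1. Re z = 0}"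
    using assms(1) unfolding transversal_at_def support_edge_points by blast
  show "two_sided_at S (edge_points G) x"
    by (rule chart_two_sided[OF U(1-5) bounded_linear_Im assms(2,4)])
  show "two_sided_at S (edge_points G') x"
    by (rule chart_two_sided[OF U(1-4) U(6) bounded_linear_Re assms(3,5)])
qed

lemma transversal_off_supports:
  assumes "transversal_at S G G' x"
  obtains z where "z \<in> topspace S" "z \<notin> support G" "z \<notin> support G'"
proof -
  obtain U \<phi> where U: "openin S U" "homeomorphic_map (subtopology S U) (top_of_set (ball (0 :: complex) 1)) \<phi>"
    "\<phi> ` (U \<inter> support G) = {z \<in> ball 0 1. Im z = 0}" "\<phi> ` (U \<inter> support G') = {z \<in> ball 0 1. Re z = 0}"
    using assms(1) unfolding transversal_at_def by blast
  have top: "topspace (subtopology S U) = U" using openin_subset[OF U(1)] by (simp add: Int_absorb1)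
  have "\<phi> ` U = ball 0 1" using homeomorphic_imp_surjective_map[OF U(2)] unfolding top by simp
  moreover have "Complex (1/2) (1/2) \<in> ball 0 1"
    by (simp add: cmod_def power2_eq_square real_sqrt_lt_1_iff)
  ultimately obtain z where z: "z \<in> U" "\<phi> z = Complex (1/2) (1/2)" by (metis imageE)
  have "z \<notin> support G" using z U(3) by (metis (mono_tags, lifting) IntI complex.sel(2) imageI mem_Collect_eq zero_neq_one divide_eq_0_iff zero_neq_numeral)
  moreover have "z \<notin> support G'"
    using z U(4) by (metis (mono_tags, lifting) IntI complex.sel(1) imageI mem_Collect_eq zero_neq_one divide_eq_0_iff zero_neq_numeral)
  ultimately show thesis using that z(1) openin_subset[OF U(1)] by blast
qed

lemma two_sided_at_pullback:
  fixes \<psi> :: "complex \<Rightarrow> 'a"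
  assumes cont: "continuous_map euclidean S \<psi>" and op: "open_map euclidean S \<psi>"
    and V: "open V" "w \<in> V" "inj_on \<psi> V" and two: "two_sided_at S A (\<psi> w)" and W: "open W" "w \<in> W"
  shows "\<exists>N H1 H2. open N \<and> w \<in> N \<and> N \<subseteq> W \<and> connected H1 \<and> connected H2 \<and> N - \<psi> -` A = H1 \<union> H2"
proof -
  have "openin S (\<psi> ` (V \<inter> W))" using op V(1) W(1) unfolding open_map_def by (simp add: open_Int)
  then obtain N H1 H2 where N: "openin S N" "\<psi> w \<in> N" "N \<subseteq> \<psi> ` (V \<inter> W)" "connectedin S H1" "connectedin S H2" "N - A = H1 \<union> H2"
    using two V(2) W(2) unfolding two_sided_at_def by (metis IntI imageI)
  have oV: "openin S (\<psi> ` V)" using op V(1) unfolding open_map_def by simp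
  have hom: "homeomorphic_map (top_of_set V) (subtopology S (\<psi> ` V)) \<psi>"
  proof (rule bijective_open_imp_homeomorphic_map)
    show "continuous_map (top_of_set V) (subtopology S (\<psi> ` V)) \<psi>"
      using continuous_map_from_subtopology[OF cont] by (auto simp: continuous_map_in_subtopology)
    show "open_map (top_of_set V) (subtopology S (\<psi> ` V)) \<psi>"
      unfolding open_map_def
    proof (intro allI impI)
      fix O' assume "openin (top_of_set V) O'"
      then have O': "open O'" "O' \<subseteq> V" using V(1) openin_open_eq by blast+
      then have "openin S (\<psi> ` O')" using op unfolding open_map_def by simp
      then show "openin (subtopology S (\<psi> ` V)) (\<psi> ` O')"
        using O'(2) by (metis image_mono openin_subset_topspace_eq openin_subtopology_Int subtopology_topspace inf.absorb1)
    qed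
    show "\<psi> ` topspace (top_of_set V) = topspace (subtopology S (\<psi> ` V))"
      using openin_subset[OF oV] by auto
    show "inj_on \<psi> (topspace (top_of_set V))" using V(3) by simp
  qed
  have conn: "connected (V \<inter> \<psi> -` H)" if "connectedin S H" "H \<subseteq> \<psi> ` V" for H
  proof -
    have "\<psi> ` (V \<inter> \<psi> -` H) = H" using that(2) by blast
    moreover have "connectedin (subtopology S (\<psi> ` V)) H"
      using that by (simp add: connectedin_subtopology)
    ultimately have "connectedin (top_of_set V) (V \<inter> \<psi> -` H)"
      using homeomorphic_map_connectedness[OF hom, of "V \<inter> \<psi> -` H"] by simp
    then show ?thesis by (simp add: connectedin_subtopology)
  qed
  have "open (\<psi> -` N)" using openin_continuous_map_preimage[OF cont N(1)] by (simp add: vimage_def)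
  then have "open (V \<inter> \<psi> -` N)" using V(1) by blast
  moreover have "w \<in> V \<inter> \<psi> -` N" using V N by blast
  moreover have "V \<inter> \<psi> -` N \<subseteq> W"
  proof
    fix y assume y: "y \<in> V \<inter> \<psi> -` N"
    then obtain y' where "y' \<in> V" "y' \<in> W" "\<psi> y = \<psi> y'" using N(3) by blast
    then show "y \<in> W" using inj_onD[OF V(3)] y by blast
  qed
  moreover have "(V \<inter> \<psi> -` N) - \<psi> -` A = (V \<inter> \<psi> -` H1) \<union> (V \<inter> \<psi> -` H2)" using N(6) by blast
  moreover have "connected (V \<inter> \<psi> -` H1)" "connected (V \<inter> \<psi> -` H2)"
  proof -
    have "H1 \<subseteq> N" "H2 \<subseteq> N" using N(6) by auto
    moreover have "N \<subseteq> \<psi> ` V" using N(3) by blast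
    ultimately show "connected (V \<inter> \<psi> -` H1)" "connected (V \<inter> \<psi> -` H2)"
      using conn N(4,5) by simp_all
  qed
  ultimately show ?thesis by metis
qed

section \<open>Paths of length two\<close>

abbreviation (input) crossings :: "'a embedded_graph \<Rightarrow> 'a embedded_graph \<Rightarrow> 'a set" where
  "crossings Gp Gm \<equiv> support Gp \<inter> support Gm"

lemma verts_subset_support: "verts G \<subseteq> support G"
  unfolding support_def by simp

lemma normal_pair_separated:
  assumes "normal_pair S Gp Gm"
  shows "verts Gp \<inter> support Gm = {}" "verts Gm \<inter> support Gp = {}"
proof -
  have "support Gp \<inter> support Gm \<inter> (verts Gp \<union> verts Gm) = {}"
    using assms unfolding normal_pair_def by simp
  then show "verts Gp \<inter> support Gm = {}" "verts Gm \<inter> support Gp = {}"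
    using verts_subset_support[of Gp] verts_subset_support[of Gm] by blast+
qed

lemma normal_pair_crossing:
  assumes np: "normal_pair S Gp Gm" and x: "x \<in> crossings Gp Gm"
  shows "x \<notin> verts Gp" "x \<notin> verts Gm" "x \<in> edge_points Gp" "x \<in> edge_points Gm"
  using normal_pair_separated[OF np] x unfolding support_edge_points by blast+

lemma edge_facts:
  assumes "graph_embedded_in G S" "e \<in> edges G"
  shows "pathin S e" "e 0 \<in> verts G" "e 1 \<in> verts G" "inj_on e {0<..<1}" "e ` {0<..<1} \<inter> verts G = {}"
    "e ` {0..1} \<subseteq> support G"
proof -
  have "\<forall>e \<in> edges G. pathin S e \<and> e 0 \<in> verts G \<and> e 1 \<in> verts G \<and>
        inj_on e {0<..<1} \<and> e ` {0<..<1} \<inter> verts G = {}"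
    using assms(1) unfolding graph_embedded_in_def by simp
  then show "pathin S e" "e 0 \<in> verts G" "e 1 \<in> verts G" "inj_on e {0<..<1}" "e ` {0<..<1} \<inter> verts G = {}"
    using assms(2) by simp_all
  show "e ` {0..1} \<subseteq> support G" using assms(2) unfolding support_def by blast
qed

text \<open>A single edge of the refinement is a piece of an edge of one graph, and so has no end in the other graph.\<close>

lemma width_ge_2:
  assumes np: "normal_pair S Gp Gm"
  shows "2 \<le> width Gp Gm"
  unfolding width_def graph_distance_def
proof (intro INF_greatest)
  fix u v n assume u: "u \<in> verts Gp" and v: "v \<in> verts Gm"
    and n: "n \<in> {n. (u, v) \<in> adjacency (common_refinement Gp Gm) ^^ n}"
  have sep: "u \<notin> support Gm" "v \<notin> support Gp" using normal_pair_separated[OF np] u v by blast+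
  have "n \<noteq> 0"
  proof
    assume "n = 0"
    then have "u = v" using n by simp
    then show False using sep(1) v unfolding support_def by blast
  qed
  moreover have "n \<noteq> 1"
  proof
    assume "n = 1"
    then have "(u, v) \<in> adjacency (common_refinement Gp Gm)" using n by simp
    then obtain p where p: "p \<in> edges (common_refinement Gp Gm)" "{u, v} = {p 0, p 1}"
      unfolding adjacency_def by blast
    then obtain e s t where e: "e \<in> edges Gp \<union> edges Gm" "0 \<le> s" "s < t" "t \<le> 1" "p = edge_piece s t e"
      unfolding common_refinement_def by auto
    have "p 0 = e s" "p 1 = e t" using e(5) unfolding edge_piece_def by simp_all
    then have "{u,v} \<subseteq> e ` {0..1}" using p(2) e(2-4) by auto
    moreover have "e ` {0..1} \<subseteq> support Gp \<or> e ` {0..1} \<subseteq> support Gm"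
      using e(1) unfolding support_def by auto
    ultimately show False using sep by auto
  qed
  ultimately have "2 \<le> n" by linarith
  then show "2 \<le> enat n" by (metis enat_ord_simps(1) numeral_eq_enat)
qed

text \<open>The piece of \<open>e\<close> between an extremal crossing and the corresponding end of \<open>e\<close> is an edge of the refinement.\<close>

lemma extremal_piece:
  assumes np: "normal_pair S Gp Gm" and G: "G = Gp \<or> G = Gm" and e: "e \<in> edges G"
    and t: "t \<in> {0..1}" "e t \<in> crossings Gp Gm"
    and ext: "extremal_on (crossings Gp Gm) e t"
  obtains v where "v \<in> verts G" "(v, e t) \<in> adjacency (common_refinement Gp Gm)" "(e t, v) \<in> adjacency (common_refinement Gp Gm)"
proof -
  have emb: "graph_embedded_in G S" using np G unfolding normal_pair_def by blast
  note ef = edge_facts[OF emb e]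
  note sep = normal_pair_separated[OF np]
  have nv: "e t \<notin> verts G" using normal_pair_crossing[OF np t(2)] G by blast
  then have "t \<noteq> 0" "t \<noteq> 1" using ef(2,3) by metis+
  then have t01: "0 < t" "t < 1" using t(1) by auto
  have rv: "e t' \<notin> refinement_verts Gp Gm" if "0 < t'" "t' < 1" "e t' \<notin> crossings Gp Gm" for t'
  proof -
    have "e t' \<in> support G" using ef(6) that by auto
    moreover have "e t' \<in> e ` {0<..<1}" using that(1,2) by simp
    then have "e t' \<notin> verts G" using ef(5) by blast
    ultimately show ?thesis using G sep that(3) unfolding refinement_verts_def by blast
  qed
  have tv: "e t \<in> refinement_verts Gp Gm" "e 0 \<in> refinement_verts Gp Gm" "e 1 \<in> refinement_verts Gp Gm"
    using t(2) ef(2,3) G unfolding refinement_verts_def by blast+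
  have eG: "e \<in> edges Gp \<union> edges Gm" using e G by blast
  have piece: "edge_piece a b e \<in> edges (common_refinement Gp Gm)"
    if "0 \<le> a" "a < b" "b \<le> 1" "e a \<in> refinement_verts Gp Gm" "e b \<in> refinement_verts Gp Gm"
      "e ` {a<..<b} \<inter> refinement_verts Gp Gm = {}" for a b
    using that eG unfolding common_refinement_def by auto
  have ends: "edge_piece a b e 0 = e a" "edge_piece a b e 1 = e b" for a b unfolding edge_piece_def
    by simp_all
  from ext[unfolded extremal_on_def] show thesis
  proof
    assume n: "\<forall>t'\<in>{0..<t}. e t' \<notin> crossings Gp Gm"
    have "e t' \<notin> refinement_verts Gp Gm" if "t' \<in> {0<..<t}" for t'
      by (rule rv) (use n that t01 in auto)
    then have "e ` {0<..<t} \<inter> refinement_verts Gp Gm = {}" by blast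
    then have "edge_piece 0 t e \<in> edges (common_refinement Gp Gm)"
      using piece[of 0 t] t01 tv by simp
    then show thesis using that[OF ef(2)] ends unfolding adjacency_def by blast
  next
    assume n: "\<forall>t'\<in>{t<..1}. e t' \<notin> crossings Gp Gm"
    have "e t' \<notin> refinement_verts Gp Gm" if "t' \<in> {t<..<1}" for t'
      by (rule rv) (use n that t01 in auto)
    then have "e ` {t<..<1} \<inter> refinement_verts Gp Gm = {}" by blast
    then have "edge_piece t 1 e \<in> edges (common_refinement Gp Gm)"
      using piece[of t 1] t01 tv by simp
    then show thesis using that[OF ef(3)] ends unfolding adjacency_def by blast
  qed
qed

section \<open>The existence of an extremal crossing\<close>

text \<open>Lift all edges to the plane, with a point \<open>z\<close> off both graphs sent to infinity. Two lifts meet at most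
once since an edge passes only once through a crossing. A crossing of lifts that is extremal on both
projects to the required one.\<close>

theorem exists_extremal_crossing:
  assumes S: "is_two_sphere S \<or> is_projective_plane S" and np: "normal_pair S Gp Gm"
    and ne: "crossings Gp Gm \<noteq> {}"
  obtains e f t u where "e \<in> edges Gp" "f \<in> edges Gm" "t \<in> {0..1}" "u \<in> {0..1}" "e t = f u"
    "extremal_on (crossings Gp Gm) e t"
    "extremal_on (crossings Gp Gm) f u"
proof -
  have meet: "\<forall>e \<in> edges Gp. \<forall>f \<in> edges Gm. \<forall>x \<in> e ` {0..1} \<inter> f ` {0..1}. \<forall>y \<in> e ` {0..1} \<inter> f ` {0..1}. x = y"
    using np unfolding normal_pair_def by (elim conjE) assumption
  define G where "G s = (if s then Gp else Gm)" for s
  define D where "D s = edge_points (G s)" for s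
  have emb: "graph_embedded_in (G s) S" for s using np unfolding normal_pair_def G_def by simp
  note ef = edge_facts[OF emb]
  have sup: "crossings Gp Gm = D True \<inter> D False"
  proof -
    have "crossings Gp Gm \<subseteq> D True \<inter> D False"
      using normal_pair_crossing(3,4)[OF np] unfolding D_def G_def by auto
    then show ?thesis unfolding D_def G_def support_edge_points by auto
  qed
  have trans: "transversal_at S Gp Gm x" if "x \<in> crossings Gp Gm" for x
    using np that unfolding normal_pair_def by simp
  have two: "two_sided_at S (D s) x" if x: "x \<in> D True \<inter> D False" for s x
  proof -
    have x': "x \<in> crossings Gp Gm" using x sup by simp
    have "finite (verts Gp)" "finite (verts Gm)"
      using np unfolding normal_pair_def graph_embedded_in_def by blast+
    then show ?thesis
      using transversal_two_sided[OF trans[OF x']] normal_pair_crossing(1,2)[OF np x']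
        unfolding D_def G_def by simp
  qed
  obtain x0 where x0: "x0 \<in> crossings Gp Gm" using ne by blast
  obtain z where z: "z \<in> topspace S" "z \<notin> support Gp" "z \<notin> support Gm"
    using transversal_off_supports[OF trans[OF x0]] by blast
  obtain \<pi> where "lifting_map (sphere (0::real^3) 1) S (topspace S) \<pi>"
    using S two_sphere_cover projective_plane_cover by metis
  then obtain \<psi> :: "complex \<Rightarrow> 'a" where \<psi>: "lifting_map UNIV S (topspace S - {z}) \<psi>"
    using punctured_plane_cover z(1) by metis
  have cont: "continuous_map euclidean S \<psi>" and op: "open_map euclidean S \<psi>"
    and linj: "\<And>w. \<exists>V. open V \<and> w \<in> V \<and> inj_on \<psi> V"
    and surj: "topspace S - {z} \<subseteq> range \<psi>"
    and lift: "\<And>e. pathin S e \<Longrightarrow> e ` {0..1} \<subseteq> topspace S - {z} \<Longrightarrow> \<exists>L. lifts UNIV \<psi> e L"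
    using \<psi> unfolding lifting_map_def subtopology_UNIV by simp_all
  have elift: "\<exists>L. lifts UNIV \<psi> e L" if "e \<in> edges (G s)" for e s
  proof (rule lift[OF ef(1)[OF that]])
    have "e ` {0..1} \<subseteq> topspace S" using ef(1)[OF that] unfolding pathin_def
      by (metis continuous_map_image_subset_topspace topspace_euclidean_subtopology)
    moreover have "z \<notin> support (G s)" using z unfolding G_def by simp
    ultimately show "e ` {0..1} \<subseteq> topspace S - {z}" using ef(6)[OF that] by blast
  qed
  define L where "L e = (SOME L. lifts UNIV \<psi> e L)" for e
  have L: "lifts UNIV \<psi> e (L e)" if "e \<in> edges (G s)" for e s
    unfolding L_def using someI_ex[OF elift[OF that]] .
  have Lfin: "finite (L e)" and Lpath: "\<And>c. c \<in> L e \<Longrightarrow> path c" and Lproj: "\<And>c t. c \<in> L e \<Longrightarrow> t \<in> {0..1} \<Longrightarrow> \<psi> (c t) = e t"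
    and Luniq: "\<And>c d t. c \<in> L e \<Longrightarrow> d \<in> L e \<Longrightarrow> t \<in> {0..1} \<Longrightarrow> c t = d t \<Longrightarrow> c = d"
    and Lex: "\<And>w t. t \<in> {0..1} \<Longrightarrow> \<psi> w = e t \<Longrightarrow> \<exists>c\<in>L e. c t = w" if "e \<in> edges (G s)" for e s
    using L[OF that] unfolding lifts_def by blast+
  define \<C> where "\<C> s = (\<Union>e\<in>edges (G s). L e)" for s
  define K where "K s = (\<Union>c\<in>\<C> s. c ` {0..1})" for s
  define X where "X = K True \<inter> K False"
  have K: "K s = \<psi> -` D s" for s
  proof
    show "K s \<subseteq> \<psi> -` D s" unfolding K_def \<C>_def D_def edge_points_def
      using Lproj[of _ s] by fastforce
    show "\<psi> -` D s \<subseteq> K s"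
    proof
      fix w assume "w \<in> \<psi> -` D s"
      then obtain e t where "e \<in> edges (G s)" "t \<in> {0..1}" "\<psi> w = e t"
        unfolding D_def edge_points_def by auto
      then show "w \<in> K s" unfolding K_def \<C>_def using Lex[of e s t w] by blast
    qed
  qed
  have X: "w \<in> X \<longleftrightarrow> \<psi> w \<in> crossings Gp Gm" for w unfolding X_def K sup by simp
  have nv: "\<psi> w \<notin> verts (G s)" if "w \<in> X" for w s
    using normal_pair_crossing(1,2)[OF np] that unfolding X G_def by simp
  have unique: "e = f \<and> t = u" if "e \<in> edges (G s)" "f \<in> edges (G s)" "t \<in> {0<..<1}" "u \<in> {0<..<1}" "e t = f u" for e f s t u
  proof -
    have "e t \<in> e ` {0<..<1}" "e t \<in> f ` {0<..<1}" using that by (metis imageI)+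
    then have "e = f" using emb[of s] that(1,2) unfolding graph_embedded_in_def by blast
    then show ?thesis using inj_onD[OF ef(4)[OF that(1)], of t u] that by auto
  qed
  interpret plane_curves \<C> K X
  proof
    show "K s = (\<Union>c\<in>\<C> s. c ` {0..1})" for s by (rule K_def)
    show "X = K True \<inter> K False" by (rule X_def)
    show "finite (\<C> s)" for s
    proof -
      have "finite (edges (G s))" using emb[of s] unfolding graph_embedded_in_def by simp
      then show ?thesis unfolding \<C>_def using Lfin by (intro finite_UN_I) auto
    qed
    show "path c" if "c \<in> \<C> s" for c s using that Lpath unfolding \<C>_def by blast
    show "inj_on c {0<..<1}" if c: "c \<in> \<C> s" for c s
    proof (rule inj_onI)
      fix t u assume tu: "t \<in> {0<..<1}" "u \<in> {0<..<1}" "c t = c u"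
      obtain e where e: "e \<in> edges (G s)" "c \<in> L e" using c unfolding \<C>_def by blast
      have "e t = e u" using Lproj[OF e, of t] Lproj[OF e, of u] tu by auto
      then show "t = u" using unique[OF e(1) e(1) tu(1,2)] by blast
    qed
    show "c 0 \<notin> X" "c 1 \<notin> X" if c: "c \<in> \<C> s" for c s
    proof -
      obtain e where e: "e \<in> edges (G s)" "c \<in> L e" using c unfolding \<C>_def by blast
      have "\<psi> (c 0) \<in> verts (G s)" "\<psi> (c 1) \<in> verts (G s)"
        using Lproj[OF e, of 0] Lproj[OF e, of 1] ef(2,3)[OF e(1)] by simp_all
      then show "c 0 \<notin> X" "c 1 \<notin> X" using nv by blast+
    qed
    show "c ` {0<..<1} \<inter> d ` {0<..<1} = {}" if cd: "c \<in> \<C> s" "d \<in> \<C> s" "c \<noteq> d" for c d s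
    proof (rule ccontr)
      assume "c ` {0<..<1} \<inter> d ` {0<..<1} \<noteq> {}"
      then obtain t u where tu: "t \<in> {0<..<1}" "u \<in> {0<..<1}" "c t = d u" by blast
      obtain e where e: "e \<in> edges (G s)" "c \<in> L e" using cd unfolding \<C>_def by blast
      obtain f where f: "f \<in> edges (G s)" "d \<in> L f" using cd unfolding \<C>_def by blast
      have "e t = f u" using Lproj[OF e, of t] Lproj[OF f, of u] tu by auto
      then have "e = f" "t = u" using unique[OF e(1) f(1) tu(1,2)] by blast+
      then have "c = d" using Luniq[OF e(1,2), of d t] f tu by auto
      then show False using cd(3) by blast
    qed
    show "x = y" if cd: "c \<in> \<C> s" "d \<in> \<C> (\<not> s)" "x \<in> c ` {0..1} \<inter> d ` {0..1}" "y \<in> c ` {0..1} \<inter> d ` {0..1}" for c d s x y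
    proof -
      obtain e where e: "e \<in> edges (G s)" "c \<in> L e" using cd unfolding \<C>_def by blast
      obtain f where f: "f \<in> edges (G (\<not> s))" "d \<in> L f" using cd unfolding \<C>_def by blast
      have both: "\<psi> v \<in> e ` {0..1} \<inter> f ` {0..1}" if "v \<in> c ` {0..1} \<inter> d ` {0..1}" for v
        using that Lproj[OF e] Lproj[OF f] by force
      have "\<psi> x = \<psi> y"
      proof (cases s)
        case True
        then have "e \<in> edges Gp" "f \<in> edges Gm" using e(1) f(1) unfolding G_def by simp_all
        then show ?thesis using meet both[OF cd(3)] both[OF cd(4)] by blast
      next
        case False
        then have "f \<in> edges Gp" "e \<in> edges Gm" using e(1) f(1) unfolding G_def by simp_all
        then show ?thesis using meet both[OF cd(3)] both[OF cd(4)] by blast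
      qed
      have inX: "v \<in> X" if "v \<in> c ` {0..1} \<inter> d ` {0..1}" for v
      proof -
        have "v \<in> K s" "v \<in> K (\<not> s)" using that cd(1,2) unfolding K_def by blast+
        then show ?thesis unfolding X_def by (cases s) auto
      qed
      obtain t where t: "t \<in> {0..1}" "x = c t" using cd(3) by blast
      obtain u where u: "u \<in> {0..1}" "y = c u" using cd(4) by blast
      have eq: "e t = e u" using \<open>\<psi> x = \<psi> y\<close> Lproj[OF e t(1)] Lproj[OF e u(1)] t u by simp
      have inner: "v \<in> {0<..<1}" if "v \<in> {0..1}" "c v \<in> X" for v
      proof -
        have "e v \<notin> verts (G s)" using nv[OF that(2), of s] Lproj[OF e that(1)] by simp
        then have "v \<noteq> 0" "v \<noteq> 1" using ef(2,3)[OF e(1)] by metis+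
        then show ?thesis using that(1) by auto
      qed
      have "c t \<in> X" "c u \<in> X" using inX[OF cd(3)] inX[OF cd(4)] t(2) u(2) by simp_all
      then have "t = u" using unique[OF e(1) e(1) inner[OF t(1)] inner[OF u(1)] eq] by simp
      then show ?thesis using t u by simp
    qed
    show "\<exists>N H1 H2. open N \<and> x \<in> N \<and> N \<subseteq> W \<and> connected H1 \<and> connected H2 \<and> N - K s = H1 \<union> H2"
      if "x \<in> X" "open W" "x \<in> W" for x W s
    proof -
      obtain V where V: "open V" "x \<in> V" "inj_on \<psi> V" using linj by blast
      have "two_sided_at S (D s) (\<psi> x)" using two that(1) unfolding X sup by blast
      then show ?thesis unfolding K using two_sided_at_pullback[OF cont op V _ that(2,3)] by blast
    qed
  qed
  have "X \<noteq> {}"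
  proof -
    have "x0 \<in> edge_points Gp" using normal_pair_crossing(3)[OF np x0] .
    then obtain e t where e: "e \<in> edges Gp" "t \<in> {0..1}" "x0 = e t" unfolding edge_points_def
      by blast
    have "pathin S e" using ef(1)[of e True] e(1) unfolding G_def by simp
    then have "e t \<in> topspace S" unfolding pathin_def
      using e(2) by (metis continuous_map_image_subset_topspace imageI subsetD topspace_euclidean_subtopology)
    moreover have "x0 \<noteq> z" using x0 z by blast
    ultimately obtain w where "x0 = \<psi> w" using surj e(3) by blast
    then show ?thesis using X x0 by blast
  qed
  then obtain c d t u where cd: "c \<in> \<C> True" "d \<in> \<C> False" "t \<in> {0..1}" "u \<in> {0..1}" "c t = d u" "extremal_on X c t" "extremal_on X d u"
    using extremal_crossing by blast
  obtain e where e: "e \<in> edges (G True)" "c \<in> L e" using cd unfolding \<C>_def by blast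
  obtain f where f: "f \<in> edges (G False)" "d \<in> L f" using cd unfolding \<C>_def by blast
  have ce: "c t' \<in> X \<longleftrightarrow> e t' \<in> crossings Gp Gm" if "t' \<in> {0..1}" for t'
    unfolding X Lproj[OF e that] ..
  have df: "d t' \<in> X \<longleftrightarrow> f t' \<in> crossings Gp Gm" if "t' \<in> {0..1}" for t'
    unfolding X Lproj[OF f that] ..
  show thesis
  proof (rule that[of e f t u])
    show "e \<in> edges Gp" "f \<in> edges Gm" using e f unfolding G_def by simp_all
    show "e t = f u" using Lproj[OF e cd(3)] Lproj[OF f cd(4)] cd(5) by simp
    show "extremal_on (crossings Gp Gm) e t"
      using cd(3,6) ce unfolding extremal_on_def by auto
    show "extremal_on (crossings Gp Gm) f u"
      using cd(4,7) df unfolding extremal_on_def by auto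
  qed (use cd in auto)
qed

theorem theorem1p5:
  fixes S :: "'a topology" and Gp Gm :: "'a embedded_graph"
  assumes "is_two_sphere S \<or> is_projective_plane S"
    and "normal_pair S Gp Gm"
    and "support Gp \<inter> support Gm \<noteq> {}"
  shows "width Gp Gm = 2"
proof (rule antisym)
  show "2 \<le> width Gp Gm" by (rule width_ge_2[OF assms(2)])
  obtain e f t u where ef: "e \<in> edges Gp" "f \<in> edges Gm" "t \<in> {0..1}" "u \<in> {0..1}" "e t = f u"
    and ext: "extremal_on (crossings Gp Gm) e t"
      "extremal_on (crossings Gp Gm) f u"
    by (rule exists_extremal_crossing[OF assms]) (rule that)
  have "e t \<in> support Gp" "f u \<in> support Gm" using ef(1-4) unfolding support_def by blast+
  then have x: "e t \<in> crossings Gp Gm" "f u \<in> crossings Gp Gm" using ef(5) by auto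
  obtain v where v: "v \<in> verts Gp" "(v, e t) \<in> adjacency (common_refinement Gp Gm)"
    using extremal_piece[OF assms(2) _ ef(1,3) x(1) ext(1)] by blast
  obtain w where w: "w \<in> verts Gm" "(f u, w) \<in> adjacency (common_refinement Gp Gm)"
    using extremal_piece[OF assms(2) _ ef(2,4) x(2) ext(2)] by blast
  have "(v, w) \<in> adjacency (common_refinement Gp Gm) ^^ 2"
    using v(2) w(2) ef(5) by (auto simp: numeral_2_eq_2)
  then have "graph_distance (common_refinement Gp Gm) v w \<le> enat 2"
    unfolding graph_distance_def by (intro INF_lower) simp
  then have "graph_distance (common_refinement Gp Gm) v w \<le> 2" by (simp add: numeral_eq_enat)
  then show "width Gp Gm \<le> 2"
    unfolding width_def using v(1) w(1) by (meson INF_lower2)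
qed

end
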